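(* The categories $SIC$ and $LIC$ are dual (i.e. $SIC$ is equivalent to the opposite category of $LIC$).
   Context: A topological space is spectral if it is sober (every irreducible closed set is the closure of a unique singleton), compact, and its compact open subsets form a basis of the topology closed under intersections of any two members. A spectral map is a map between spectral spaces such that inverse images of compact open sets are compact open. For a finite set $Y$, a rational polyhedron in $[0,1]^Y$ is a finite union of rational simplexes (convex envelopes of finitely many affinely independent rational points); a cylinder rational polyhedron of $[0,1]^k$ is a set $\{f\in[0,1]^k : f|_Y\in P_0\}$ with $Y\subseteq k$ finite and $P_0\subseteq[0,1]^Y$ a rational polyhedron; $\mathrm{Cypol}(k)$ is the lattice of these sets under inclusion. A space $X$ is cylinder based if it is spectral and its lattice of compact open sets is anti-isomorphic to $\mathrm{Cypol}(k)$ for some cardinal $k$, possibly infinite. $SIC$ is the category whose objects are triples $(X,C,m)$ where $X$ is a cylinder based topological space, $C$ is a spectral space, and $m:C\to X$ is a monomorphic spectral map preserving closed sets (images of closed sets are closed). A morphism from $(X,C,m)$ to $(Y,D,n)$ is a pair of spectral maps $s:X\to Y$, $t:C\to D$ with $s\circ m=n\circ t$. For an MV-algebra $A$, the Belluce lattice $\beta(A)$ is the bounded distributive lattice $A/\!\sim$ where $x\sim y$ if $x$ and $y$ belong to the same prime ideals of $A$ (with operations induced by $\vee,\wedge$). The Stone dual of a bounded distributive lattice $L$ is $\mathrm{Spec}(L)$, the set of prime ideals of $L$ with topology generated by the sets $\{P : a\notin P\}$, $a\in L$; the Stone dual of a homomorphism $f:L\to L'$ is $f^{-1}:\mathrm{Spec}(L')\to\mathrm{Spec}(L)$.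 $LIC$ ("lattices in context") is the category whose objects are triples $(\beta(\mathrm{Free}),L,f)$ where $\mathrm{Free}$ is a free MV-algebra (over any cardinal number of generators), $L$ is a bounded distributive lattice, and $f:\beta(\mathrm{Free})\to L$ is a lattice epimorphism such that the Stone dual of $f$ preserves closed sets. A morphism from $(\beta(\mathrm{Free}_1),L_1,f)$ to $(\beta(\mathrm{Free}_2),L_2,g)$ is a pair of lattice homomorphisms $s:\beta(\mathrm{Free}_1)\to\beta(\mathrm{Free}_2)$, $t:L_1\to L_2$ with $g\circ s=t\circ f$. Lattice homomorphisms preserve $0$ and $1$. *)

theory Defs
  imports
    "HOL-Analysis.Abstract_Topology"
    "HOL-Algebra.Lattice"
    "HOL-Library.Equipollence"
begin

section \<open>Categories and equivalence of categories\<close>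

text \<open>
  A category is given by its set of objects and its hom-sets. Hom-sets for different pairs of
  objects may overlap as sets, so identities and composition carry the objects as arguments:
  \<open>Comp C A B D g f\<close> is \<open>g\<close> after \<open>f\<close> for \<open>f : A \<rightarrow> B\<close> and \<open>g : B \<rightarrow> D\<close>.
\<close>

record ('o, 'm) category =
  Obj :: "'o set"
  Hom :: "'o \<Rightarrow> 'o \<Rightarrow> 'm set"
  Ident :: "'o \<Rightarrow> 'm"
  Comp :: "'o \<Rightarrow> 'o \<Rightarrow> 'o \<Rightarrow> 'm \<Rightarrow> 'm \<Rightarrow> 'm"

locale is_category =
  fixes C :: "('o, 'm) category"
  assumes Ident_in_Hom: "A \<in> Obj C \<Longrightarrow> Ident C A \<in> Hom C A A"
    and Comp_in_Hom:
      "\<lbrakk>A \<in> Obj C; B \<in> Obj C; D \<in> Obj C; f \<in> Hom C A B; g \<in> Hom C B D\<rbrakk>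
        \<Longrightarrow> Comp C A B D g f \<in> Hom C A D"
    and Comp_Ident_right:
      "\<lbrakk>A \<in> Obj C; B \<in> Obj C; f \<in> Hom C A B\<rbrakk> \<Longrightarrow> Comp C A A B f (Ident C A) = f"
    and Comp_Ident_left:
      "\<lbrakk>A \<in> Obj C; B \<in> Obj C; f \<in> Hom C A B\<rbrakk> \<Longrightarrow> Comp C A B B (Ident C B) f = f"
    and Comp_assoc:
      "\<lbrakk>A \<in> Obj C; B \<in> Obj C; D \<in> Obj C; E \<in> Obj C;
        f \<in> Hom C A B; g \<in> Hom C B D; h \<in> Hom C D E\<rbrakk>
        \<Longrightarrow> Comp C A D E h (Comp C A B D g f) = Comp C A B E (Comp C B D E h g) f"

definition opposite :: "('o, 'm) category \<Rightarrow> ('o, 'm) category" where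
  "opposite C =
    \<lparr>Obj = Obj C,
     Hom = (\<lambda>A B. Hom C B A),
     Ident = Ident C,
     Comp = (\<lambda>A B D g f. Comp C D B A f g)\<rparr>"

locale is_functor =
  fixes C :: "('o, 'm) category" and D :: "('p, 'n) category"
    and Fo :: "'o \<Rightarrow> 'p" and Fm :: "'o \<Rightarrow> 'o \<Rightarrow> 'm \<Rightarrow> 'n"
  assumes functor_Obj: "A \<in> Obj C \<Longrightarrow> Fo A \<in> Obj D"
    and functor_Hom:
      "\<lbrakk>A \<in> Obj C; B \<in> Obj C; f \<in> Hom C A B\<rbrakk> \<Longrightarrow> Fm A B f \<in> Hom D (Fo A) (Fo B)"
    and functor_Ident: "A \<in> Obj C \<Longrightarrow> Fm A A (Ident C A) = Ident D (Fo A)"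
    and functor_Comp:
      "\<lbrakk>A \<in> Obj C; B \<in> Obj C; E \<in> Obj C; f \<in> Hom C A B; g \<in> Hom C B E\<rbrakk>
        \<Longrightarrow> Fm A E (Comp C A B E g f) = Comp D (Fo A) (Fo B) (Fo E) (Fm B E g) (Fm A B f)"

definition isomorphism_in :: "('o, 'm) category \<Rightarrow> 'o \<Rightarrow> 'o \<Rightarrow> 'm \<Rightarrow> bool" where
  "isomorphism_in C A B f \<longleftrightarrow>
    f \<in> Hom C A B \<and>
    (\<exists>g \<in> Hom C B A. Comp C A B A g f = Ident C A \<and> Comp C B A B f g = Ident C B)"

definition natural_isomorphism ::
  "('o, 'm) category \<Rightarrow> ('p, 'n) category \<Rightarrow> ('o \<Rightarrow> 'p) \<Rightarrow> ('o \<Rightarrow> 'o \<Rightarrow> 'm \<Rightarrow> 'n) \<Rightarrow>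
    ('o \<Rightarrow> 'p) \<Rightarrow> ('o \<Rightarrow> 'o \<Rightarrow> 'm \<Rightarrow> 'n) \<Rightarrow> ('o \<Rightarrow> 'n) \<Rightarrow> bool" where
  "natural_isomorphism C D Fo Fm Go Gm \<eta> \<longleftrightarrow>
    (\<forall>A \<in> Obj C. isomorphism_in D (Fo A) (Go A) (\<eta> A)) \<and>
    (\<forall>A \<in> Obj C. \<forall>B \<in> Obj C. \<forall>f \<in> Hom C A B.
      Comp D (Fo A) (Fo B) (Go B) (\<eta> B) (Fm A B f) =
      Comp D (Fo A) (Go A) (Go B) (Gm A B f) (\<eta> A))"

definition equivalent_categories :: "('o, 'm) category \<Rightarrow> ('p, 'n) category \<Rightarrow> bool" where
  "equivalent_categories C D \<longleftrightarrow>
    is_category C \<and> is_category D \<and>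
    (\<exists>Fo Fm Go Gm \<eta> \<epsilon>.
      is_functor C D Fo Fm \<and> is_functor D C Go Gm \<and>
      natural_isomorphism C C (\<lambda>A. A) (\<lambda>A B f. f)
        (\<lambda>A. Go (Fo A)) (\<lambda>A B f. Gm (Fo A) (Fo B) (Fm A B f)) \<eta> \<and>
      natural_isomorphism D D (\<lambda>A. Fo (Go A)) (\<lambda>A B f. Fm (Go A) (Go B) (Gm A B f))
        (\<lambda>A. A) (\<lambda>A B f. f) \<epsilon>)"


section \<open>Spectral spaces and spectral maps\<close>

definition irreducible_closedin :: "'a topology \<Rightarrow> 'a set \<Rightarrow> bool" where
  "irreducible_closedin X S \<longleftrightarrow>
    closedin X S \<and> S \<noteq> {} \<and>
    (\<forall>A B. closedin X A \<and> closedin X B \<and> S = A \<union> B \<longrightarrow> A = S \<or> B = S)"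

definition sober_space :: "'a topology \<Rightarrow> bool" where
  "sober_space X \<longleftrightarrow>
    (\<forall>S. irreducible_closedin X S \<longrightarrow> (\<exists>!x. x \<in> topspace X \<and> X closure_of {x} = S))"

definition compact_openin :: "'a topology \<Rightarrow> 'a set \<Rightarrow> bool" where
  "compact_openin X U \<longleftrightarrow> openin X U \<and> compactin X U"

definition spectral_space :: "'a topology \<Rightarrow> bool" where
  "spectral_space X \<longleftrightarrow>
    sober_space X \<and> compact_space X \<and>
    openin X = arbitrary union_of (compact_openin X) \<and>
    (\<forall>U V. compact_openin X U \<and> compact_openin X V \<longrightarrow> compact_openin X (U \<inter> V))"

text \<open>
  Maps are extensional (\<open>undefined\<close> outside their domain), so that equality of maps is equality of
  their values on the domain.
\<close>

definition spectral_maps :: "'a topology \<Rightarrow> 'b topology \<Rightarrow> ('a \<Rightarrow> 'b) set" where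
  "spectral_maps X Y =
    {f \<in> topspace X \<rightarrow>\<^sub>E topspace Y.
      \<forall>U. compact_openin Y U \<longrightarrow> compact_openin X {x \<in> topspace X. f x \<in> U}}"

text \<open>
  Monomorphisms of the category of spectral spaces on the type of the domain. (Already the
  one-point test space forces injectivity, so larger types of test spaces give the same maps.)
\<close>

definition spectral_mono :: "'a topology \<Rightarrow> 'b topology \<Rightarrow> ('a \<Rightarrow> 'b) \<Rightarrow> bool" where
  "spectral_mono C X m \<longleftrightarrow>
    m \<in> spectral_maps C X \<and>
    (\<forall>T :: 'a topology. spectral_space T \<longrightarrow>
      (\<forall>g \<in> spectral_maps T C. \<forall>h \<in> spectral_maps T C.
        compose (topspace T) m g = compose (topspace T) m h \<longrightarrow> g = h))"


section \<open>Cylinder rational polyhedra\<close>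

text \<open>The cube \<open>[0,1]\<^sup>Y\<close> is \<open>Y \<rightarrow>\<^sub>E {0..1}\<close>; its points are \<open>undefined\<close> outside \<open>Y\<close>.\<close>

definition affinely_independent_on :: "'k set \<Rightarrow> ('k \<Rightarrow> real) set \<Rightarrow> bool" where
  "affinely_independent_on Y V \<longleftrightarrow>
    (\<forall>c. (\<Sum>v\<in>V. c v) = 0 \<and> (\<forall>y\<in>Y. (\<Sum>v\<in>V. c v * v y) = 0) \<longrightarrow> (\<forall>v\<in>V. c v = 0))"

definition convex_envelope_on :: "'k set \<Rightarrow> ('k \<Rightarrow> real) set \<Rightarrow> ('k \<Rightarrow> real) set" where
  "convex_envelope_on Y V =
    {(\<lambda>y\<in>Y. \<Sum>v\<in>V. c v * v y) | c. (\<forall>v\<in>V. 0 \<le> c v) \<and> (\<Sum>v\<in>V. c v) = 1}"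

definition rational_simplex :: "'k set \<Rightarrow> ('k \<Rightarrow> real) set \<Rightarrow> bool" where
  "rational_simplex Y S \<longleftrightarrow>
    (\<exists>V. finite V \<and> V \<subseteq> Y \<rightarrow>\<^sub>E {0..1} \<inter> \<rat> \<and>
      affinely_independent_on Y V \<and> S = convex_envelope_on Y V)"

definition rational_polyhedron :: "'k set \<Rightarrow> ('k \<Rightarrow> real) set \<Rightarrow> bool" where
  "rational_polyhedron Y P \<longleftrightarrow>
    (\<exists>\<S>. finite \<S> \<and> (\<forall>S\<in>\<S>. rational_simplex Y S) \<and> P = \<Union>\<S>)"

definition cylinder_polyhedra :: "'k set \<Rightarrow> ('k \<Rightarrow> real) set set" where
  "cylinder_polyhedra K =
    {{f \<in> K \<rightarrow>\<^sub>E {0..1}. restrict f Y \<in> P} | Y P.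
      finite Y \<and> Y \<subseteq> K \<and> rational_polyhedron Y P}"

definition inclusion_order :: "'a set set \<Rightarrow> 'a set gorder" where
  "inclusion_order \<A> = \<lparr>carrier = \<A>, eq = (=), le = (\<subseteq>)\<rparr>"

definition Cypol :: "'k set \<Rightarrow> ('k \<Rightarrow> real) set gorder" where
  "Cypol K = inclusion_order (cylinder_polyhedra K)"

definition compact_opens :: "'a topology \<Rightarrow> 'a set gorder" where
  "compact_opens X = inclusion_order {U. compact_openin X U}"

definition lattices_isomorphic :: "'a gorder \<Rightarrow> 'b gorder \<Rightarrow> bool" where
  "lattices_isomorphic L M \<longleftrightarrow>
    (\<exists>f. bij_betw f (carrier L) (carrier M) \<and>
      (\<forall>x \<in> carrier L. \<forall>y \<in> carrier L. x \<sqsubseteq>\<^bsub>L\<^esub> y \<longleftrightarrow> f x \<sqsubseteq>\<^bsub>M\<^esub> f y))"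

text \<open>
  A cardinal \<open>k\<close> is represented by a set \<open>K\<close> of that cardinality; \<open>\<K>\<close> is the collection of the
  admitted index sets. With \<open>\<K> = UNIV\<close> every cardinal up to that of the type \<open>'k\<close> occurs.
\<close>

definition cylinder_based :: "'k set set \<Rightarrow> 'a topology \<Rightarrow> bool" where
  "cylinder_based \<K> X \<longleftrightarrow>
    spectral_space X \<and> (\<exists>K\<in>\<K>. lattices_isomorphic (compact_opens X) (inv_gorder (Cypol K)))"


section \<open>The category SIC\<close>

text \<open>
  The type \<open>'u\<close> is the universe in which all the spaces \<open>X\<close>, \<open>C\<close> of SIC and the lattices \<open>L\<close> of LIC
  live; they are carried by arbitrary subsets of it. It has to be large relative to \<open>\<K>\<close>: a cylinder
  based space for \<open>K \<noteq> {}\<close> has the cardinality of the power set of \<open>K <+> (UNIV :: nat set)\<close>.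
\<close>

type_synonym 'u sic_object = "'u topology \<times> 'u topology \<times> ('u \<Rightarrow> 'u)"
type_synonym 'u sic_morphism = "('u \<Rightarrow> 'u) \<times> ('u \<Rightarrow> 'u)"

definition SIC :: "'k set set \<Rightarrow> ('u sic_object, 'u sic_morphism) category" where
  "SIC \<K> =
    \<lparr>Obj = {(X, C, m).
       cylinder_based \<K> X \<and> spectral_space C \<and> spectral_mono C X m \<and> closed_map C X m},
     Hom = (\<lambda>(X, C, m) (Y, D, n).
       {(s, t). s \<in> spectral_maps X Y \<and> t \<in> spectral_maps C D \<and>
         compose (topspace C) s m = compose (topspace C) n t}),
     Ident = (\<lambda>(X, C, m). (\<lambda>x\<in>topspace X. x, \<lambda>x\<in>topspace C. x)),
     Comp = (\<lambda>(X, C, m) _ _ (s', t') (s, t).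
       (compose (topspace X) s' s, compose (topspace C) t' t))\<rparr>"


section \<open>MV-algebras and free MV-algebras\<close>

record 'a mv = "'a partial_object" +
  mv_plus :: "'a \<Rightarrow> 'a \<Rightarrow> 'a" (infixl \<open>\<boxplus>\<index>\<close> 65)
  mv_neg :: "'a \<Rightarrow> 'a" (\<open>\<ominus>\<index> _\<close> [81] 80)
  mv_zero :: 'a (\<open>\<zero>\<index>\<close>)

locale mv_algebra =
  fixes A (structure)
  assumes plus_closed: "\<lbrakk>x \<in> carrier A; y \<in> carrier A\<rbrakk> \<Longrightarrow> x \<boxplus> y \<in> carrier A"
    and neg_closed: "x \<in> carrier A \<Longrightarrow> \<ominus> x \<in> carrier A"
    and zero_closed: "\<zero> \<in> carrier A"
    and plus_assoc:
      "\<lbrakk>x \<in> carrier A; y \<in> carrier A; z \<in> carrier A\<rbrakk> \<Longrightarrow> (x \<boxplus> y) \<boxplus> z = x \<boxplus> (y \<boxplus> z)"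
    and plus_comm: "\<lbrakk>x \<in> carrier A; y \<in> carrier A\<rbrakk> \<Longrightarrow> x \<boxplus> y = y \<boxplus> x"
    and plus_zero: "x \<in> carrier A \<Longrightarrow> x \<boxplus> \<zero> = x"
    and neg_neg: "x \<in> carrier A \<Longrightarrow> \<ominus> (\<ominus> x) = x"
    and plus_one: "x \<in> carrier A \<Longrightarrow> x \<boxplus> \<ominus> \<zero> = \<ominus> \<zero>"
    and lukasiewicz:
      "\<lbrakk>x \<in> carrier A; y \<in> carrier A\<rbrakk> \<Longrightarrow> \<ominus> (\<ominus> x \<boxplus> y) \<boxplus> y = \<ominus> (\<ominus> y \<boxplus> x) \<boxplus> x"

definition mv_join :: "('a, 'b) mv_scheme \<Rightarrow> 'a \<Rightarrow> 'a \<Rightarrow> 'a" where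
  "mv_join A x y = \<ominus>\<^bsub>A\<^esub> (\<ominus>\<^bsub>A\<^esub> x \<boxplus>\<^bsub>A\<^esub> y) \<boxplus>\<^bsub>A\<^esub> y"

definition mv_meet :: "('a, 'b) mv_scheme \<Rightarrow> 'a \<Rightarrow> 'a \<Rightarrow> 'a" where
  "mv_meet A x y = \<ominus>\<^bsub>A\<^esub> (mv_join A (\<ominus>\<^bsub>A\<^esub> x) (\<ominus>\<^bsub>A\<^esub> y))"

definition mv_le :: "('a, 'b) mv_scheme \<Rightarrow> 'a \<Rightarrow> 'a \<Rightarrow> bool" where
  "mv_le A x y \<longleftrightarrow> \<ominus>\<^bsub>A\<^esub> x \<boxplus>\<^bsub>A\<^esub> y = \<ominus>\<^bsub>A\<^esub> \<zero>\<^bsub>A\<^esub>"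

definition mv_homs :: "('a, 'c) mv_scheme \<Rightarrow> ('b, 'd) mv_scheme \<Rightarrow> ('a \<Rightarrow> 'b) set" where
  "mv_homs A B =
    {f \<in> carrier A \<rightarrow>\<^sub>E carrier B.
      (\<forall>x \<in> carrier A. \<forall>y \<in> carrier A. f (x \<boxplus>\<^bsub>A\<^esub> y) = f x \<boxplus>\<^bsub>B\<^esub> f y) \<and>
      (\<forall>x \<in> carrier A. f (\<ominus>\<^bsub>A\<^esub> x) = \<ominus>\<^bsub>B\<^esub> f x) \<and> f \<zero>\<^bsub>A\<^esub> = \<zero>\<^bsub>B\<^esub>}"

datatype 'k mv_term = Gen 'k | Zero | Neg "'k mv_term" | Plus "'k mv_term" "'k mv_term"

definition mv_terms :: "'k set \<Rightarrow> 'k mv_term set" where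
  "mv_terms K = {t. set_mv_term t \<subseteq> K}"

text \<open>
  The congruence on the terms over \<open>K\<close> generated by the MV-algebra axioms; the free MV-algebra over
  \<open>K\<close> is the quotient of the term algebra.
\<close>

inductive_set mv_cong :: "'k set \<Rightarrow> ('k mv_term \<times> 'k mv_term) set" for K :: "'k set" where
  refl: "s \<in> mv_terms K \<Longrightarrow> (s, s) \<in> mv_cong K"
| sym: "(s, t) \<in> mv_cong K \<Longrightarrow> (t, s) \<in> mv_cong K"
| trans: "(s, t) \<in> mv_cong K \<Longrightarrow> (t, u) \<in> mv_cong K \<Longrightarrow> (s, u) \<in> mv_cong K"
| Neg: "(s, t) \<in> mv_cong K \<Longrightarrow> (Neg s, Neg t) \<in> mv_cong K"
| Plus: "(s, t) \<in> mv_cong K \<Longrightarrow> (u, v) \<in> mv_cong K \<Longrightarrow> (Plus s u, Plus t v) \<in> mv_cong K"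
| assoc: "s \<in> mv_terms K \<Longrightarrow> t \<in> mv_terms K \<Longrightarrow> u \<in> mv_terms K \<Longrightarrow>
    (Plus (Plus s t) u, Plus s (Plus t u)) \<in> mv_cong K"
| comm: "s \<in> mv_terms K \<Longrightarrow> t \<in> mv_terms K \<Longrightarrow> (Plus s t, Plus t s) \<in> mv_cong K"
| zero: "s \<in> mv_terms K \<Longrightarrow> (Plus s Zero, s) \<in> mv_cong K"
| negneg: "s \<in> mv_terms K \<Longrightarrow> (Neg (Neg s), s) \<in> mv_cong K"
| one: "s \<in> mv_terms K \<Longrightarrow> (Plus s (Neg Zero), Neg Zero) \<in> mv_cong K"
| luk: "s \<in> mv_terms K \<Longrightarrow> t \<in> mv_terms K \<Longrightarrow>
    (Plus (Neg (Plus (Neg s) t)) t, Plus (Neg (Plus (Neg t) s)) s) \<in> mv_cong K"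

definition free_mv :: "'k set \<Rightarrow> 'k mv_term set mv" where
  "free_mv K =
    \<lparr>carrier = mv_terms K // mv_cong K,
     mv_plus = (\<lambda>S T. \<Union>s\<in>S. \<Union>t\<in>T. mv_cong K `` {Plus s t}),
     mv_neg = (\<lambda>S. \<Union>s\<in>S. mv_cong K `` {Neg s}),
     mv_zero = mv_cong K `` {Zero}\<rparr>"

lemma mv_terms_simps [simp]:
  "Gen k \<in> mv_terms K \<longleftrightarrow> k \<in> K"
  "Zero \<in> mv_terms K"
  "Neg s \<in> mv_terms K \<longleftrightarrow> s \<in> mv_terms K"
  "Plus s t \<in> mv_terms K \<longleftrightarrow> s \<in> mv_terms K \<and> t \<in> mv_terms K"
  by (auto simp: mv_terms_def)

lemma mv_cong_in_terms: "(s, t) \<in> mv_cong K \<Longrightarrow> s \<in> mv_terms K \<and> t \<in> mv_terms K"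
  by (induction rule: mv_cong.induct) auto

lemma equiv_mv_cong: "equiv (mv_terms K) (mv_cong K)"
  by (rule equivI)
    (auto intro!: refl_onI symI transI intro: mv_cong.refl mv_cong.sym mv_cong.trans
      dest: mv_cong_in_terms)

lemma free_mv_plus:
  assumes "s \<in> mv_terms K" "t \<in> mv_terms K"
  shows "mv_cong K `` {s} \<boxplus>\<^bsub>free_mv K\<^esub> mv_cong K `` {t} = mv_cong K `` {Plus s t}"
proof -
  have "(\<lambda>s t. mv_cong K `` {Plus s t}) respects2 mv_cong K"
    by (intro congruent2I' equiv_class_eq[OF equiv_mv_cong]) (rule mv_cong.Plus)
  then show ?thesis
    using assms by (simp add: free_mv_def UN_equiv_class2[OF equiv_mv_cong equiv_mv_cong])
qed

lemma free_mv_neg: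
  assumes "s \<in> mv_terms K"
  shows "\<ominus>\<^bsub>free_mv K\<^esub> (mv_cong K `` {s}) = mv_cong K `` {Neg s}"
proof -
  have "(\<lambda>s. mv_cong K `` {Neg s}) respects mv_cong K"
    by (intro congruentI equiv_class_eq[OF equiv_mv_cong]) (rule mv_cong.Neg)
  then show ?thesis
    using assms by (simp add: free_mv_def UN_equiv_class[OF equiv_mv_cong])
qed

lemma free_mv_zero: "\<zero>\<^bsub>free_mv K\<^esub> = mv_cong K `` {Zero}"
  by (simp add: free_mv_def)

lemma free_mv_carrierE:
  assumes "x \<in> carrier (free_mv K)"
  obtains s where "s \<in> mv_terms K" "x = mv_cong K `` {s}"
  using assms by (auto simp: free_mv_def elim: quotientE)

lemma free_mv_carrierI: "s \<in> mv_terms K \<Longrightarrow> mv_cong K `` {s} \<in> carrier (free_mv K)"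
  by (simp add: free_mv_def quotientI)

proposition mv_algebra_free_mv: "mv_algebra (free_mv K)"
proof -
  note class_eq = equiv_class_eq[OF equiv_mv_cong]
  note ops = free_mv_plus free_mv_neg free_mv_zero free_mv_carrierI
  show ?thesis
  proof (unfold_locales, goal_cases)
    case (4 x y z)
    then show ?case
      by (elim free_mv_carrierE) (simp add: ops mv_cong.assoc[THEN class_eq])
  next
    case (5 x y)
    then show ?case
      by (elim free_mv_carrierE) (simp add: ops mv_cong.comm[THEN class_eq])
  next
    case (6 x)
    then show ?case
      by (elim free_mv_carrierE) (simp add: ops mv_cong.zero[THEN class_eq])
  next
    case (7 x)
    then show ?case
      by (elim free_mv_carrierE) (simp add: ops mv_cong.negneg[THEN class_eq])
  next
    case (8 x)
    then show ?case
      by (elim free_mv_carrierE) (simp add: ops mv_cong.one[THEN class_eq])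
  next
    case (9 x y)
    then show ?case
      by (elim free_mv_carrierE) (simp add: ops mv_cong.luk[THEN class_eq])
  qed (auto simp: ops elim!: free_mv_carrierE)
qed

primrec mv_eval :: "('a, 'b) mv_scheme \<Rightarrow> ('k \<Rightarrow> 'a) \<Rightarrow> 'k mv_term \<Rightarrow> 'a" where
  "mv_eval A h (Gen k) = h k"
| "mv_eval A h Zero = \<zero>\<^bsub>A\<^esub>"
| "mv_eval A h (Neg s) = \<ominus>\<^bsub>A\<^esub> mv_eval A h s"
| "mv_eval A h (Plus s t) = mv_eval A h s \<boxplus>\<^bsub>A\<^esub> mv_eval A h t"

text \<open>The universal property of \<open>free_mv K\<close>.\<close>

proposition free_mv_universal:
  assumes A: "mv_algebra A" and h: "h \<in> K \<rightarrow> carrier A"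
  shows "\<exists>!g. g \<in> mv_homs (free_mv K) A \<and> (\<forall>k\<in>K. g (mv_cong K `` {Gen k}) = h k)"
proof -
  interpret mv_algebra A by (rule A)
  have cl: "mv_eval A h s \<in> carrier A" if "s \<in> mv_terms K" for s
    using that h by (induction s) (auto intro: plus_closed neg_closed zero_closed)
  have cong: "mv_eval A h s = mv_eval A h t" if "(s, t) \<in> mv_cong K" for s t
    using that
  proof (induction rule: mv_cong.induct)
    case (comm s t)
    then show ?case by (simp add: cl plus_comm)
  next
    case (luk s t)
    then show ?case by (simp only: mv_eval.simps lukasiewicz cl)
  qed (simp_all add: cl plus_assoc plus_zero neg_neg plus_one)
  define g where "g = (\<lambda>S\<in>carrier (free_mv K). the_elem (mv_eval A h ` S))"
  have g: "g (mv_cong K `` {s}) = mv_eval A h s" if s: "s \<in> mv_terms K" for s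
  proof -
    have "s \<in> mv_cong K `` {s}"
      using s by (simp add: mv_cong.refl)
    then have "the_elem (mv_eval A h ` (mv_cong K `` {s})) = mv_eval A h s"
    proof (intro the_elem_image_unique)
      fix t assume "t \<in> mv_cong K `` {s}"
      then have "(s, t) \<in> mv_cong K" by simp
      then show "mv_eval A h t = mv_eval A h s" by (rule cong[symmetric])
    qed blast
    then show ?thesis
      using s by (simp only: g_def restrict_apply free_mv_carrierI if_True)
  qed
  have carrier_free: "x \<in> carrier (free_mv K) \<longleftrightarrow> (\<exists>s\<in>mv_terms K. x = mv_cong K `` {s})" for x
    by (blast elim: free_mv_carrierE intro: free_mv_carrierI)
  have "g \<in> extensional (carrier (free_mv K))"
    by (simp add: g_def)
  then have g_hom: "g \<in> mv_homs (free_mv K) A"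
    by (auto simp: mv_homs_def PiE_def carrier_free g free_mv_plus free_mv_neg free_mv_zero cl)
  have unique: "g' = g"
    if g': "g' \<in> mv_homs (free_mv K) A" "\<forall>k\<in>K. g' (mv_cong K `` {Gen k}) = h k" for g'
  proof -
    note hom = g'(1)[unfolded mv_homs_def, simplified]
    have "g' (mv_cong K `` {s}) = mv_eval A h s" if "s \<in> mv_terms K" for s
      using that
    proof (induction s)
      case (Neg s)
      then show ?case
        using hom by (simp flip: free_mv_neg add: free_mv_carrierI)
    next
      case (Plus s t)
      then show ?case
        using hom by (simp flip: free_mv_plus add: free_mv_carrierI)
    qed (use g' hom in \<open>auto simp flip: free_mv_zero\<close>)
    then show "g' = g"
      using g'(1) g_hom
      by (intro extensionalityI[of _ "carrier (free_mv K)"])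
        (auto simp: mv_homs_def PiE_def carrier_free g)
  qed
  show ?thesis
  proof (rule ex1I[of _ g])
    show "g \<in> mv_homs (free_mv K) A \<and> (\<forall>k\<in>K. g (mv_cong K `` {Gen k}) = h k)"
      using g_hom by (simp add: g)
  qed (use unique in blast)
qed


section \<open>The Belluce lattice\<close>

definition mv_ideal :: "('a, 'b) mv_scheme \<Rightarrow> 'a set \<Rightarrow> bool" where
  "mv_ideal A I \<longleftrightarrow>
    I \<subseteq> carrier A \<and> \<zero>\<^bsub>A\<^esub> \<in> I \<and>
    (\<forall>x\<in>I. \<forall>y\<in>I. x \<boxplus>\<^bsub>A\<^esub> y \<in> I) \<and>
    (\<forall>x\<in>I. \<forall>y\<in>carrier A. mv_le A y x \<longrightarrow> y \<in> I)"

definition mv_prime_ideal :: "('a, 'b) mv_scheme \<Rightarrow> 'a set \<Rightarrow> bool" where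
  "mv_prime_ideal A P \<longleftrightarrow>
    mv_ideal A P \<and> P \<noteq> carrier A \<and>
    (\<forall>x\<in>carrier A. \<forall>y\<in>carrier A. mv_meet A x y \<in> P \<longrightarrow> x \<in> P \<or> y \<in> P)"

definition belluce_rel :: "('a, 'b) mv_scheme \<Rightarrow> ('a \<times> 'a) set" where
  "belluce_rel A =
    {(x, y). x \<in> carrier A \<and> y \<in> carrier A \<and> (\<forall>P. mv_prime_ideal A P \<longrightarrow> (x \<in> P \<longleftrightarrow> y \<in> P))}"

text \<open>
  The lattices of HOL-Algebra are given by their order; that of the Belluce lattice is the one of
  the induced meet: \<open>[x] \<sqsubseteq> [y]\<close> iff \<open>[x \<and> y] = [x]\<close>.
\<close>

definition belluce :: "('a, 'b) mv_scheme \<Rightarrow> 'a set gorder" where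
  "belluce A =
    \<lparr>carrier = carrier A // belluce_rel A,
     eq = (=),
     le = (\<lambda>S T. \<exists>x\<in>S. \<exists>y\<in>T. (mv_meet A x y, x) \<in> belluce_rel A)\<rparr>"


section \<open>Bounded distributive lattices and Stone duality\<close>

definition bounded_distributive_lattice :: "'a gorder \<Rightarrow> bool" where
  "bounded_distributive_lattice L \<longleftrightarrow>
    bounded_lattice L \<and>
    (\<forall>x\<in>carrier L. \<forall>y\<in>carrier L. \<forall>z\<in>carrier L.
      x \<sqinter>\<^bsub>L\<^esub> (y \<squnion>\<^bsub>L\<^esub> z) = (x \<sqinter>\<^bsub>L\<^esub> y) \<squnion>\<^bsub>L\<^esub> (x \<sqinter>\<^bsub>L\<^esub> z))"

definition lattice_homs :: "'a gorder \<Rightarrow> 'b gorder \<Rightarrow> ('a \<Rightarrow> 'b) set" where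
  "lattice_homs L M =
    {f \<in> carrier L \<rightarrow>\<^sub>E carrier M.
      join_pres L M f \<and> meet_pres L M f \<and> f \<bottom>\<^bsub>L\<^esub> = \<bottom>\<^bsub>M\<^esub> \<and> f \<top>\<^bsub>L\<^esub> = \<top>\<^bsub>M\<^esub>}"

text \<open>
  Epimorphisms of bounded distributive lattices, tested on the lattices on the type of the codomain.
  (As soon as this type has two elements, the two-element chain is among the test lattices, and
  since homomorphisms to it separate the elements of a distributive lattice, larger types of test
  lattices give the same maps.)
\<close>

definition lattice_epi :: "'a gorder \<Rightarrow> 'b gorder \<Rightarrow> ('a \<Rightarrow> 'b) \<Rightarrow> bool" where
  "lattice_epi L M f \<longleftrightarrow>
    f \<in> lattice_homs L M \<and>
    (\<forall>N :: 'b gorder. bounded_distributive_lattice N \<longrightarrow>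
      (\<forall>g \<in> lattice_homs M N. \<forall>h \<in> lattice_homs M N.
        compose (carrier L) g f = compose (carrier L) h f \<longrightarrow> g = h))"

definition prime_ideals :: "'a gorder \<Rightarrow> 'a set set" where
  "prime_ideals L =
    {P. P \<subseteq> carrier L \<and> P \<noteq> {} \<and> P \<noteq> carrier L \<and>
      (\<forall>x\<in>P. \<forall>y\<in>carrier L. y \<sqsubseteq>\<^bsub>L\<^esub> x \<longrightarrow> y \<in> P) \<and>
      (\<forall>x\<in>P. \<forall>y\<in>P. x \<squnion>\<^bsub>L\<^esub> y \<in> P) \<and>
      (\<forall>x\<in>carrier L. \<forall>y\<in>carrier L. x \<sqinter>\<^bsub>L\<^esub> y \<in> P \<longrightarrow> x \<in> P \<or> y \<in> P)}"

definition Spec :: "'a gorder \<Rightarrow> 'a set topology" where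
  "Spec L = topology_generated_by ((\<lambda>a. {P \<in> prime_ideals L. a \<notin> P}) ` carrier L)"

definition stone_dual_map :: "'a gorder \<Rightarrow> 'b gorder \<Rightarrow> ('a \<Rightarrow> 'b) \<Rightarrow> 'b set \<Rightarrow> 'a set" where
  "stone_dual_map L M f = (\<lambda>P\<in>prime_ideals M. {x \<in> carrier L. f x \<in> P})"


section \<open>The category LIC\<close>

type_synonym 'k belluce_element = "'k mv_term set set"
type_synonym ('k, 'u) lic_object = "'k belluce_element gorder \<times> 'u gorder \<times> ('k belluce_element \<Rightarrow> 'u)"
type_synonym ('k, 'u) lic_morphism = "('k belluce_element \<Rightarrow> 'k belluce_element) \<times> ('u \<Rightarrow> 'u)"

definition LIC :: "'k set set \<Rightarrow> (('k, 'u) lic_object, ('k, 'u) lic_morphism) category" where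
  "LIC \<K> =
    \<lparr>Obj = {(B, L, f).
       (\<exists>K\<in>\<K>. B = belluce (free_mv K)) \<and> bounded_distributive_lattice L \<and>
       lattice_epi B L f \<and> closed_map (Spec L) (Spec B) (stone_dual_map B L f)},
     Hom = (\<lambda>(B, L, f) (B', L', g).
       {(s, t). s \<in> lattice_homs B B' \<and> t \<in> lattice_homs L L' \<and>
         compose (carrier B) g s = compose (carrier B) t f}),
     Ident = (\<lambda>(B, L, f). (\<lambda>x\<in>carrier B. x, \<lambda>x\<in>carrier L. x)),
     Comp = (\<lambda>(B, L, f) _ _ (s', t') (s, t).
       (compose (carrier B) s' s, compose (carrier L) t' t))\<rparr>"

end

theory Submission
  imports Defs "HOL-Algebra.FiniteProduct"
begin

text \<open>
  Sending a point \<open>f\<close> of the cube to the terms vanishing at \<open>f\<close> gives prime ideals of the free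
  MV-algebra, and these suffice to separate: if a prime ideal \<open>P\<close> contains \<open>t\<close> but not \<open>s\<close>, then
  in the totally ordered quotient by \<open>P\<close>, embedded in the unit interval of Chang's ordered group, finitely
  many linear conditions with integer coefficients express that \<open>t\<close> vanishes and \<open>s\<close> does not. By
  Fourier-Motzkin elimination they are solvable over the reals as well, so some point of the cube
  annihilates \<open>t\<close> but not \<open>s\<close>. Hence the Belluce lattice of the free MV-algebra over \<open>K\<close> is
  anti-isomorphic to the lattice of zero sets of terms, and these zero sets are the cylinder rational
  polyhedra: terms are piecewise linear, and conversely half-spaces with integer coefficients are zero sets.

  The cylinder based spaces are therefore the spaces dual to the lattices \<open>belluce (free_mv K)\<close>, and
  Stone duality does the rest. A spectral map between spectral spaces amounts to a homomorphism between
  their lattices of compact open sets. A closed injective map \<open>m : C \<rightarrow> X\<close> is dual to a surjection,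
  since a compact open set \<open>U\<close> of \<open>C\<close> is the preimage of the open set \<open>X - m(C - U)\<close> and hence of a
  compact open set; dually, lattice epimorphisms give injective maps of spectra.
\<close>

section \<open>Linear forms and Fourier-Motzkin elimination\<close>

text \<open>The obstacle is a prime ideal whose quotient chain contains nonzero infinitesimals: such
  a chain does not embed into the unit interval, so no single point of the cube gives the ideal.
  What can be carried over is finite. A form with integer coefficients has a value in every abelian
  group, and elimination only adds forms and multiplies them by positive integers; division is
  confined to the field in which the solution is rebuilt. The same elimination serves twice more:
  over \<open>rat\<close> it shows that vertices are rational, and as a projection it finds
  inequalities for a simplex. Size is the second obstacle. The spaces and the lattice
  \<open>L\<close> must be carried by the universe \<open>'u\<close>, while the constructions yield
  families of open sets and sets of ideals. Closedness and injectivity of \<open>m\<close> bound the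
  compact open sets of \<open>C\<close> by the Belluce lattice, and injectivity of the dual map
  bounds the spectrum of \<open>L\<close> by that of the Belluce lattice, so injections into the
  universe exist. Duals of objects are therefore merely chosen, together with witnesses, and the
  equivalence comes from a fully faithful, essentially surjective functor.\<close>

definition lin :: "'v set \<Rightarrow> ('v \<Rightarrow> int) \<Rightarrow> ('v \<Rightarrow> 'f::linordered_field) \<Rightarrow> 'f" where
  "lin V l r = (\<Sum>v\<in>V. of_int (l v) * r v)"

type_synonym 'v constr = "('v \<Rightarrow> int) \<times> bool"

text \<open>The two sign tests are parameters, so that one and the same constraint can be read in an
  ordered field and in Chang's group.\<close>

definition holds :: "(('v \<Rightarrow> int) \<Rightarrow> bool) \<Rightarrow> (('v \<Rightarrow> int) \<Rightarrow> bool) \<Rightarrow> 'v constr \<Rightarrow> bool" where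
  "holds nn pp c \<longleftrightarrow> (if snd c then pp (fst c) else nn (fst c))"

definition sat :: "'v set \<Rightarrow> ('v \<Rightarrow> 'f::linordered_field) \<Rightarrow> 'v constr set \<Rightarrow> bool" where
  "sat V r S \<longleftrightarrow> (\<forall>c\<in>S. holds (\<lambda>l. 0 \<le> lin V l r) (\<lambda>l. 0 < lin V l r) c)"

text \<open>If \<open>fst c z\<close> is positive and \<open>fst d z\<close> negative, both
  multipliers are positive and the coefficients at \<open>z\<close> cancel. Cross-multiplying
  instead of dividing keeps the coefficients integers.\<close>

definition combine :: "'v \<Rightarrow> 'v constr \<Rightarrow> 'v constr \<Rightarrow> 'v constr" where
  "combine z c d = (\<lambda>v. (- fst d z) * fst c v + fst c z * fst d v, snd c \<or> snd d)"

definition fm_elim :: "'v \<Rightarrow> 'v constr set \<Rightarrow> 'v constr set" where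
  "fm_elim z S = {c \<in> S. fst c z = 0} \<union>
    {combine z c d | c d. c \<in> S \<and> d \<in> S \<and> 0 < fst c z \<and> fst d z < 0}"

lemma finite_fm_elim:
  assumes "finite S" shows "finite (fm_elim z S)"
proof -
  have "fm_elim z S \<subseteq> S \<union> (\<lambda>(c, d). combine z c d) ` (S \<times> S)"
    by (auto simp: fm_elim_def)
  then show ?thesis by (rule finite_subset) (use assms in simp)
qed

lemma fm_elimE:
  assumes "c \<in> fm_elim z S"
  obtains "c \<in> S" "fst c z = 0"
  | d e where "d \<in> S" "e \<in> S" "0 < fst d z" "fst e z < 0" "c = combine z d e"
  using assms unfolding fm_elim_def by blast

lemma fm_elim_coeff_zero: "c \<in> fm_elim z S \<Longrightarrow> fst c z = 0"
  by (erule fm_elimE) (simp_all add: combine_def)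

lemma fm_elim_vanish: "\<forall>c\<in>S. fst c v = 0 \<Longrightarrow> c \<in> fm_elim z S \<Longrightarrow> fst c v = 0"
  by (erule fm_elimE) (simp_all add: combine_def)

lemma fm_elim_not_strict: "\<forall>c\<in>S. \<not> snd c \<Longrightarrow> c \<in> fm_elim z S \<Longrightarrow> \<not> snd c"
  by (erule fm_elimE) (simp_all add: combine_def)

lemma lin_add: "lin V (\<lambda>v. l v + m v) r = lin V l r + lin V m r"
  by (simp add: lin_def sum.distrib algebra_simps)

lemma lin_scale: "lin V (\<lambda>v. n * l v) r = of_int n * lin V l r"
  by (simp add: lin_def sum_distrib_left algebra_simps)

lemma lin_minus: "lin V (\<lambda>v. - l v) r = - lin V l r"
  by (simp add: lin_def sum_negf)

lemma lin_diff: "lin V (\<lambda>v. l v - m v) r = lin V l r - lin V m r"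
  by (simp add: lin_def sum_subtractf algebra_simps)

lemma lin_zero [simp]: "lin V (\<lambda>v. 0) r = 0"
  by (simp add: lin_def)

lemma lin_unit: "finite V \<Longrightarrow> w \<in> V \<Longrightarrow> lin V (\<lambda>v. if v = w then n else 0) r = of_int n * r w"
  by (simp add: lin_def if_distrib[of of_int] if_distrib[of "\<lambda>x. x * _"] cong: if_cong)

lemma lin_cong: "(\<And>v. v \<in> V \<Longrightarrow> r v = r' v) \<Longrightarrow> lin V l r = lin V l r'"
  by (simp add: lin_def)

lemma lin_insert:
  "finite V \<Longrightarrow> z \<notin> V \<Longrightarrow> lin (insert z V) l r = of_int (l z) * r z + lin V l r"
  by (simp add: lin_def)

lemma lin_scale_point: "lin V l (\<lambda>v. a * r v) = a * lin V l r"
  by (simp add: lin_def sum_distrib_left algebra_simps)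

text \<open>
  \<open>nn\<close> and \<open>pp\<close> stand for the forms that are nonnegative and positive under a valuation in
  some ordered group, of which elimination uses only closure under addition.
\<close>

locale cone =
  fixes nn pp :: "('v \<Rightarrow> int) \<Rightarrow> bool"
  assumes nn_add: "nn l \<Longrightarrow> nn m \<Longrightarrow> nn (\<lambda>v. l v + m v)"
    and pp_add: "pp l \<Longrightarrow> nn m \<Longrightarrow> pp (\<lambda>v. l v + m v)"
    and pp_nn: "pp l \<Longrightarrow> nn l"
    and not_pp_zero: "\<not> pp (\<lambda>_. 0)"
begin

text \<open>A positive multiple is a repeated sum, and sums are all that a cone offers. The
  induction starts at 1, since nothing is assumed about \<open>nn\<close> at the zero form.\<close>

lemma nn_scale:
  assumes "nn l" "0 < n" shows "nn (\<lambda>v. n * l v)"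
  using assms(2)
proof (induction n rule: int_gr_induct)
  case (step i)
  then show ?case using nn_add[OF step.IH assms(1)] by (simp add: distrib_right)
qed (use assms in simp)

lemma pp_scale:
  assumes "pp l" "0 < n" shows "pp (\<lambda>v. n * l v)"
  using assms(2)
proof (induction n rule: int_gr_induct)
  case (step i)
  then show ?case using pp_add[OF step.IH pp_nn[OF assms(1)]] by (simp add: distrib_right)
qed (use assms in simp)

text \<open>Both multipliers are positive, and a sum is strict as soon as one of its summands
  is.\<close>

lemma holds_combine:
  assumes c: "holds nn pp c" "0 < fst c z" and d: "holds nn pp d" "fst d z < 0"
  shows "holds nn pp (combine z c d)"
proof -
  have pos: "0 < - fst d z" using d by simp
  have pp_add': "pp (\<lambda>v. l v + m v)" if "nn l" "pp m" for l m
    using pp_add[OF that(2,1)] by (simp add: add.commute)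
  show ?thesis
  proof (cases "snd c")
    case True
    then have "pp (\<lambda>v. (- fst d z) * fst c v)" using c pp_scale[OF _ pos] by (simp add: holds_def)
    moreover have "nn (\<lambda>v. fst c z * fst d v)"
      using d c nn_scale pp_nn by (auto simp: holds_def split: if_splits)
    ultimately have "pp (\<lambda>v. (- fst d z) * fst c v + fst c z * fst d v)" by (rule pp_add)
    then show ?thesis using True by (simp add: holds_def combine_def)
  next
    case False
    then have nn: "nn (\<lambda>v. (- fst d z) * fst c v)" using c nn_scale[OF _ pos] by (simp add: holds_def)
    show ?thesis
    proof (cases "snd d")
      case True
      then have "pp (\<lambda>v. fst c z * fst d v)" using d c pp_scale by (simp add: holds_def)
      then have "pp (\<lambda>v. (- fst d z) * fst c v + fst c z * fst d v)" by (rule pp_add'[OF nn])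
      then show ?thesis using True by (simp add: holds_def combine_def)
    next
      case False2: False
      then have "nn (\<lambda>v. fst c z * fst d v)" using d c nn_scale by (simp add: holds_def)
      then have "nn (\<lambda>v. (- fst d z) * fst c v + fst c z * fst d v)" by (rule nn_add[OF nn])
      then show ?thesis using False False2 by (simp add: holds_def combine_def)
    qed
  qed
qed

lemma holds_fm_elim: "\<forall>c\<in>S. holds nn pp c \<Longrightarrow> \<forall>c\<in>fm_elim z S. holds nn pp c"
  by (blast elim!: fm_elimE intro: holds_combine)

end

section \<open>Elimination over ordered fields\<close>

lemma cone_lin: "cone (\<lambda>l. 0 \<le> lin V l r) (\<lambda>l. 0 < lin V l r)"
  by unfold_locales (auto simp: lin_add)

text \<open>The midpoint between the greatest lower bound and the least upper bound works: if the
  two coincide, a strict bound attaining the common value would contradict \<open>le\<close>. If one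
  side is missing, a step of 1 beyond the extreme bound of the other suffices.\<close>

lemma separating_point:
  fixes q :: "'c \<Rightarrow> 'f::linordered_field"
  assumes fin: "finite P" "finite N"
    and le: "\<And>c d. c \<in> P \<Longrightarrow> d \<in> N \<Longrightarrow> q c \<le> q d \<and> (s c \<or> s d \<longrightarrow> q c < q d)"
  shows "\<exists>x. (\<forall>c\<in>P. q c \<le> x \<and> (s c \<longrightarrow> q c < x)) \<and> (\<forall>d\<in>N. x \<le> q d \<and> (s d \<longrightarrow> x < q d))"
proof -
  have up: "\<exists>c\<in>P. \<forall>c'\<in>P. q c' \<le> q c" if "P \<noteq> {}"
    using Max_in[of "q ` P"] Max_ge[of "q ` P"] fin that by fastforce
  have lo: "\<exists>d\<in>N. \<forall>d'\<in>N. q d \<le> q d'" if "N \<noteq> {}"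
    using Min_in[of "q ` N"] Min_le[of "q ` N"] fin that by fastforce
  consider "P = {}" "N = {}" | "P \<noteq> {}" "N = {}" | "P = {}" "N \<noteq> {}" | "P \<noteq> {}" "N \<noteq> {}" by blast
  then show ?thesis
  proof cases
    case 2
    then obtain c where "\<forall>c'\<in>P. q c' \<le> q c" using up by blast
    then show ?thesis using 2 by (intro exI[of _ "q c + 1"]) (auto intro: add_increasing2 le_less_trans)
  next
    case 3
    then obtain d where d: "\<forall>d'\<in>N. q d \<le> q d'" using lo by blast
    then have "\<forall>d'\<in>N. q d - 1 < q d'" by (metis diff_less_eq less_add_one order_le_less_trans add.commute less_le_trans)
    then show ?thesis using 3 by (intro exI[of _ "q d - 1"]) (auto simp: less_imp_le)
  next
    case 4
    obtain c where c: "c \<in> P" "\<forall>c'\<in>P. q c' \<le> q c" using up 4 by blast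
    obtain d where d: "d \<in> N" "\<forall>d'\<in>N. q d \<le> q d'" using lo 4 by blast
    let ?x = "(q c + q d) / 2"
    have "q c' \<le> ?x \<and> (s c' \<longrightarrow> q c' < ?x)" if "c' \<in> P" for c'
      using c(2)[rule_format, OF that] le[OF that d(1)]
      by (auto simp: field_simps)
    moreover have "?x \<le> q d' \<and> (s d' \<longrightarrow> ?x < q d')" if "d' \<in> N" for d'
      using d(2)[rule_format, OF that] le[OF c(1) that]
      by (auto simp: field_simps)
    ultimately show ?thesis by blast
  qed auto
qed

text \<open>Solved for the coordinate \<open>z\<close>, a constraint \<open>c\<close> bounds
  \<open>x\<close> by \<open>q c\<close>, from below or from above according to the sign of its
  coefficient. The combined constraints say that every lower bound is compatible with every upper
  one, which is what \<open>separating_point\<close> asks for.\<close>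

lemma fm_elim_complete:
  fixes r :: "'v \<Rightarrow> 'f::linordered_field"
  assumes fin: "finite V" "finite S" and z: "z \<notin> V" and sat: "sat V r (fm_elim z S)"
  shows "\<exists>x. sat (insert z V) (r(z := x)) S"
proof -
  define b where "b c = lin V (fst c) r" for c :: "'v constr"
  define a where "a c = (of_int (fst c z) :: 'f)" for c :: "'v constr"
  define q where "q c = - b c / a c" for c
  have le: "q c \<le> q d \<and> (snd c \<or> snd d \<longrightarrow> q c < q d)"
    if "c \<in> {c \<in> S. 0 < fst c z}" "d \<in> {d \<in> S. fst d z < 0}" for c d
  proof -
    have "combine z c d \<in> fm_elim z S" using that unfolding fm_elim_def by blast
    then have "holds (\<lambda>l. 0 \<le> lin V l r) (\<lambda>l. 0 < lin V l r) (combine z c d)"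
      using sat by (simp add: sat_def)
    moreover have "lin V (fst (combine z c d)) r = - a d * b c + a c * b d"
      using lin_add[of V "\<lambda>v. (- fst d z) * fst c v" "\<lambda>v. fst c z * fst d v" r]
      by (simp only: combine_def fst_conv lin_scale) (simp add: a_def b_def)
    ultimately have "0 \<le> - a d * b c + a c * b d \<and> (snd c \<or> snd d \<longrightarrow> 0 < - a d * b c + a c * b d)"
      by (auto simp: holds_def combine_def split: if_splits)
    moreover have "0 < a c" "a d < 0" using that by (auto simp: a_def)
    ultimately show ?thesis by (auto simp: q_def field_simps)
  qed
  obtain x where x: "\<forall>c\<in>{c \<in> S. 0 < fst c z}. q c \<le> x \<and> (snd c \<longrightarrow> q c < x)"
    "\<forall>d\<in>{d \<in> S. fst d z < 0}. x \<le> q d \<and> (snd d \<longrightarrow> x < q d)"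
    using separating_point[of "{c \<in> S. 0 < fst c z}" "{d \<in> S. fst d z < 0}" q snd] le fin by auto
  have val: "lin (insert z V) (fst c) (r(z := x)) = a c * x + b c" for c :: "'v constr"
  proof -
    have "lin V (fst c) (r(z := x)) = lin V (fst c) r"
      by (rule lin_cong) (use z in auto)
    then show ?thesis using fin z by (simp add: lin_insert a_def b_def)
  qed
  have "holds (\<lambda>l. 0 \<le> lin (insert z V) l (r(z := x))) (\<lambda>l. 0 < lin (insert z V) l (r(z := x))) c"
    if c: "c \<in> S" for c
  proof -
    consider "fst c z = 0" | "0 < fst c z" | "fst c z < 0" by linarith
    then show ?thesis
    proof cases
      case 1
      then have "c \<in> fm_elim z S" using c by (simp add: fm_elim_def)
      then show ?thesis using sat 1 by (auto simp: sat_def holds_def val b_def a_def)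
    next
      case 2
      then have "0 < a c" "q c \<le> x" "snd c \<longrightarrow> q c < x" using x(1)[rule_format, of c] c by (simp_all add: a_def)
      then show ?thesis by (auto simp: holds_def val q_def field_simps)
    next
      case 3
      then have "a c < 0" "x \<le> q c" "snd c \<longrightarrow> x < q c" using x(2)[rule_format, of c] c by (simp_all add: a_def)
      then show ?thesis by (auto simp: holds_def val q_def field_simps)
    qed
  qed
  then show ?thesis unfolding sat_def by blast
qed

text \<open>The direction that is not \<open>fm_elim_complete\<close> holds because the eliminated
  constraints follow from the original ones and do not involve \<open>z\<close>, so that the value
  \<open>x\<close> does not affect them.\<close>

lemma fm_elim_iff:
  fixes r :: "'v \<Rightarrow> 'f::linordered_field"
  assumes fin: "finite V" "finite S" and z: "z \<notin> V"
  shows "sat V r (fm_elim z S) \<longleftrightarrow> (\<exists>x. sat (insert z V) (r(z := x)) S)"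
proof
  assume "\<exists>x. sat (insert z V) (r(z := x)) S"
  then obtain x where x: "sat (insert z V) (r(z := x)) S" by blast
  interpret cone "\<lambda>l. 0 \<le> lin (insert z V) l (r(z := x))" "\<lambda>l. 0 < lin (insert z V) l (r(z := x))"
    by (rule cone_lin)
  have eq: "lin (insert z V) l (r(z := x)) = lin V l r" if "l z = 0" for l
  proof -
    have "lin V l (r(z := x)) = lin V l r"
      by (rule lin_cong) (use z in auto)
    then show ?thesis using fin z that by (simp add: lin_insert)
  qed
  show "sat V r (fm_elim z S)"
    unfolding sat_def
  proof
    fix c assume c: "c \<in> fm_elim z S"
    show "holds (\<lambda>l. 0 \<le> lin V l r) (\<lambda>l. 0 < lin V l r) c"
      using holds_fm_elim[of S z] x c unfolding holds_def sat_def
      by (metis eq[of "fst c"] fm_elim_coeff_zero[OF c])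
  qed
qed (use fm_elim_complete[OF assms] in blast)

text \<open>Elimination stays inside the cone. When no variable is left every form is zero, and
  \<open>not_pp_zero\<close> excludes a strict one, so the last system holds trivially in any field.
  Going back, each eliminated variable receives a value in the field. Thus solvability passes from
  an ordered group, or from another field, to the field at hand.\<close>

theorem (in cone) feasible:
  assumes "finite V" "finite S" "\<forall>c\<in>S. holds nn pp c" "\<forall>c\<in>S. \<forall>v. v \<notin> V \<longrightarrow> fst c v = 0"
  shows "\<exists>r :: 'v \<Rightarrow> 'f::linordered_field. sat V r S"
  using assms
proof (induction V arbitrary: S rule: finite_induct)
  case empty
  then have "fst c = (\<lambda>_. 0)" if "c \<in> S" for c using that by auto
  then have "\<not> snd c" if "c \<in> S" for c
    using empty.prems(2)[rule_format, OF that] that not_pp_zero by (metis holds_def)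
  then show ?case by (auto simp: sat_def holds_def lin_def)
next
  case (insert z V)
  have "\<exists>r :: 'v \<Rightarrow> 'f. sat V r (fm_elim z S)"
  proof (rule insert.IH)
    show "\<forall>c\<in>fm_elim z S. \<forall>v. v \<notin> V \<longrightarrow> fst c v = 0"
      using insert.prems(3) fm_elim_vanish fm_elim_coeff_zero by (metis insertE)
  qed (use insert.prems in \<open>auto intro: finite_fm_elim holds_fm_elim[rule_format]\<close>)
  then obtain r :: "'v \<Rightarrow> 'f" where "sat V r (fm_elim z S)" by blast
  from fm_elim_complete[OF insert.hyps(1) insert.prems(1) insert.hyps(2) this] show ?case by blast
qed

text \<open>One application of \<open>fm_elim_iff\<close> for each coordinate of \<open>W\<close>.
  Nonstrictness is carried along because the shadow is to be described as a closed polytope.\<close>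

theorem projection:
  assumes "finite W" "finite V" "V \<inter> W = {}" "finite S" "\<forall>c\<in>S. \<not> snd c"
  shows "\<exists>S'. finite S' \<and> (\<forall>c\<in>S'. \<not> snd c) \<and>
    (\<forall>r :: 'v \<Rightarrow> 'f::linordered_field.
      sat V r S' \<longleftrightarrow> (\<exists>r'. (\<forall>v\<in>V. r' v = r v) \<and> sat (V \<union> W) r' S))"
  using assms
proof (induction W arbitrary: S rule: finite_induct)
  case empty
  have eq: "sat V r S \<longleftrightarrow> (\<exists>r'. (\<forall>v\<in>V. r' v = r v) \<and> sat V r' S)" for r :: "'v \<Rightarrow> 'f"
  proof
    assume "\<exists>r'. (\<forall>v\<in>V. r' v = r v) \<and> sat V r' S"
    then obtain r' where r': "\<forall>v\<in>V. r' v = r v" "sat V r' S" by blast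
    have "lin V l r' = lin V l r" for l by (rule lin_cong) (use r' in auto)
    then show "sat V r S" using r' by (simp add: sat_def)
  qed blast
  show ?case
    unfolding Un_empty_right
    by (rule exI[of _ S], intro conjI allI, rule empty.prems(3), rule empty.prems(4), rule eq)
next
  case (insert z W)
  have "V \<inter> W = {}" "\<forall>c\<in>fm_elim z S. \<not> snd c"
    using insert.prems(2) fm_elim_not_strict[OF insert.prems(4)] by auto
  from insert.IH[OF insert.prems(1) this(1) finite_fm_elim[OF insert.prems(3)] this(2)]
  obtain S' where S': "finite S'" "\<forall>c\<in>S'. \<not> snd c" "\<And>r :: 'v \<Rightarrow> 'f.
      sat V r S' \<longleftrightarrow> (\<exists>r'. (\<forall>v\<in>V. r' v = r v) \<and> sat (V \<union> W) r' (fm_elim z S))"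
    by blast
  have z: "z \<notin> V \<union> W" using insert.hyps insert.prems(2) by auto
  have el: "sat (V \<union> W) r (fm_elim z S) \<longleftrightarrow> (\<exists>x. sat (V \<union> insert z W) (r(z := x)) S)" for r :: "'v \<Rightarrow> 'f"
    using fm_elim_iff[of "V \<union> W" S z r] insert.hyps(1) insert.prems(1,3) z by simp
  have "sat V r S' \<longleftrightarrow> (\<exists>r'. (\<forall>v\<in>V. r' v = r v) \<and> sat (V \<union> insert z W) r' S)" for r :: "'v \<Rightarrow> 'f"
  proof
    assume "sat V r S'"
    then obtain r' x where r': "\<forall>v\<in>V. r' v = r v" "sat (V \<union> insert z W) (r'(z := x)) S"
      unfolding S' el by blast
    then have "\<forall>v\<in>V. (r'(z := x)) v = r v" using z by auto
    then show "\<exists>r'. (\<forall>v\<in>V. r' v = r v) \<and> sat (V \<union> insert z W) r' S" using r'(2) by blast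
  next
    assume "\<exists>r'. (\<forall>v\<in>V. r' v = r v) \<and> sat (V \<union> insert z W) r' S"
    then obtain r' where r': "\<forall>v\<in>V. r' v = r v" "sat (V \<union> insert z W) (r'(z := r' z)) S"
      by auto
    then show "sat V r S'" unfolding S' el by blast
  qed
  then show ?case using S'(1,2) by blast
qed

section \<open>Rational polyhedra\<close>

lemma convex_envelope_onI:
  assumes "x \<in> extensional Y" "\<And>v. v \<in> V \<Longrightarrow> 0 \<le> c v" "(\<Sum>v\<in>V. c v) = 1"
    "\<And>y. y \<in> Y \<Longrightarrow> x y = (\<Sum>v\<in>V. c v * v y)"
  shows "x \<in> convex_envelope_on Y V"
proof -
  have "x = (\<lambda>y\<in>Y. \<Sum>v\<in>V. c v * v y)"
    using assms(1,4) by (intro extensionalityI[of _ Y]) auto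
  then show ?thesis using assms(2,3) unfolding convex_envelope_on_def by blast
qed

lemma convex_envelope_onE:
  assumes "x \<in> convex_envelope_on Y V"
  obtains c where "x \<in> extensional Y" "\<And>v. v \<in> V \<Longrightarrow> 0 \<le> c v" "(\<Sum>v\<in>V. c v) = 1"
    "\<And>y. y \<in> Y \<Longrightarrow> x y = (\<Sum>v\<in>V. c v * v y)"
proof -
  obtain c where "x = (\<lambda>y\<in>Y. \<Sum>v\<in>V. c v * v y)" "\<forall>v\<in>V. 0 \<le> c v" "(\<Sum>v\<in>V. c v) = 1"
    using assms unfolding convex_envelope_on_def by blast
  then show ?thesis by (intro that[of c]) simp_all
qed

text \<open>Among the subsets whose envelope contains \<open>x\<close> take one of least
  cardinality. An affine dependence \<open>d\<close> could be subtracted from the weights until one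
  of them vanishes, which would give a smaller subset.\<close>

lemma caratheodory_on:
  assumes fin: "finite V" and x: "x \<in> convex_envelope_on Y V"
  shows "\<exists>V' \<subseteq> V. affinely_independent_on Y V' \<and> x \<in> convex_envelope_on Y V'"
proof -
  obtain V' where V': "V' \<subseteq> V" "x \<in> convex_envelope_on Y V'"
    and min: "\<And>W. W \<subseteq> V \<Longrightarrow> x \<in> convex_envelope_on Y W \<Longrightarrow> card V' \<le> card W"
    using arg_min_nat_lemma[of "\<lambda>W. W \<subseteq> V \<and> x \<in> convex_envelope_on Y W" V card] x by blast
  have finV': "finite V'" using V' fin finite_subset by blast
  have "affinely_independent_on Y V'"
  proof (rule ccontr)
    assume "\<not> affinely_independent_on Y V'"
    then obtain d w where d: "(\<Sum>v\<in>V'. d v) = 0" "\<And>y. y \<in> Y \<Longrightarrow> (\<Sum>v\<in>V'. d v * v y) = 0"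
      and w: "w \<in> V'" "d w \<noteq> 0"
      unfolding affinely_independent_on_def by blast
    \<comment> \<open>The coefficients sum to 0 and are not all 0, so they cannot all be
      nonpositive.\<close>
    have "\<exists>v\<in>V'. 0 < d v"
    proof (rule ccontr)
      assume "\<not> (\<exists>v\<in>V'. 0 < d v)"
      then have "\<forall>v\<in>V'. 0 \<le> - d v" by auto
      moreover have "(\<Sum>v\<in>V'. - d v) = 0" using d(1) by (simp add: sum_negf)
      ultimately have "\<forall>v\<in>V'. - d v = 0" using finV' by (simp add: sum_nonneg_eq_0_iff)
      then show False using w by auto
    qed
    then have ne: "{v \<in> V'. 0 < d v} \<noteq> {}" by blast
    obtain c where x: "x \<in> extensional Y" and c: "\<And>v. v \<in> V' \<Longrightarrow> 0 \<le> c v" "(\<Sum>v\<in>V'. c v) = 1"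
      "\<And>y. y \<in> Y \<Longrightarrow> x y = (\<Sum>v\<in>V'. c v * v y)"
      using V'(2) by (rule convex_envelope_onE) blast
    obtain v0 where v0: "v0 \<in> V'" "0 < d v0" "\<And>v. v \<in> V' \<Longrightarrow> 0 < d v \<Longrightarrow> c v0 / d v0 \<le> c v / d v"
      using arg_min_if_finite(1)[of "{v \<in> V'. 0 < d v}" "\<lambda>v. c v / d v"]
        arg_min_least[of "{v \<in> V'. 0 < d v}" _ "\<lambda>v. c v / d v"] finV' ne by auto
    \<comment> \<open>The smallest ratio over the positive \<open>d v\<close> is the largest
      multiple of \<open>d\<close> that leaves all weights nonnegative, and it makes the weight of
      \<open>v0\<close> vanish.\<close>
    define t where "t = c v0 / d v0"
    define c' where "c' v = c v - t * d v" for v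
    have "0 \<le> t" using v0 c by (simp add: t_def)
    have zero: "c' v0 = 0" using v0 by (simp add: c'_def t_def)
    have remove: "(\<Sum>v\<in>V' - {v0}. c' v * h v) = (\<Sum>v\<in>V'. c' v * h v)" for h :: "_ \<Rightarrow> real"
      using finV' v0(1) zero by (simp add: sum.remove)
    have split: "(\<Sum>v\<in>V'. c' v * h v) = (\<Sum>v\<in>V'. c v * h v) - t * (\<Sum>v\<in>V'. d v * h v)"
      for h :: "_ \<Rightarrow> real"
      by (simp add: c'_def algebra_simps sum_subtractf sum_distrib_left)
    have "x \<in> convex_envelope_on Y (V' - {v0})"
    proof (rule convex_envelope_onI[where c = c'])
      fix v assume v: "v \<in> V' - {v0}"
      show "0 \<le> c' v"
      proof (cases "0 < d v")
        case True
        then have "t \<le> c v / d v" using v0(3)[of v] v by (simp add: t_def)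
        then show ?thesis using True by (simp add: c'_def field_simps)
      next
        case False
        then have "t * d v \<le> 0" using \<open>0 \<le> t\<close> by (simp add: mult_nonneg_nonpos)
        then show ?thesis using c(1)[of v] v by (simp add: c'_def)
      qed
    next
      show "(\<Sum>v\<in>V' - {v0}. c' v) = 1"
        using remove[of "\<lambda>_. 1"] split[of "\<lambda>_. 1"] c d by simp
    next
      fix y assume "y \<in> Y"
      then show "x y = (\<Sum>v\<in>V' - {v0}. c' v * v y)"
        using remove[of "\<lambda>v. v y"] split[of "\<lambda>v. v y"] c d by simp
    qed (rule x)
    then have "card V' \<le> card (V' - {v0})" using V' by (intro min) auto
    then show False using v0(1) finV' by (metis card_Diff1_less leD)
  qed
  then show ?thesis using V' by blast
qed

text \<open>Clears denominators, so that the corners of a rational simplex can enter forms with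
  integer coefficients.\<close>

lemma finite_common_denominator:
  fixes Q :: "real set"
  assumes "finite Q" "Q \<subseteq> \<rat>"
  shows "\<exists>D>0. \<forall>q\<in>Q. \<exists>n::int. of_int D * q = of_int n"
  using assms
proof (induction rule: finite_induct)
  case empty
  show ?case by (rule exI[of _ 1]) simp
next
  case (insert q Q)
  then obtain D where D: "D > 0" "\<forall>q\<in>Q. \<exists>n::int. of_int D * q = of_int n" by auto
  obtain a b where ab: "b > 0" "q = of_int a / of_int b"
    using insert.prems Rats_cases' by (metis insert_subset)
  have "\<exists>n::int. of_int (D * b) * p = of_int n" if p: "p \<in> insert q Q" for p
  proof (cases "p = q")
    case True
    then have "of_int (D * b) * p = of_int (D * a)" using ab by (simp add: field_simps)
    then show ?thesis by blast
  next
    case False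
    then obtain n where "of_int D * p = of_int n" using D p by auto
    then have "of_int (D * b) * p = of_int (b * n)" by (simp add: mult.commute mult.left_commute)
    then show ?thesis by blast
  qed
  then show ?case using D(1) ab(1) by (intro exI[of _ "D * b"]) auto
qed

text \<open>The coordinate \<open>None\<close> homogenizes affine forms; it takes the value 1 at points of the cube.\<close>

abbreviation homog :: "('k \<Rightarrow> 'f::linordered_field) \<Rightarrow> 'k option \<Rightarrow> 'f" where
  "homog f \<equiv> case_option 1 f"

abbreviation coords :: "'k set \<Rightarrow> 'k option set" where
  "coords Y \<equiv> insert None (Some ` Y)"

section \<open>Polytopes cut out of the cube by integer forms\<close>

definition polytope_on :: "'k set \<Rightarrow> ('k option \<Rightarrow> int) set \<Rightarrow> ('k \<Rightarrow> real) set" where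
  "polytope_on Y S = {f \<in> Y \<rightarrow>\<^sub>E {0..1}. \<forall>l\<in>S. 0 \<le> lin (coords Y) l (homog f)}"

lemma lin_coords:
  "finite Y \<Longrightarrow> lin (coords Y) l r = of_int (l None) * r None + (\<Sum>y\<in>Y. of_int (l (Some y)) * r (Some y))"
  by (simp add: lin_def sum.reindex)

text \<open>The parameter \<open>t\<close> is an arbitrary real: outside the unit interval the
  combination leaves the segment along its line, and \<open>t = -1\<close> reflects \<open>y\<close>
  in \<open>x\<close>.\<close>

definition affine_comb :: "'k set \<Rightarrow> real \<Rightarrow> ('k \<Rightarrow> real) \<Rightarrow> ('k \<Rightarrow> real) \<Rightarrow> 'k \<Rightarrow> real" where
  "affine_comb Y t x y = (\<lambda>k\<in>Y. (1 - t) * x k + t * y k)"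

lemma lin_affine_comb:
  assumes "finite Y"
  shows "lin (coords Y) l (homog (affine_comb Y t x y)) =
    (1 - t) * lin (coords Y) l (homog x) + t * lin (coords Y) l (homog y)"
  using assms
  by (simp add: lin_coords affine_comb_def algebra_simps sum_distrib_left sum.distrib sum_subtractf)

lemma convex_envelope_on_comb:
  assumes p: "p \<in> convex_envelope_on Y V" and q: "q \<in> convex_envelope_on Y V" and t: "0 \<le> t" "t \<le> 1"
  shows "affine_comb Y t p q \<in> convex_envelope_on Y V"
proof -
  obtain c where c: "\<And>v. v \<in> V \<Longrightarrow> 0 \<le> c v" "(\<Sum>v\<in>V. c v) = 1" "\<And>y. y \<in> Y \<Longrightarrow> p y = (\<Sum>v\<in>V. c v * v y)"
    using p by (rule convex_envelope_onE) blast
  obtain d where d: "\<And>v. v \<in> V \<Longrightarrow> 0 \<le> d v" "(\<Sum>v\<in>V. d v) = 1" "\<And>y. y \<in> Y \<Longrightarrow> q y = (\<Sum>v\<in>V. d v * v y)"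
    using q by (rule convex_envelope_onE) blast
  show ?thesis
  proof (rule convex_envelope_onI[where c = "\<lambda>v. (1 - t) * c v + t * d v"])
    show "(\<Sum>v\<in>V. (1 - t) * c v + t * d v) = 1"
      using c d by (simp add: sum.distrib flip: sum_distrib_left)
  next
    fix y assume "y \<in> Y"
    then show "affine_comb Y t p q y = (\<Sum>v\<in>V. ((1 - t) * c v + t * d v) * v y)"
      by (simp add: affine_comb_def c d distrib_right sum.distrib sum_distrib_left mult.assoc)
  qed (use c d t in \<open>auto simp: affine_comb_def\<close>)
qed

text \<open>Because the weights sum to 1 they also reproduce the constant term, that is the
  coefficient at \<open>None\<close>.\<close>

lemma lin_convex_sum:
  assumes "finite Y" and c: "(\<Sum>v\<in>V. c v) = 1" "\<And>y. y \<in> Y \<Longrightarrow> x y = (\<Sum>v\<in>V. c v * v y)"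
  shows "lin (coords Y) l (homog x) = (\<Sum>v\<in>V. c v * lin (coords Y) l (homog v))"
proof -
  have "(\<Sum>v\<in>V. c v * lin (coords Y) l (homog v)) =
      (\<Sum>v\<in>V. of_int (l None) * c v) + (\<Sum>v\<in>V. \<Sum>y\<in>Y. of_int (l (Some y)) * (c v * v y))"
    using assms(1) by (simp add: lin_coords distrib_left sum.distrib sum_distrib_left algebra_simps)
  also have "\<dots> = of_int (l None) + (\<Sum>y\<in>Y. of_int (l (Some y)) * x y)"
    using c by (subst sum.swap) (simp flip: sum_distrib_left)
  finally show ?thesis using assms(1) by (simp add: lin_coords)
qed

section \<open>Vertices of a polytope in the cube\<close>

definition cube_forms :: "'k set \<Rightarrow> ('k option \<Rightarrow> int) set" where
  "cube_forms Y = (\<lambda>k v. if v = Some k then 1 else 0) ` Y \<union>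
    (\<lambda>k v. (if v = None then 1 else 0) - (if v = Some k then 1 else 0)) ` Y"

lemma cube_forms_iff:
  assumes Y: "finite Y"
  shows "(\<forall>l\<in>cube_forms Y. 0 \<le> lin (coords Y) l r) \<longleftrightarrow> (\<forall>k\<in>Y. 0 \<le> r (Some k) \<and> r (Some k) \<le> r None)"
proof -
  have "lin (coords Y) (\<lambda>v. if v = Some k then 1 else 0) r = r (Some k)" if "k \<in> Y" for k
    using lin_unit[of "coords Y" "Some k" 1 r] Y that by simp
  moreover have "lin (coords Y) (\<lambda>v. if v = None then 1 else 0) r = r None"
    using lin_unit[of "coords Y" None 1 r] Y by simp
  ultimately have
    "(\<forall>l\<in>cube_forms Y. 0 \<le> lin (coords Y) l r) \<longleftrightarrow> (\<forall>k\<in>Y. 0 \<le> r (Some k)) \<and> (\<forall>k\<in>Y. 0 \<le> r None - r (Some k))"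
    unfolding cube_forms_def ball_Un ball_simps by (simp add: lin_diff)
  then show ?thesis by auto
qed

text \<open>Putting the facets of the cube among the constraints makes the polytope bounded in a way
  that the constraints themselves show: along every line some constraint decreases in each
  direction.\<close>

locale polytope_constraints =
  fixes Y :: "'k set" and S :: "('k option \<Rightarrow> int) set"
  assumes Y: "finite Y" and S: "finite S" and cube: "cube_forms Y \<subseteq> S"
begin

abbreviation g :: "('k option \<Rightarrow> int) \<Rightarrow> ('k \<Rightarrow> real) \<Rightarrow> real" where
  "g l x \<equiv> lin (coords Y) l (homog x)"

definition P :: "('k \<Rightarrow> real) set" where
  "P = {x \<in> extensional Y. \<forall>l\<in>S. 0 \<le> g l x}"

definition act :: "('k \<Rightarrow> real) \<Rightarrow> ('k option \<Rightarrow> int) set" where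
  "act x = {l \<in> S. g l x = 0}"

text \<open>Vertices are characterized by their active equations rather than as extreme points,
  because finiteness and rationality can be read off from these equations.\<close>

definition vert :: "('k \<Rightarrow> real) set" where
  "vert = {x \<in> P. \<forall>y \<in> extensional Y. (\<forall>l\<in>act x. g l y = 0) \<longrightarrow> y = x}"

lemma P_cube: "x \<in> P \<Longrightarrow> x \<in> Y \<rightarrow>\<^sub>E {0..1}"
  using cube_forms_iff[OF Y, of "homog x"] cube by (auto simp: P_def PiE_def)

text \<open>A vertex is recovered from its set of active constraints, a subset of the finite
  \<open>S\<close>.\<close>

lemma finite_vert: "finite vert"
proof (rule finite_imageD)
  show "finite (act ` vert)" by (rule finite_subset[of _ "Pow S"]) (use S in \<open>auto simp: act_def\<close>)
  show "inj_on act vert"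
  proof (rule inj_onI)
    fix x y assume x: "x \<in> vert" and y: "y \<in> vert" and eq: "act x = act y"
    have "y \<in> extensional Y" using y by (simp add: vert_def P_def)
    moreover have "\<forall>l\<in>act x. g l y = 0" unfolding eq by (simp add: act_def)
    ultimately have "y = x" using x unfolding vert_def by blast
    then show "x = y" by simp
  qed
qed

text \<open>
  The line from \<open>x\<close> through \<open>y\<close> stays in the active facets of \<open>x\<close>; it is followed up to the first
  further constraint that becomes active.
\<close>

lemma exit_face:
  assumes x: "x \<in> P" and y: "y \<in> extensional Y" "\<forall>l\<in>act x. g l y = 0"
    and dec: "\<exists>l\<in>S. g l y < g l x"
  shows "\<exists>t>0. affine_comb Y t x y \<in> P \<and> act x \<subset> act (affine_comb Y t x y)"
proof -
  define D where "D = {l \<in> S. g l y < g l x}"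
  \<comment> \<open>The parameter at which the line reaches the hyperplane of \<open>l\<close>; the
    smallest one is the exit.\<close>
  define q where "q l = g l x / (g l x - g l y)" for l
  obtain l0 where l0: "l0 \<in> D" "\<And>l. l \<in> D \<Longrightarrow> q l0 \<le> q l"
    using arg_min_if_finite(1)[of D q] arg_min_least[of D _ q] S dec by (auto simp: D_def)
  \<comment> \<open>A constraint active at \<open>x\<close> vanishes at \<open>y\<close> as well,
    hence does not decrease and is not in \<open>D\<close>.\<close>
  have pos: "0 < g l x" if "l \<in> D" for l
  proof -
    have "g l x \<noteq> 0" using that y(2) by (auto simp: D_def act_def)
    then show ?thesis using x that by (force simp: P_def D_def)
  qed
  define t where "t = q l0"
  have t: "0 < t" using pos[OF l0(1)] l0(1) by (simp add: t_def q_def D_def)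
  have val: "g l (affine_comb Y t x y) = g l x - t * (g l x - g l y)" for l
    by (simp add: lin_affine_comb[OF Y] algebra_simps)
  have "0 \<le> g l (affine_comb Y t x y)" if l: "l \<in> S" for l
  proof (cases "l \<in> D")
    case True
    then have "t \<le> q l" using l0 by (simp add: t_def)
    then show ?thesis using True by (simp add: val q_def D_def field_simps)
  next
    case False
    then have "t * (g l x - g l y) \<le> 0" using l t by (simp add: D_def mult_nonneg_nonpos)
    then show ?thesis using x l by (simp add: val P_def) (smt (verit) Ball_def mem_Collect_eq)
  qed
  then have "affine_comb Y t x y \<in> P" by (simp add: P_def affine_comb_def)
  moreover have "act x \<subseteq> act (affine_comb Y t x y)"
    using y(2) by (auto simp: act_def val)
  moreover have "l0 \<in> act (affine_comb Y t x y) - act x"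
  proof -
    have "t * (g l0 x - g l0 y) = g l0 x" using l0(1) by (simp add: t_def q_def D_def)
    then have "g l0 (affine_comb Y t x y) = 0" by (simp add: val)
    then show ?thesis using l0(1) pos[OF l0(1)] by (simp add: act_def D_def)
  qed
  ultimately show ?thesis using t by blast
qed

text \<open>Induction on the number of inactive constraints. A point that is no vertex lies on a
  line inside its active facets; followed in both directions, the line leaves the polytope at two
  points with more active constraints, and the point lies between them.\<close>

lemma P_convex_vert: "x \<in> P \<Longrightarrow> x \<in> convex_envelope_on Y vert"
proof (induction "card (S - act x)" arbitrary: x rule: less_induct)
  case less
  show ?case
  proof (cases "x \<in> vert")
    case True
    show ?thesis
    proof (rule convex_envelope_onI[where c = "\<lambda>v. if v = x then 1 else 0"])
      show "x \<in> extensional Y" using less.prems by (simp add: P_def)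
    qed (use True finite_vert in \<open>auto simp: if_distrib[of "\<lambda>x. x * _"] cong: if_cong\<close>)
  next
    case False
    then obtain y where y: "y \<in> extensional Y" "\<forall>l\<in>act x. g l y = 0" "y \<noteq> x"
      using less.prems by (auto simp: vert_def)
    \<comment> \<open>The reflection of \<open>y\<close> in \<open>x\<close> gives the opposite
      direction on the line.\<close>
    define y' where "y' = affine_comb Y (-1) x y"
    have val: "g l y' = 2 * g l x - g l y" for l
      by (simp add: y'_def lin_affine_comb[OF Y])
    have y': "y' \<in> extensional Y" "\<forall>l\<in>act x. g l y' = 0"
      using y(2) by (simp_all add: val) (simp_all add: y'_def affine_comb_def act_def)
    obtain k where k: "k \<in> Y" "y k \<noteq> x k"
      using y(1,3) less.prems extensionalityI[of y Y x] by (auto simp: P_def)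
    define l where "l = (\<lambda>v. if v = Some k then 1 else 0 :: int)"
    define l' where "l' = (\<lambda>v. (if v = None then 1 else 0) - (if v = Some k then 1 else 0 :: int))"
    have ll: "l \<in> S" "l' \<in> S" using cube k unfolding cube_forms_def l_def l'_def by blast+
    have g: "g l z = z k" "g l' z = 1 - z k" for z
      using lin_unit[of "coords Y" "Some k" 1 "homog z"] lin_unit[of "coords Y" None 1 "homog z"] k Y
      by (simp_all add: l_def l'_def lin_diff)
    \<comment> \<open>The coordinate \<open>k\<close> changes along the line, so \<open>x k\<close>
      decreases in one direction and \<open>1 - x k\<close> in the other; both are forms of the
      cube.\<close>
    have dec: "\<exists>l\<in>S. g l y < g l x" "\<exists>l\<in>S. g l y' < g l x"
    proof -
      have "(g l y < g l x \<and> g l' y' < g l' x) \<or> (g l' y < g l' x \<and> g l y' < g l x)"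
        using k(2) unfolding val g by (cases "y k < x k") auto
      then show "\<exists>l\<in>S. g l y < g l x" "\<exists>l\<in>S. g l y' < g l x" using ll by blast+
    qed
    have smaller: "card (S - act z) < card (S - act x)" if "act x \<subset> act z" for z
      using that S by (intro psubset_card_mono) (auto simp: act_def)
    obtain t where t: "t > 0" "affine_comb Y t x y \<in> P" "act x \<subset> act (affine_comb Y t x y)"
      using exit_face[OF less.prems y(1,2) dec(1)] by blast
    obtain s where s: "s > 0" "affine_comb Y s x y' \<in> P" "act x \<subset> act (affine_comb Y s x y')"
      using exit_face[OF less.prems y' dec(2)] by blast
    \<comment> \<open>The exit points are \<open>x + t * (y - x)\<close> and
      \<open>x - s * (y - x)\<close>; the weight \<open>t / (t + s)\<close> on the second balances
      the two displacements.\<close>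
    have "x = affine_comb Y (t / (t + s)) (affine_comb Y t x y) (affine_comb Y s x y')"
    proof (rule extensionalityI[of _ Y])
      fix i assume i: "i \<in> Y"
      define w where "w = t / (t + s)"
      have "w * (t + s) = t" using s(1) t(1) by (simp add: w_def)
      then have "w * t + w * s = t" by (simp add: distrib_left)
      moreover have "(1 - w) * ((1 - t) * x i + t * y i) + w * ((1 - s) * x i + s * (2 * x i - y i)) =
          x i + (t - (w * t + w * s)) * (y i - x i)"
        by (simp add: algebra_simps)
      ultimately have "(1 - w) * ((1 - t) * x i + t * y i) + w * ((1 - s) * x i + s * (2 * x i - y i)) = x i"
        by simp
      then show "x i = affine_comb Y (t / (t + s)) (affine_comb Y t x y) (affine_comb Y s x y') i"
        using i by (simp add: affine_comb_def y'_def flip: w_def)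
    qed (use less.prems in \<open>auto simp: P_def affine_comb_def\<close>)
    also have "\<dots> \<in> convex_envelope_on Y vert"
      by (rule convex_envelope_on_comb)
        (use less.hyps[OF smaller[OF t(3)] t(2)] less.hyps[OF smaller[OF s(3)] s(2)] s(1) t(1) in auto)
    finally show ?thesis .
  qed
qed

text \<open>
  Elimination over \<open>rat\<close> gives a rational solution of the active constraints of a vertex, and the
  vertex is their only solution.
\<close>

lemma vert_rational:
  assumes x: "x \<in> vert" and k: "k \<in> Y" shows "x k \<in> \<rat>"
proof -
  \<comment> \<open>Coefficients outside the coordinates are cut off, because
    \<open>feasible\<close> asks for forms supported on them.\<close>
  define rs where "rs l = (\<lambda>v. if v \<in> coords Y then l v else 0)" for l :: "'k option \<Rightarrow> int"
  have lin_rs: "lin (coords Y) (rs l) r = lin (coords Y) l r" for l and r :: "'k option \<Rightarrow> 'f::linordered_field"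
    unfolding lin_def by (rule sum.cong) (auto simp: rs_def)
  define u where "u = (\<lambda>v :: 'k option. if v = None then 1 else 0 :: int)"
  \<comment> \<open>Each active equation enters as two inequalities. Requiring \<open>u\<close> to
    be positive makes the homogenizing coordinate of the solution nonzero, so that one can divide by
    it.\<close>
  define T where "T = (\<lambda>l. (rs l, False)) ` act x \<union> (\<lambda>l. (rs (\<lambda>v. - l v), False)) ` act x \<union> {(u, True)}"
  \<comment> \<open>The cone is evaluation at the real vertex itself, and \<open>feasible\<close>
    turns this real solution into a rational one.\<close>
  interpret cone "\<lambda>l. 0 \<le> g l x" "\<lambda>l. 0 < g l x" by (rule cone_lin)
  have "\<exists>r :: 'k option \<Rightarrow> rat. sat (coords Y) r T"
  proof (rule feasible)
    show "finite (coords Y)" "finite T" using Y S by (auto simp: T_def act_def)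
    show "\<forall>c\<in>T. \<forall>v. v \<notin> coords Y \<longrightarrow> fst c v = 0" by (auto simp: T_def rs_def u_def)
    show "\<forall>c\<in>T. holds (\<lambda>l. 0 \<le> g l x) (\<lambda>l. 0 < g l x) c"
      using Y by (auto simp: T_def holds_def lin_rs lin_minus act_def u_def lin_unit[where n = 1, simplified])
  qed
  then obtain r :: "'k option \<Rightarrow> rat" where r: "sat (coords Y) r T" ..
  have rN: "0 < r None"
    using r Y by (auto simp: sat_def T_def holds_def u_def lin_unit[where n = 1, simplified])
  have zero: "lin (coords Y) l r = 0" if "l \<in> act x" for l
  proof -
    have "(rs l, False) \<in> T" "(rs (\<lambda>v. - l v), False) \<in> T" using that by (auto simp: T_def)
    then have "0 \<le> lin (coords Y) l r" "0 \<le> - lin (coords Y) l r"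
      using r by (force simp: sat_def holds_def lin_rs lin_minus)+
    then show ?thesis by simp
  qed
  define y where "y = (\<lambda>k\<in>Y. of_rat (r (Some k) / r None) :: real)"
  have "g l y = of_rat (lin (coords Y) l r / r None)" for l
  proof -
    have "lin (coords Y) l r / r None = of_int (l None) + (\<Sum>k\<in>Y. of_int (l (Some k)) * (r (Some k) / r None))"
      using rN Y by (simp add: lin_coords add_divide_distrib sum_divide_distrib)
    then show ?thesis
      using Y by (simp add: lin_coords y_def of_rat_add of_rat_sum of_rat_mult del: times_divide_eq_right)
  qed
  then have "\<forall>l\<in>act x. g l y = 0" using zero by simp
  moreover have "y \<in> extensional Y" by (simp add: y_def)
  ultimately have "y = x" using x by (auto simp: vert_def)
  then show ?thesis using k by (auto simp: y_def)
qed

text \<open>By Caratheodory's theorem the envelope of the vertices is the union of the envelopes of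
  the affinely independent sets of vertices, and there are finitely many of these.\<close>

lemma rational_polyhedron_P: "rational_polyhedron Y P"
proof -
  define SS where "SS = convex_envelope_on Y ` {V. V \<subseteq> vert \<and> affinely_independent_on Y V}"
  have "finite SS" using finite_vert by (simp add: SS_def)
  moreover have "rational_simplex Y W" if W: "W \<in> SS" for W
  proof -
    obtain V where "W = convex_envelope_on Y V" "V \<in> {V. V \<subseteq> vert \<and> affinely_independent_on Y V}"
      using W unfolding SS_def by (rule imageE)
    then have V: "V \<subseteq> vert" "affinely_independent_on Y V" "W = convex_envelope_on Y V" by simp_all
    have "V \<subseteq> Y \<rightarrow>\<^sub>E {0..1} \<inter> \<rat>"
    proof
      fix x assume "x \<in> V"
      then have "x \<in> vert" using V by blast
      then show "x \<in> Y \<rightarrow>\<^sub>E {0..1} \<inter> \<rat>"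
        using P_cube[of x] vert_rational[of x] by (auto simp: vert_def PiE_iff)
    qed
    moreover have "finite V" using V(1) finite_vert by (rule finite_subset)
    ultimately show ?thesis unfolding rational_simplex_def using V(2,3) by (intro exI[of _ V] conjI)
  qed
  moreover have "P = \<Union> SS"
  proof
    show "P \<subseteq> \<Union> SS"
    proof
      fix x assume "x \<in> P"
      then obtain V where V: "V \<subseteq> vert" "affinely_independent_on Y V" "x \<in> convex_envelope_on Y V"
        using caratheodory_on[OF finite_vert P_convex_vert[OF \<open>x \<in> P\<close>]] by blast
      then have "convex_envelope_on Y V \<in> SS" by (simp add: SS_def)
      then show "x \<in> \<Union> SS" using V(3) by (rule UnionI)
    qed
    show "\<Union> SS \<subseteq> P"
    proof
      fix x assume "x \<in> \<Union> SS"
      then obtain W where "W \<in> SS" "x \<in> W" by (rule UnionE)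
      then obtain V where "x \<in> convex_envelope_on Y V" "V \<in> {V. V \<subseteq> vert \<and> affinely_independent_on Y V}"
        unfolding SS_def by blast
      then have V: "V \<subseteq> vert" "x \<in> convex_envelope_on Y V" by simp_all
      obtain c where x: "x \<in> extensional Y" and c: "\<And>v. v \<in> V \<Longrightarrow> 0 \<le> c v" "(\<Sum>v\<in>V. c v) = 1"
        "\<And>y. y \<in> Y \<Longrightarrow> x y = (\<Sum>v\<in>V. c v * v y)"
        using V(2) by (rule convex_envelope_onE) blast
      have "0 \<le> g l x" if "l \<in> S" for l
        using V(1) c(1) that by (subst lin_convex_sum[OF Y c(2,3)])
          (auto simp: vert_def P_def intro!: sum_nonneg mult_nonneg_nonneg)
      then show "x \<in> P" using x by (simp add: P_def)
    qed
  qed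
  ultimately show ?thesis unfolding rational_polyhedron_def by blast
qed

end

text \<open>Adding the forms of the cube to \<open>S\<close> leaves the polytope unchanged and meets
  the assumptions of \<open>polytope_constraints\<close>.\<close>

theorem rational_polyhedron_polytope_on:
  assumes "finite Y" "finite S"
  shows "rational_polyhedron Y (polytope_on Y S)"
proof -
  interpret polytope_constraints Y "S \<union> cube_forms Y"
    using assms by unfold_locales (auto simp: cube_forms_def)
  have "polytope_on Y S = P"
    using P_cube cube_forms_iff[OF assms(1), of "homog _"]
    by (auto simp: polytope_on_def P_def PiE_iff)
  then show ?thesis using rational_polyhedron_P by simp
qed

section \<open>Simplexes as projections of systems of weights\<close>

lemma finite_coords: "finite Y \<Longrightarrow> finite (coords Y)"
  by simp

lemma lin_Inl_Inr:
  assumes "finite A" "finite B"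
  shows "lin (Inl ` A \<union> Inr ` B) l r = lin A (l \<circ> Inl) (r \<circ> Inl) + lin B (l \<circ> Inr) (r \<circ> Inr)"
  unfolding lin_def using assms by (subst sum.union_disjoint) (auto simp: sum.reindex)

text \<open>The pairs of a point and a system of weights representing it satisfy finitely many
  inequalities with integer coefficients. Eliminating the weights by \<open>projection\<close>
  leaves inequalities for the point alone.\<close>

theorem rational_simplex_polytope_on:
  assumes Y: "finite Y" and P: "rational_simplex Y P"
  shows "\<exists>S. finite S \<and> P = polytope_on Y S"
proof -
  obtain V where V: "finite V" "V \<subseteq> Y \<rightarrow>\<^sub>E {0..1} \<inter> \<rat>" "P = convex_envelope_on Y V"
    using P by (auto simp: rational_simplex_def)
  have "finite ((\<lambda>(v, y). v y) ` (V \<times> Y))" "(\<lambda>(v, y). v y) ` (V \<times> Y) \<subseteq> \<rat>"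
    using V Y by (auto simp: PiE_iff subset_iff)
  then obtain D n where D: "D > (0::int)" and n: "\<And>v y. v \<in> V \<Longrightarrow> y \<in> Y \<Longrightarrow> of_int D * v y = of_int (n v y)"
    using finite_common_denominator[of "(\<lambda>(v, y). v y) ` (V \<times> Y)"] by simp metis
  \<comment> \<open>Variables tagged \<open>Inl\<close> are the homogeneous coordinates of the
    point, those tagged \<open>Inr\<close> the weights. \<open>E y\<close> is the coordinate
    equation at \<open>y\<close> multiplied by the common denominator \<open>D\<close>,
    \<open>T\<close> states that the weights sum to 1, and \<open>N v\<close> that the weight of
    \<open>v\<close> is nonnegative.\<close>
  define E :: "'a \<Rightarrow> 'a option + ('a \<Rightarrow> real) \<Rightarrow> int" where
    "E y = case_sum (\<lambda>x. if x = Some y then D else 0) (\<lambda>v. - n v y)" for y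
  define T :: "'a option + ('a \<Rightarrow> real) \<Rightarrow> int" where
    "T = case_sum (\<lambda>x. if x = None then -1 else 0) (\<lambda>v. 1)"
  define N :: "('a \<Rightarrow> real) \<Rightarrow> 'a option + ('a \<Rightarrow> real) \<Rightarrow> int" where
    "N v = (\<lambda>x. if x = Inr v then 1 else 0)" for v
  define F where "F = E ` Y \<union> (\<lambda>y x. - E y x) ` Y \<union> N ` V \<union> {T, \<lambda>x. - T x}"
  note lin_split = lin_Inl_Inr[OF finite_coords[OF Y] V(1)]
  have Inr: "Inr v \<in> Inl ` coords Y \<union> Inr ` V" if "v \<in> V" for v using that by blast
  have fin: "finite (Inl ` coords Y \<union> Inr ` V)" using Y V(1) by simp
  obtain S' where S': "finite S'" "\<forall>c\<in>S'. \<not> snd c"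
    "\<And>r :: 'a option + ('a \<Rightarrow> real) \<Rightarrow> real. sat (Inl ` coords Y) r S' \<longleftrightarrow>
      (\<exists>r'. (\<forall>v\<in>Inl ` coords Y. r' v = r v) \<and> sat (Inl ` coords Y \<union> Inr ` V) r' ((\<lambda>l. (l, False)) ` F))"
    using projection[of "Inr ` V" "Inl ` coords Y" "(\<lambda>l. (l, False)) ` F"] Y V(1)
    by (auto simp: F_def simp del: image_insert)
  \<comment> \<open>For a point with homogenizing coordinate 1, \<open>F\<close> says that the
    \<open>Inr\<close> variables are weights representing \<open>f\<close>.\<close>
  have satF: "sat (Inl ` coords Y \<union> Inr ` V) r ((\<lambda>l. (l, False)) ` F) \<longleftrightarrow>
    (\<forall>v\<in>V. 0 \<le> r (Inr v)) \<and> (\<Sum>v\<in>V. r (Inr v)) = 1 \<and> (\<forall>y\<in>Y. f y = (\<Sum>v\<in>V. r (Inr v) * v y))"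
    if r: "\<forall>v\<in>Inl ` coords Y. r v = case_sum (homog f) (\<lambda>_. 0) v" for f and r :: "'a option + ('a \<Rightarrow> real) \<Rightarrow> real"
  proof -
    have rI: "r (Inl None) = 1" "\<And>y. y \<in> Y \<Longrightarrow> r (Inl (Some y)) = f y" using r by auto
    have EE: "lin (Inl ` coords Y \<union> Inr ` V) (E y) r = of_int D * (f y - (\<Sum>v\<in>V. r (Inr v) * v y))"
      if y: "y \<in> Y" for y
    proof -
      have "lin V (E y \<circ> Inr) (r \<circ> Inr) = - (\<Sum>v\<in>V. of_int D * (r (Inr v) * v y))"
        unfolding lin_def sum_negf[symmetric]
        by (rule sum.cong) (use y n in \<open>auto simp: E_def algebra_simps simp flip: n\<close>)
      moreover have "lin (coords Y) (E y \<circ> Inl) (r \<circ> Inl) = of_int D * f y"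
        using lin_unit[of "coords Y" "Some y" D "r \<circ> Inl"] Y y rI by (simp add: E_def comp_def)
      ultimately show ?thesis
        unfolding lin_split by (simp add: right_diff_distrib sum_distrib_left)
    qed
    have TT: "lin (Inl ` coords Y \<union> Inr ` V) T r = (\<Sum>v\<in>V. r (Inr v)) - 1"
      using lin_unit[of "coords Y" None "-1" "r \<circ> Inl"] Y rI
      unfolding lin_split by (simp add: T_def comp_def) (simp add: lin_def)
    have NN: "lin (Inl ` coords Y \<union> Inr ` V) (N v) r = r (Inr v)" if "v \<in> V" for v
      using lin_unit[OF fin Inr[OF that], of 1 r] by (simp add: N_def)
    let ?A = "Inl ` coords Y \<union> Inr ` V :: ('a option + ('a \<Rightarrow> real)) set"
    have D0: "0 \<le> of_int D * a \<and> 0 \<le> - (of_int D * a) \<longleftrightarrow> a = 0" for a :: real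
      using D by (auto simp: zero_le_mult_iff mult_le_0_iff)
    have "sat ?A r ((\<lambda>l. (l, False)) ` F) \<longleftrightarrow> (\<forall>l\<in>F. 0 \<le> lin ?A l r)"
      unfolding sat_def holds_def ball_simps by simp
    also have "\<dots> \<longleftrightarrow> (\<forall>y\<in>Y. 0 \<le> lin ?A (E y) r \<and> 0 \<le> - lin ?A (E y) r) \<and>
        (\<forall>v\<in>V. 0 \<le> lin ?A (N v) r) \<and> 0 \<le> lin ?A T r \<and> 0 \<le> - lin ?A T r"
      unfolding F_def ball_Un ball_simps lin_minus by blast
    also have "(\<forall>y\<in>Y. 0 \<le> lin ?A (E y) r \<and> 0 \<le> - lin ?A (E y) r) \<longleftrightarrow>
        (\<forall>y\<in>Y. f y = (\<Sum>v\<in>V. r (Inr v) * v y))"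
    proof (rule ball_cong[OF HOL.refl])
      fix y assume "y \<in> Y"
      show "0 \<le> lin ?A (E y) r \<and> 0 \<le> - lin ?A (E y) r \<longleftrightarrow> f y = (\<Sum>v\<in>V. r (Inr v) * v y)"
        unfolding EE[OF \<open>y \<in> Y\<close>] D0 by (rule right_minus_eq)
    qed
    also have "(\<forall>v\<in>V. 0 \<le> lin ?A (N v) r) \<longleftrightarrow> (\<forall>v\<in>V. 0 \<le> r (Inr v))"
      by (intro ball_cong HOL.refl) (simp only: NN)
    finally show ?thesis unfolding TT by auto
  qed
  define S where "S = (\<lambda>c. fst c \<circ> Inl) ` S'"
  have "f \<in> P \<longleftrightarrow> f \<in> polytope_on Y S" for f
  proof -
    have P_cube: "f \<in> Y \<rightarrow>\<^sub>E {0..1}" if "f \<in> P"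
    proof -
      obtain c where f: "f \<in> extensional Y" and c: "\<And>v. v \<in> V \<Longrightarrow> 0 \<le> c v" "(\<Sum>v\<in>V. c v) = 1"
        "\<And>y. y \<in> Y \<Longrightarrow> f y = (\<Sum>v\<in>V. c v * v y)"
        using \<open>f \<in> P\<close> unfolding V(3) by (rule convex_envelope_onE) blast
      have "0 \<le> f y \<and> f y \<le> 1" if y: "y \<in> Y" for y
      proof -
        have v: "0 \<le> v y \<and> v y \<le> 1" if "v \<in> V" for v using V(2) y that by (auto simp: PiE_iff subset_iff)
        then have "0 \<le> f y" using c y by (auto intro!: sum_nonneg mult_nonneg_nonneg)
        moreover have "(\<Sum>v\<in>V. c v * v y) \<le> (\<Sum>v\<in>V. c v)"
          using c(1) v by (intro sum_mono) (simp add: mult_left_le)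
        ultimately show ?thesis using c y by simp
      qed
      then show ?thesis using f by (auto simp: PiE_iff)
    qed
    have "sat (Inl ` coords Y) (case_sum (homog f) (\<lambda>_. 0)) S' \<longleftrightarrow> (\<forall>l\<in>S. 0 \<le> lin (coords Y) l (homog f))"
    proof -
      have "lin (Inl ` coords Y) l (case_sum (homog f) (\<lambda>_. 0)) = lin (coords Y) (l \<circ> Inl) (homog f)"
        for l :: "'a option + ('a \<Rightarrow> real) \<Rightarrow> int"
        unfolding lin_def by (subst sum.reindex) auto
      then show ?thesis
        unfolding sat_def holds_def S_def ball_simps
        by (intro ball_cong HOL.refl) (use S'(2) in \<open>simp del: image_insert\<close>)
    qed
    moreover have "f \<in> P \<longleftrightarrow> sat (Inl ` coords Y) (case_sum (homog f) (\<lambda>_. 0)) S'" if f: "f \<in> extensional Y"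
    proof
      assume "f \<in> P"
      then obtain c where c: "\<And>v. v \<in> V \<Longrightarrow> 0 \<le> c v" "(\<Sum>v\<in>V. c v) = 1"
        "\<And>y. y \<in> Y \<Longrightarrow> f y = (\<Sum>v\<in>V. c v * v y)"
        unfolding V(3) by (rule convex_envelope_onE) blast
      then show "sat (Inl ` coords Y) (case_sum (homog f) (\<lambda>_. 0)) S'"
        unfolding S'(3) by (intro exI[of _ "case_sum (homog f) c"] conjI) (auto simp: satF[of _ f] simp del: image_insert)
    next
      assume "sat (Inl ` coords Y) (case_sum (homog f) (\<lambda>_. 0)) S'"
      then obtain r where "\<forall>v\<in>Inl ` coords Y. r v = case_sum (homog f) (\<lambda>_. 0) v"
        "sat (Inl ` coords Y \<union> Inr ` V) r ((\<lambda>l. (l, False)) ` F)"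
        unfolding S'(3) by blast
      then have "(\<forall>v\<in>V. 0 \<le> r (Inr v)) \<and> (\<Sum>v\<in>V. r (Inr v)) = 1 \<and> (\<forall>y\<in>Y. f y = (\<Sum>v\<in>V. r (Inr v) * v y))"
        using satF by blast
      then show "f \<in> P" unfolding V(3) by (intro convex_envelope_onI[OF f, where c = "\<lambda>v. r (Inr v)"]) auto
    qed
    ultimately show ?thesis using P_cube by (auto simp: polytope_on_def PiE_iff)
  qed
  moreover have "finite S" using S' by (simp add: S_def)
  ultimately show ?thesis by blast
qed

section \<open>Zero sets of MV-terms in the cube\<close>

definition unit_mv :: "real mv" where
  "unit_mv = \<lparr>carrier = {0..1}, mv_plus = (\<lambda>x y. min 1 (x + y)), mv_neg = (\<lambda>x. 1 - x), mv_zero = 0\<rparr>"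

abbreviation ev :: "('k \<Rightarrow> real) \<Rightarrow> 'k mv_term \<Rightarrow> real" where
  "ev \<equiv> mv_eval unit_mv"

lemma unit_mv_simps [simp]:
  "carrier unit_mv = {0..1}" "x \<boxplus>\<^bsub>unit_mv\<^esub> y = min 1 (x + y)" "\<ominus>\<^bsub>unit_mv\<^esub> x = 1 - x" "\<zero>\<^bsub>unit_mv\<^esub> = 0"
  by (simp_all add: unit_mv_def)

lemma mv_algebra_unit_mv: "mv_algebra unit_mv"
  by unfold_locales (auto simp: min_def)

lemma ev_range:
  assumes "t \<in> mv_terms K" "\<And>k. k \<in> K \<Longrightarrow> f k \<in> {0..1}"
  shows "0 \<le> ev f t" "ev f t \<le> 1"
proof -
  have "ev f t \<in> {0..1}" using assms(1)
    by (induction t) (use assms(2) in \<open>auto simp: min_def\<close>)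
  then show "0 \<le> ev f t" "ev f t \<le> 1" by auto
qed

lemma mv_eval_cong: "t \<in> mv_terms K \<Longrightarrow> (\<And>k. k \<in> K \<Longrightarrow> f k = g k) \<Longrightarrow> mv_eval A f t = mv_eval A g t"
  by (induction t) auto

definition zero_set :: "'k set \<Rightarrow> 'k mv_term \<Rightarrow> ('k \<Rightarrow> real) set" where
  "zero_set K t = {f \<in> K \<rightarrow>\<^sub>E {0..1}. ev f t = 0}"

abbreviation form_one :: "'k option \<Rightarrow> int" where
  "form_one \<equiv> \<lambda>v. if v = None then 1 else 0"

text \<open>
  Each pair consists of forms cutting out, by being nonnegative, a region of the cube, and a form
  that represents the term function on that region.
\<close>

primrec pieces :: "'k mv_term \<Rightarrow> (('k option \<Rightarrow> int) set \<times> ('k option \<Rightarrow> int)) set" where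
  "pieces (Gen k) = {({}, \<lambda>v. if v = Some k then 1 else 0)}"
| "pieces Zero = {({}, \<lambda>_. 0)}"
| "pieces (Neg s) = (\<lambda>(c, l). (c, \<lambda>v. form_one v - l v)) ` pieces s"
| "pieces (Plus s t) = (\<Union>(c, l)\<in>pieces s. \<Union>(d, m)\<in>pieces t.
    {(insert (\<lambda>v. form_one v - (l v + m v)) (c \<union> d), \<lambda>v. l v + m v),
     (insert (\<lambda>v. (l v + m v) - form_one v) (c \<union> d), form_one)})"

lemma pieces_PlusI:
  assumes "(c, l) \<in> pieces s" "(d, m) \<in> pieces t"
  shows "(insert (\<lambda>v. form_one v - (l v + m v)) (c \<union> d), \<lambda>v. l v + m v) \<in> pieces (Plus s t)"
    and "(insert (\<lambda>v. (l v + m v) - form_one v) (c \<union> d), form_one) \<in> pieces (Plus s t)"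
  unfolding pieces.simps
  by (rule UN_I[OF assms(1)], unfold prod.case, rule UN_I[OF assms(2)], unfold prod.case, blast)+

lemma pieces_NegI: "(c, l) \<in> pieces s \<Longrightarrow> (c, \<lambda>v. form_one v - l v) \<in> pieces (Neg s)"
  by (simp only: pieces.simps) (rule image_eqI, simp_all only: prod.case)

lemma finite_pieces: "finite (pieces t)"
  by (induction t) auto

lemma finite_pieces_constraints: "(c, l) \<in> pieces t \<Longrightarrow> finite c"
  by (induction t arbitrary: c l) auto

lemma pieces_vanish:
  "t \<in> mv_terms Y \<Longrightarrow> (c, l) \<in> pieces t \<Longrightarrow> m \<in> insert l c \<Longrightarrow> v \<notin> coords Y \<Longrightarrow> m v = 0"
proof (induction t arbitrary: c l m)
  case (Neg s)
  then obtain l' where l': "(c, l') \<in> pieces s" "l = (\<lambda>v. form_one v - l' v)" by auto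
  have "l' v = 0" "\<forall>m\<in>c. m v = 0" using Neg.IH[OF _ l'(1)] Neg.prems by auto
  then show ?case using Neg.prems l' by auto
next
  case (Plus s t)
  then obtain c1 l1 d m1 where p: "(c1, l1) \<in> pieces s" "(d, m1) \<in> pieces t"
    and *: "(c, l) = (insert (\<lambda>v. form_one v - (l1 v + m1 v)) (c1 \<union> d), \<lambda>v. l1 v + m1 v) \<or>
       (c, l) = (insert (\<lambda>v. (l1 v + m1 v) - form_one v) (c1 \<union> d), form_one)"
    by auto
  have "l1 v = 0" "\<forall>m\<in>c1. m v = 0" "m1 v = 0" "\<forall>m\<in>d. m v = 0"
    using Plus.IH(1)[OF _ p(1)] Plus.IH(2)[OF _ p(2)] Plus.prems by auto
  then show ?case using * Plus.prems(3,4) by auto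
qed auto

lemma lin_form_one: "finite Y \<Longrightarrow> lin (coords Y) form_one r = r None"
  using lin_unit[of "coords Y" None 1 r] by simp

lemma lin_form_gen: "finite Y \<Longrightarrow> k \<in> Y \<Longrightarrow> lin (coords Y) (\<lambda>v. if v = Some k then 1 else 0) r = r (Some k)"
  using lin_unit[of "coords Y" "Some k" 1 r] by simp

lemma pieces_value:
  assumes Y: "finite Y" and f: "\<And>k. k \<in> Y \<Longrightarrow> f k \<in> {0..1}"
  shows "t \<in> mv_terms Y \<Longrightarrow> (c, l) \<in> pieces t \<Longrightarrow> \<forall>m\<in>c. 0 \<le> lin (coords Y) m (homog f) \<Longrightarrow>
    lin (coords Y) l (homog f) = ev f t"
proof (induction t arbitrary: c l)
  case (Gen k)
  then show ?case using lin_form_gen[OF Y, of k "homog f"] by simp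
next
  case (Neg s)
  then obtain l' where l': "(c, l') \<in> pieces s" "l = (\<lambda>v. form_one v - l' v)" by auto
  have "lin (coords Y) l' (homog f) = ev f s" using Neg.IH[OF _ l'(1)] Neg.prems by simp
  then show ?case unfolding l'(2) lin_diff lin_form_one[OF Y] by simp
next
  case (Plus s t)
  then obtain c1 l1 d m1 where p: "(c1, l1) \<in> pieces s" "(d, m1) \<in> pieces t"
    and *: "(c, l) = (insert (\<lambda>v. form_one v - (l1 v + m1 v)) (c1 \<union> d), \<lambda>v. l1 v + m1 v) \<or>
       (c, l) = (insert (\<lambda>v. (l1 v + m1 v) - form_one v) (c1 \<union> d), form_one)"
    by auto
  have "\<forall>m\<in>c1 \<union> d. 0 \<le> lin (coords Y) m (homog f)" using * Plus.prems(3) by auto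
  then have v: "lin (coords Y) l1 (homog f) = ev f s" "lin (coords Y) m1 (homog f) = ev f t"
    using Plus.IH(1)[OF _ p(1)] Plus.IH(2)[OF _ p(2)] Plus.prems(1) by auto
  from * show ?case
  proof
    assume "(c, l) = (insert (\<lambda>v. form_one v - (l1 v + m1 v)) (c1 \<union> d), \<lambda>v. l1 v + m1 v)"
    then have "0 \<le> lin (coords Y) (\<lambda>v. form_one v - (l1 v + m1 v)) (homog f)" "l = (\<lambda>v. l1 v + m1 v)"
      using Plus.prems(3) by auto
    then show ?thesis unfolding lin_diff lin_add lin_form_one[OF Y] v by (simp add: lin_add v)
  next
    assume "(c, l) = (insert (\<lambda>v. (l1 v + m1 v) - form_one v) (c1 \<union> d), form_one)"
    then have "0 \<le> lin (coords Y) (\<lambda>v. (l1 v + m1 v) - form_one v) (homog f)" "l = form_one"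
      using Plus.prems(3) by auto
    then show ?thesis unfolding lin_diff lin_add lin_form_one[OF Y] v by (simp add: lin_form_one[OF Y])
  qed
qed auto

lemma pieces_cover:
  assumes Y: "finite Y" and f: "\<And>k. k \<in> Y \<Longrightarrow> f k \<in> {0..1}"
  shows "t \<in> mv_terms Y \<Longrightarrow> \<exists>c l. (c, l) \<in> pieces t \<and> (\<forall>m\<in>c. 0 \<le> lin (coords Y) m (homog f))"
proof (induction t)
  case (Neg s)
  then obtain c l where "(c, l) \<in> pieces s" "\<forall>m\<in>c. 0 \<le> lin (coords Y) m (homog f)" by force
  then show ?case using pieces_NegI by blast
next
  case (Plus s t)
  then obtain c l where p: "(c, l) \<in> pieces s" "\<forall>m\<in>c. 0 \<le> lin (coords Y) m (homog f)" by force
  obtain d m where q: "(d, m) \<in> pieces t" "\<forall>m\<in>d. 0 \<le> lin (coords Y) m (homog f)" using Plus by auto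
  show ?case
  proof (cases "lin (coords Y) l (homog f) + lin (coords Y) m (homog f) \<le> 1")
    case True
    have mem: "(insert (\<lambda>v. form_one v - (l v + m v)) (c \<union> d), \<lambda>v. l v + m v) \<in> pieces (Plus s t)"
      using p(1) q(1) by (rule pieces_PlusI)
    have "0 \<le> lin (coords Y) (\<lambda>v. form_one v - (l v + m v)) (homog f)"
      unfolding lin_diff lin_add lin_form_one[OF Y] using True by simp
    then have "\<forall>m\<in>insert (\<lambda>v. form_one v - (l v + m v)) (c \<union> d). 0 \<le> lin (coords Y) m (homog f)"
      using p(2) q(2) by blast
    with mem show ?thesis by (intro exI conjI)
  next
    case False
    have mem: "(insert (\<lambda>v. (l v + m v) - form_one v) (c \<union> d), form_one) \<in> pieces (Plus s t)"
      using p(1) q(1) by (rule pieces_PlusI)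
    have "0 \<le> lin (coords Y) (\<lambda>v. (l v + m v) - form_one v) (homog f)"
      unfolding lin_diff lin_add lin_form_one[OF Y] using False by simp
    then have "\<forall>m\<in>insert (\<lambda>v. (l v + m v) - form_one v) (c \<union> d). 0 \<le> lin (coords Y) m (homog f)"
      using p(2) q(2) by blast
    with mem show ?thesis by (intro exI conjI)
  qed
qed auto

lemma rational_polyhedron_Union:
  assumes "finite \<P>" "\<And>P. P \<in> \<P> \<Longrightarrow> rational_polyhedron Y P"
  shows "rational_polyhedron Y (\<Union>\<P>)"
proof -
  have "\<forall>P\<in>\<P>. \<exists>F. finite F \<and> (\<forall>S\<in>F. rational_simplex Y S) \<and> P = \<Union> F"
    using assms(2) unfolding rational_polyhedron_def by blast
  then obtain F where F: "\<forall>P\<in>\<P>. finite (F P) \<and> (\<forall>S\<in>F P. rational_simplex Y S) \<and> P = \<Union> (F P)"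
    by (rule bchoice[THEN exE])
  have "(\<Union>P\<in>\<P>. \<Union> (F P)) = (\<Union>P\<in>\<P>. P)"
    by (rule SUP_cong[OF HOL.refl]) (use F in simp)
  moreover have "\<Union> (\<Union>P\<in>\<P>. F P) = (\<Union>P\<in>\<P>. \<Union> (F P))" by blast
  ultimately have "\<Union>\<P> = \<Union> (\<Union>P\<in>\<P>. F P)" by simp
  moreover have "finite (\<Union>P\<in>\<P>. F P)" using F assms(1) by simp
  moreover have "\<forall>S\<in>\<Union>P\<in>\<P>. F P. rational_simplex Y S" using F by simp
  ultimately show ?thesis unfolding rational_polyhedron_def by (intro exI conjI)
qed

text \<open>On a piece the term function is the form \<open>l\<close>. As term functions are
  nonnegative on the cube, the single inequality \<open>0 \<le> - l\<close> already expresses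
  vanishing there.\<close>

lemma rational_polyhedron_zero_set:
  assumes Y: "finite Y" and t: "t \<in> mv_terms Y"
  shows "rational_polyhedron Y (zero_set Y t)"
proof -
  define \<P> where "\<P> = (\<lambda>(c, l). polytope_on Y (insert (\<lambda>v. - l v) c)) ` pieces t"
  have "zero_set Y t = \<Union>\<P>"
  proof (intro equalityI subsetI)
    fix f assume f: "f \<in> zero_set Y t"
    then have f01: "\<And>k. k \<in> Y \<Longrightarrow> f k \<in> {0..1}" by (auto simp: zero_set_def)
    obtain c l where p: "(c, l) \<in> pieces t" "\<forall>m\<in>c. 0 \<le> lin (coords Y) m (homog f)"
      using pieces_cover[where f = f, OF Y f01 t] by blast
    then have "lin (coords Y) l (homog f) = 0"
      using pieces_value[where f = f, OF Y f01 t] f by (auto simp: zero_set_def)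
    then have "f \<in> polytope_on Y (insert (\<lambda>v. - l v) c)"
      using f p by (auto simp: polytope_on_def zero_set_def lin_minus)
    then show "f \<in> \<Union>\<P>" using p by (force simp: \<P>_def)
  next
    fix f assume "f \<in> \<Union>\<P>"
    then obtain c l where p: "(c, l) \<in> pieces t" "f \<in> polytope_on Y (insert (\<lambda>v. - l v) c)"
      by (auto simp: \<P>_def)
    then have f: "f \<in> Y \<rightarrow>\<^sub>E {0..1}" "\<forall>m\<in>c. 0 \<le> lin (coords Y) m (homog f)" "lin (coords Y) l (homog f) \<le> 0"
      by (auto simp: polytope_on_def lin_minus)
    then have f01: "\<And>k. k \<in> Y \<Longrightarrow> f k \<in> {0..1}" by auto
    have "lin (coords Y) l (homog f) = ev f t"
      using pieces_value[where f = f, OF Y f01 t] p f by auto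
    then show "f \<in> zero_set Y t" using f ev_range(1)[where f = f, OF t f01] by (simp add: zero_set_def)
  qed
  moreover have "rational_polyhedron Y (\<Union>\<P>)"
    using finite_pieces[of t] finite_pieces_constraints[of _ _ t] Y
    by (intro rational_polyhedron_Union) (auto simp: \<P>_def intro!: rational_polyhedron_polytope_on)
  ultimately show ?thesis by simp
qed

section \<open>Clipped integer forms are term functions\<close>

definition clip :: "real \<Rightarrow> real" where
  "clip x = min 1 (max 0 x)"

text \<open>All integer shifts are needed at once, because \<open>clip_add\<close> expresses one shift through the next.\<close>

definition clip_term_definable :: "'k set \<Rightarrow> (('k \<Rightarrow> real) \<Rightarrow> real) \<Rightarrow> bool" where
  "clip_term_definable Y \<phi> \<longleftrightarrow> (\<forall>n::int. \<exists>t\<in>mv_terms Y. \<forall>f. (\<forall>k\<in>Y. f k \<in> {0..1}) \<longrightarrow> ev f t = clip (\<phi> f + of_int n))"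

text \<open>The right side is the MV-product of the truncated sum of \<open>clip a\<close> and
  \<open>x\<close> with \<open>clip (a + 1)\<close>. For \<open>a\<close> in \<open>[0,1]\<close>
  the second factor is 1 and truncation at 1 is all that happens; for \<open>a\<close> in
  \<open>[-1,0]\<close> the first factor is \<open>x\<close> and the product is
  \<open>max 0 (a + x)\<close>; beyond these intervals both sides are constantly 0 or 1.\<close>

lemma clip_add:
  assumes "0 \<le> x" "x \<le> 1"
  shows "clip (a + x) = 1 - min 1 ((1 - min 1 (clip a + x)) + (1 - clip (a + 1)))"
  using assms by (simp add: clip_def min_def max_def)

lemma clip_term_definable_add_term:
  assumes \<phi>: "clip_term_definable Y \<phi>" and s: "s \<in> mv_terms Y"
  shows "clip_term_definable Y (\<lambda>f. \<phi> f + ev f s)"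
  unfolding clip_term_definable_def
proof
  fix n :: int
  obtain t where t: "t \<in> mv_terms Y" "\<And>f. \<forall>k\<in>Y. f k \<in> {0..1} \<Longrightarrow> ev f t = clip (\<phi> f + of_int n)"
    using \<phi> unfolding clip_term_definable_def by metis
  obtain t' where t': "t' \<in> mv_terms Y" "\<And>f. \<forall>k\<in>Y. f k \<in> {0..1} \<Longrightarrow> ev f t' = clip (\<phi> f + of_int (n + 1))"
    using \<phi> unfolding clip_term_definable_def by metis
  have "ev f (Neg (Plus (Neg (Plus t s)) (Neg t'))) = clip (\<phi> f + ev f s + of_int n)"
    if f: "\<forall>k\<in>Y. f k \<in> {0..1}" for f
    using clip_add[of "ev f s" "\<phi> f + of_int n"] ev_range[OF s, of f] f t(2)[OF f] t'(2)[OF f]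
    by (simp add: algebra_simps)
  then show "\<exists>t\<in>mv_terms Y. \<forall>f. (\<forall>k\<in>Y. f k \<in> {0..1}) \<longrightarrow> ev f t = clip (\<phi> f + ev f s + of_int n)"
    using s t(1) t'(1) by (intro bexI[of _ "Neg (Plus (Neg (Plus t s)) (Neg t'))"]) auto
qed

lemma clip_term_definable_shift: "clip_term_definable Y (\<lambda>f. \<phi> f + of_int a) \<longleftrightarrow> clip_term_definable Y \<phi>"
proof -
  have imp: "clip_term_definable Y (\<lambda>f. \<phi> f + of_int b)" if "clip_term_definable Y \<phi>" for \<phi> :: "('a \<Rightarrow> real) \<Rightarrow> real" and b
    unfolding clip_term_definable_def
  proof
    fix n
    show "\<exists>t\<in>mv_terms Y. \<forall>f. (\<forall>k\<in>Y. f k \<in> {0..1}) \<longrightarrow> ev f t = clip (\<phi> f + of_int b + of_int n)"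
      using that[unfolded clip_term_definable_def, rule_format, of "b + n"] by (simp add: add.assoc)
  qed
  show ?thesis using imp[of "\<lambda>f. \<phi> f + of_int a" "- a"] imp[of \<phi> a] by auto
qed

lemma clip_term_definable_add_gen:
  assumes \<phi>: "clip_term_definable Y \<phi>" and k: "k \<in> Y"
  shows "clip_term_definable Y (\<lambda>f. \<phi> f + of_int a * f k)"
proof (induction a rule: int_induct[where k = 0])
  case base
  show ?case using \<phi> by simp
next
  case (step1 i)
  show ?case using clip_term_definable_add_term[OF step1.IH, of "Gen k"] k by (simp add: algebra_simps)
next
  case (step2 i)
  \<comment> \<open>Subtracting \<open>f k\<close> is done by adding \<open>Neg (Gen k)\<close>,
    worth \<open>1 - f k\<close>; the surplus 1 is an integer shift and is removed as such.\<close>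
  have "clip_term_definable Y (\<lambda>f. (\<phi> f + of_int (i - 1) * f k) + of_int 1)"
    using clip_term_definable_add_term[OF step2.IH, of "Neg (Gen k)"] k by (simp add: algebra_simps)
  then show ?case by (simp only: clip_term_definable_shift)
qed

text \<open>The variables are added one after the other to a constant, whose clipped shifts are 0 or
  1; the constant term of the form is one more shift. This is the usual preparation for McNaughton's
  theorem.\<close>

lemma clip_term_definable_lin:
  assumes "finite Y"
  shows "clip_term_definable Y (\<lambda>f. lin (coords Y) l (homog f))"
proof -
  have "clip_term_definable Y (\<lambda>f. \<Sum>k\<in>Z. of_int (l (Some k)) * f k)" if "finite Z" "Z \<subseteq> Y" for Z
    using that
  proof (induction rule: finite_induct)
    case empty
    have one: "clip (of_int n) = (if 0 < n then 1 else 0)" for n :: int by (auto simp: clip_def)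
    have "\<exists>t\<in>mv_terms Y. \<forall>f. (\<forall>k\<in>Y. f k \<in> {0..1}) \<longrightarrow> ev f t = clip (of_int n)" for n
      unfolding one by (cases "0 < n") (auto intro: bexI[of _ "Neg Zero"] bexI[of _ Zero])
    then show ?case by (simp add: clip_term_definable_def)
  next
    case (insert k Z)
    then show ?case using clip_term_definable_add_gen[OF insert.IH, of k "l (Some k)"] by (simp add: add.commute)
  qed
  from clip_term_definable_shift[THEN iffD2, OF this[OF assms order.refl], of "l None"]
  show ?thesis using assms by (simp add: lin_coords add.commute)
qed

section \<open>Polyhedra are zero sets of terms\<close>

lemma zero_set_Plus:
  assumes "s \<in> mv_terms Y" "t \<in> mv_terms Y"
  shows "zero_set Y (Plus s t) = zero_set Y s \<inter> zero_set Y t"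
  using ev_range[OF assms(1)] ev_range[OF assms(2)]
  by (auto simp: zero_set_def PiE_iff min_def add_nonneg_eq_0_iff)

text \<open>The expression that \<open>mv_meet\<close> unfolds to, so that it represents the meet of
  the free MV-algebra literally.\<close>

definition meet_term :: "'k mv_term \<Rightarrow> 'k mv_term \<Rightarrow> 'k mv_term" where
  "meet_term s t = Neg (Plus (Neg (Plus (Neg (Neg s)) (Neg t))) (Neg t))"

lemma zero_set_meet_term:
  assumes "s \<in> mv_terms Y" "t \<in> mv_terms Y"
  shows "zero_set Y (meet_term s t) = zero_set Y s \<union> zero_set Y t"
proof -
  have "ev f (meet_term s t) = min (ev f s) (ev f t)" if "f \<in> Y \<rightarrow>\<^sub>E {0..1}" for f
    using ev_range[OF assms(1), of f] ev_range[OF assms(2), of f] that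
    by (auto simp: meet_term_def min_def PiE_iff)
  moreover have "min (ev f s) (ev f t) = 0 \<longleftrightarrow> ev f s = 0 \<or> ev f t = 0" if "f \<in> Y \<rightarrow>\<^sub>E {0..1}" for f
    using ev_range[OF assms(1), of f] ev_range[OF assms(2), of f] that
    by (auto simp: min_def PiE_iff)
  ultimately have "ev f (meet_term s t) = 0 \<longleftrightarrow> ev f s = 0 \<or> ev f t = 0" if "f \<in> Y \<rightarrow>\<^sub>E {0..1}" for f
    using that by simp
  then show ?thesis unfolding zero_set_def by blast
qed

text \<open>The half-space \<open>0 \<le> l\<close> is the zero set of a term for the clipped form
  \<open>- l\<close>, and \<open>Plus\<close> intersects zero sets.\<close>

lemma polytope_on_zero_set:
  assumes Y: "finite Y" and S: "finite S"
  shows "\<exists>t\<in>mv_terms Y. polytope_on Y S = zero_set Y t"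
  using S
proof (induction rule: finite_induct)
  case empty
  show ?case by (intro bexI[of _ Zero]) (auto simp: polytope_on_def zero_set_def)
next
  case (insert l S)
  then obtain t where t: "t \<in> mv_terms Y" "polytope_on Y S = zero_set Y t" by blast
  obtain s where s: "s \<in> mv_terms Y"
    "\<And>f. \<forall>k\<in>Y. f k \<in> {0..1} \<Longrightarrow> ev f s = clip (lin (coords Y) (\<lambda>v. - l v) (homog f) + of_int 0)"
    using clip_term_definable_lin[OF Y, of "\<lambda>v. - l v"] unfolding clip_term_definable_def by metis
  have "clip (- x + of_int 0) = 0 \<longleftrightarrow> 0 \<le> x" for x by (auto simp: clip_def min_def max_def)
  then have "ev f s = 0 \<longleftrightarrow> 0 \<le> lin (coords Y) l (homog f)" if "f \<in> Y \<rightarrow>\<^sub>E {0..1}" for f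
    using s(2)[of f] that unfolding lin_minus by (auto simp: PiE_iff)
  then have "polytope_on Y (insert l S) = polytope_on Y S \<inter> zero_set Y s"
    by (auto simp: polytope_on_def zero_set_def)
  also have "\<dots> = zero_set Y (Plus t s)" using zero_set_Plus[OF t(1) s(1)] t by simp
  finally show ?case using s t by (intro bexI[of _ "Plus t s"]) simp_all
qed

lemma rational_polyhedron_is_zero_set:
  assumes Y: "finite Y" and P: "rational_polyhedron Y P"
  shows "\<exists>t\<in>mv_terms Y. P = zero_set Y t"
proof -
  obtain \<S> where \<S>: "finite \<S>" "\<forall>S\<in>\<S>. rational_simplex Y S" "P = \<Union>\<S>"
    using P unfolding rational_polyhedron_def by blast
  have "\<exists>t\<in>mv_terms Y. \<Union>\<S> = zero_set Y t" using \<S>(1,2)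
  proof (induction rule: finite_induct)
    case empty
    show ?case by (intro bexI[of _ "Neg Zero"]) (auto simp: zero_set_def)
  next
    case (insert S \<S>)
    then obtain t where t: "t \<in> mv_terms Y" "\<Union>\<S> = zero_set Y t" by auto
    obtain s where s: "s \<in> mv_terms Y" "S = zero_set Y s"
      using rational_simplex_polytope_on[OF Y, of S] polytope_on_zero_set[OF Y] insert.prems
      by (metis insertI1)
    have "\<Union> (insert S \<S>) = zero_set Y (meet_term s t)"
      using zero_set_meet_term[OF s(1) t(1)] s t by simp
    then show ?case using s t by (intro bexI[of _ "meet_term s t"]) (simp_all add: meet_term_def)
  qed
  then show ?thesis using \<S> by simp
qed

text \<open>A term has finitely many variables, and these serve as the base of its cylinder;
  conversely a term over the base is a term over \<open>K\<close>.\<close>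

theorem cylinder_polyhedra_eq_zero_sets: "cylinder_polyhedra K = zero_set K ` mv_terms K"
proof -
  have restrict: "{f \<in> K \<rightarrow>\<^sub>E {0..1}. restrict f Y \<in> zero_set Y t} = zero_set K t"
    if "Y \<subseteq> K" "t \<in> mv_terms Y" for Y t
  proof -
    have "ev (restrict f Y) t = ev f t" for f by (rule mv_eval_cong[OF that(2)]) simp
    moreover have "restrict f Y \<in> Y \<rightarrow>\<^sub>E {0..1}" if "f \<in> K \<rightarrow>\<^sub>E {0..1}" for f
      using that \<open>Y \<subseteq> K\<close> by auto
    ultimately show ?thesis by (auto simp: zero_set_def)
  qed
  show ?thesis
  proof (intro equalityI subsetI)
    fix Z assume "Z \<in> cylinder_polyhedra K"
    then obtain Y P where Y: "finite Y" "Y \<subseteq> K" "rational_polyhedron Y P" "Z = {f \<in> K \<rightarrow>\<^sub>E {0..1}. restrict f Y \<in> P}"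
      unfolding cylinder_polyhedra_def by blast
    obtain t where "t \<in> mv_terms Y" "P = zero_set Y t"
      using rational_polyhedron_is_zero_set[OF Y(1,3)] by blast
    moreover then have "t \<in> mv_terms K" using Y(2) by (auto simp: mv_terms_def)
    ultimately show "Z \<in> zero_set K ` mv_terms K" using restrict[OF Y(2)] Y(4) by blast
  next
    fix Z assume "Z \<in> zero_set K ` mv_terms K"
    then obtain t where t: "t \<in> mv_terms K" "Z = zero_set K t" by blast
    have Y: "finite (set_mv_term t)" "set_mv_term t \<subseteq> K" "t \<in> mv_terms (set_mv_term t)"
      using t(1) by (simp_all add: mv_terms_def)
    show "Z \<in> cylinder_polyhedra K"
      unfolding cylinder_polyhedra_def t(2)
      using restrict[OF Y(2,3)] rational_polyhedron_zero_set[OF Y(1,3)] Y(1,2) by blast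
  qed
qed

section \<open>MV-algebras and their totally ordered quotients\<close>

context mv_algebra begin

declare plus_closed [simp] neg_closed [simp] zero_closed [simp] neg_neg [simp] plus_zero [simp] plus_one [simp]

abbreviation mv_one :: 'a where "mv_one \<equiv> \<ominus> \<zero>"

text \<open>Truncated difference, in the unit interval \<open>max 0 (x - y)\<close>; likewise
  \<open>odot\<close> below is there \<open>max 0 (x + y - 1)\<close>.\<close>

definition sub :: "'a \<Rightarrow> 'a \<Rightarrow> 'a" where "sub x y = \<ominus> (\<ominus> x \<boxplus> y)"

definition odot :: "'a \<Rightarrow> 'a \<Rightarrow> 'a" (infixl \<open>\<odot>\<close> 70) where "x \<odot> y = \<ominus> (\<ominus> x \<boxplus> \<ominus> y)"

abbreviation le :: "'a \<Rightarrow> 'a \<Rightarrow> bool" where "le \<equiv> mv_le A"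

lemma sub_closed [simp]: "x \<in> carrier A \<Longrightarrow> y \<in> carrier A \<Longrightarrow> sub x y \<in> carrier A"
  by (simp add: sub_def)

lemma odot_closed [simp]: "x \<in> carrier A \<Longrightarrow> y \<in> carrier A \<Longrightarrow> x \<odot> y \<in> carrier A"
  by (simp add: odot_def)

lemma zero_plus [simp]: "x \<in> carrier A \<Longrightarrow> \<zero> \<boxplus> x = x"
  using plus_comm[of "\<zero>" x] by simp

lemma one_plus [simp]: "x \<in> carrier A \<Longrightarrow> mv_one \<boxplus> x = mv_one"
  using plus_comm[of "mv_one" x] by simp

lemma plus_left_comm:
  "x \<in> carrier A \<Longrightarrow> y \<in> carrier A \<Longrightarrow> z \<in> carrier A \<Longrightarrow> x \<boxplus> (y \<boxplus> z) = y \<boxplus> (x \<boxplus> z)"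
  by (metis plus_assoc plus_comm)

lemma neg_plus_self [simp]: "x \<in> carrier A \<Longrightarrow> \<ominus> x \<boxplus> x = mv_one"
  using lukasiewicz[of x mv_one] by simp

lemma plus_neg_self [simp]: "x \<in> carrier A \<Longrightarrow> x \<boxplus> \<ominus> x = mv_one"
  using plus_comm[of x "\<ominus> x"] by simp

lemma neg_eq_iff: "x \<in> carrier A \<Longrightarrow> y \<in> carrier A \<Longrightarrow> \<ominus> x = \<ominus> y \<longleftrightarrow> x = y"
  by (metis neg_neg)

lemma le_iff: "le x y \<longleftrightarrow> \<ominus> x \<boxplus> y = mv_one"
  by (simp add: mv_le_def)

lemma le_iff_sub: "x \<in> carrier A \<Longrightarrow> y \<in> carrier A \<Longrightarrow> le x y \<longleftrightarrow> sub x y = \<zero>"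
  using neg_eq_iff[of "\<ominus> x \<boxplus> y" mv_one] by (simp add: le_iff sub_def)

lemma le_refl [simp]: "x \<in> carrier A \<Longrightarrow> le x x"
  by (simp add: le_iff)

lemma le_plus: "x \<in> carrier A \<Longrightarrow> z \<in> carrier A \<Longrightarrow> le x (x \<boxplus> z)"
  by (simp add: le_iff flip: plus_assoc)

lemma le_plus2: "x \<in> carrier A \<Longrightarrow> z \<in> carrier A \<Longrightarrow> le x (z \<boxplus> x)"
  using le_plus[of x z] by (simp add: plus_comm)

lemma sub_plus_cancel: "x \<in> carrier A \<Longrightarrow> y \<in> carrier A \<Longrightarrow> le x y \<Longrightarrow> sub y x \<boxplus> x = y"
  using lukasiewicz[of y x] by (simp add: sub_def le_iff)

lemma le_antisym: "x \<in> carrier A \<Longrightarrow> y \<in> carrier A \<Longrightarrow> le x y \<Longrightarrow> le y x \<Longrightarrow> x = y"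
  using sub_plus_cancel[of x y] by (simp add: le_iff_sub)

lemma le_trans:
  assumes "x \<in> carrier A" "y \<in> carrier A" "z \<in> carrier A" "le x y" "le y z"
  shows "le x z"
proof -
  have "z = (sub z y \<boxplus> sub y x) \<boxplus> x"
    using assms by (simp add: plus_assoc sub_plus_cancel)
  then show ?thesis using le_plus2[of x "sub z y \<boxplus> sub y x"] assms by simp
qed

lemma plus_mono:
  assumes "x \<in> carrier A" "y \<in> carrier A" "z \<in> carrier A" "le x y"
  shows "le (x \<boxplus> z) (y \<boxplus> z)"
proof -
  have "y \<boxplus> z = sub y x \<boxplus> (x \<boxplus> z)"
    using assms sub_plus_cancel[of x y] by (simp flip: plus_assoc)
  then show ?thesis using le_plus2[of "x \<boxplus> z" "sub y x"] assms by simp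
qed

lemma plus_mono2:
  assumes "x \<in> carrier A" "y \<in> carrier A" "z \<in> carrier A" "le x y"
  shows "le (z \<boxplus> x) (z \<boxplus> y)"
  using plus_mono[OF assms] assms by (simp add: plus_comm)

lemma residuation:
  assumes "x \<in> carrier A" "y \<in> carrier A" "z \<in> carrier A"
  shows "le (sub x y) z \<longleftrightarrow> le x (y \<boxplus> z)"
  using assms by (simp add: le_iff sub_def plus_assoc)

lemma le_sub: "x \<in> carrier A \<Longrightarrow> y \<in> carrier A \<Longrightarrow> le x (y \<boxplus> sub x y)"
  using residuation[of x y "sub x y"] by simp

lemma sub_le: "x \<in> carrier A \<Longrightarrow> y \<in> carrier A \<Longrightarrow> le (sub x y) x"
  using le_plus2[of x y] by (simp add: residuation)

lemma sub_antimono: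
  assumes "x \<in> carrier A" "u \<in> carrier A" "v \<in> carrier A" "le u v"
  shows "le (sub x v) (sub x u)"
proof -
  have "le x (u \<boxplus> sub x u)" "le (u \<boxplus> sub x u) (v \<boxplus> sub x u)"
    using assms by (simp_all add: le_sub plus_mono)
  then have "le x (v \<boxplus> sub x u)" using le_trans[of x "u \<boxplus> sub x u" "v \<boxplus> sub x u"] assms by simp
  then show ?thesis using assms by (simp add: residuation)
qed

lemma sub_zero [simp]: "x \<in> carrier A \<Longrightarrow> sub x \<zero> = x"
  by (simp add: sub_def)

lemma sub_neg: "x \<in> carrier A \<Longrightarrow> y \<in> carrier A \<Longrightarrow> sub (\<ominus> x) (\<ominus> y) = sub y x"
  by (simp add: sub_def plus_comm)

lemma sub_sub: "x \<in> carrier A \<Longrightarrow> y \<in> carrier A \<Longrightarrow> z \<in> carrier A \<Longrightarrow> sub x (y \<boxplus> z) = sub (sub x y) z"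
  by (simp add: sub_def plus_assoc)

text \<open>This is the Lukasiewicz axiom for the negated elements; both sides are the meet of
  \<open>x\<close> and \<open>y\<close>.\<close>

lemma sub_sub_comm: "x \<in> carrier A \<Longrightarrow> y \<in> carrier A \<Longrightarrow> sub x (sub x y) = sub y (sub y x)"
  using lukasiewicz[of "\<ominus> y" "\<ominus> x"] by (simp add: sub_def plus_comm)

lemma mv_meet_eq: "x \<in> carrier A \<Longrightarrow> y \<in> carrier A \<Longrightarrow> mv_meet A x y = sub y (sub y x)"
  by (simp add: mv_meet_def mv_join_def sub_def plus_comm)

lemma sub_sub_greatest:
  assumes "x \<in> carrier A" "y \<in> carrier A" "z \<in> carrier A" "le z x" "le z y"
  shows "le z (sub x (sub x y))"
proof -
  have "z = sub x (sub x z)" using assms by (subst sub_sub_comm) (simp_all add: le_iff_sub)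
  moreover have "le (sub x (sub x z)) (sub x (sub x y))"
    using assms by (intro sub_antimono) auto
  ultimately show ?thesis by simp
qed

text \<open>The bound on \<open>c\<close> means that \<open>c \<boxplus> m\<close> is an untruncated
  sum, from which \<open>m\<close> can be taken off again.\<close>

lemma plus_sub:
  assumes "c \<in> carrier A" "m \<in> carrier A" "le c (\<ominus> m)"
  shows "sub (c \<boxplus> m) m = c"
proof -
  have "le m (\<ominus> c)" using assms by (simp add: le_iff plus_comm)
  then have "\<ominus> c = sub (\<ominus> c) m \<boxplus> m" using assms sub_plus_cancel[of m "\<ominus> c"] by simp
  then have "c = \<ominus> (sub (\<ominus> c) m \<boxplus> m)" using assms by (metis neg_neg)
  then show ?thesis using assms by (simp add: sub_def)
qed

text \<open>
  With \<open>m\<close> the meet of \<open>x\<close> and \<open>y\<close>, and \<open>c\<close> the meet in question, \<open>m \<boxplus> c\<close> lies below both \<open>x\<close> and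
  \<open>y\<close>, so \<open>m \<boxplus> c = m\<close>; as \<open>c\<close> lies below \<open>\<ominus> m\<close>, the summand \<open>m\<close> can be cancelled.
\<close>

lemma prelinearity:
  assumes x: "x \<in> carrier A" and y: "y \<in> carrier A"
  shows "mv_meet A (sub x y) (sub y x) = \<zero>"
proof -
  define m where "m = sub x (sub x y)"
  define c where "c = mv_meet A (sub x y) (sub y x)"
  have c: "c = sub (sub x y) (sub (sub x y) (sub y x))" "c = sub (sub y x) (sub (sub y x) (sub x y))"
    unfolding c_def using x y by (simp_all add: mv_meet_eq) (subst sub_sub_comm; simp)
  have [simp]: "m \<in> carrier A" "c \<in> carrier A" using x y c by (simp_all add: m_def)
  have c_le: "le c (sub x y)" "le c (sub y x)"
    using x y sub_le[of "sub x y" "sub (sub x y) (sub y x)"] sub_le[of "sub y x" "sub (sub y x) (sub x y)"] c by simp_all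
  have xm: "m \<boxplus> sub x y = x"
    unfolding m_def using x y by (simp add: sub_plus_cancel sub_le)
  have ym: "m \<boxplus> sub y x = y"
    unfolding m_def using x y by (subst sub_sub_comm) (simp_all add: sub_plus_cancel sub_le)
  have "le (m \<boxplus> c) x" "le (m \<boxplus> c) y"
    using plus_mono2[OF _ _ _ c_le(1), of m] plus_mono2[OF _ _ _ c_le(2), of m] x y xm ym by simp_all
  then have "le (m \<boxplus> c) m" using sub_sub_greatest[of x y "m \<boxplus> c"] x y by (simp add: m_def)
  then have mc: "m \<boxplus> c = m" using le_antisym[of "m \<boxplus> c" m] le_plus[of m c] by simp
  have "le (sub x y) (\<ominus> m)"
    using x y by (simp add: m_def sub_def le_iff plus_comm plus_left_comm)
  then have "le c (\<ominus> m)" using le_trans[of c "sub x y" "\<ominus> m"] c_le x y by simp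
  then have "c = sub (c \<boxplus> m) m" using plus_sub[of c m] by simp
  also have "\<dots> = sub m m" using mc by (simp add: plus_comm)
  also have "\<dots> = \<zero>" by (simp add: sub_def)
  finally show ?thesis by (simp add: c_def)
qed

lemma sub_triangle:
  assumes "x \<in> carrier A" "y \<in> carrier A" "z \<in> carrier A"
  shows "le (sub x z) (sub x y \<boxplus> sub y z)"
proof -
  have "le x (y \<boxplus> sub x y)" "le (y \<boxplus> sub x y) ((z \<boxplus> sub y z) \<boxplus> sub x y)"
    using assms by (simp_all add: le_sub plus_mono)
  then have "le x ((z \<boxplus> sub y z) \<boxplus> sub x y)"
    using le_trans[of x "y \<boxplus> sub x y" "(z \<boxplus> sub y z) \<boxplus> sub x y"] assms by simp
  then show ?thesis using assms by (simp add: residuation plus_assoc plus_comm plus_left_comm)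
qed

lemma sub_plus_right_le:
  assumes "x \<in> carrier A" "y \<in> carrier A" "z \<in> carrier A"
  shows "le (sub (x \<boxplus> z) (y \<boxplus> z)) (sub x y)"
proof -
  have "le (x \<boxplus> z) ((y \<boxplus> sub x y) \<boxplus> z)" using assms by (simp add: le_sub plus_mono)
  then show ?thesis using assms by (simp add: residuation plus_assoc plus_comm plus_left_comm)
qed

section \<open>The product and its mixed associativity with the sum\<close>

lemma odot_comm: "x \<in> carrier A \<Longrightarrow> y \<in> carrier A \<Longrightarrow> x \<odot> y = y \<odot> x"
  by (simp add: odot_def plus_comm)

lemma odot_assoc: "x \<in> carrier A \<Longrightarrow> y \<in> carrier A \<Longrightarrow> z \<in> carrier A \<Longrightarrow> (x \<odot> y) \<odot> z = x \<odot> (y \<odot> z)"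
  by (simp add: odot_def plus_assoc)

lemma odot_eq_sub: "x \<in> carrier A \<Longrightarrow> y \<in> carrier A \<Longrightarrow> x \<odot> y = sub x (\<ominus> y)"
  by (simp add: odot_def sub_def)

lemma odot_le: "x \<in> carrier A \<Longrightarrow> y \<in> carrier A \<Longrightarrow> le (x \<odot> y) x"
  by (simp add: odot_eq_sub sub_le)

lemma odot_zero_iff: "x \<in> carrier A \<Longrightarrow> y \<in> carrier A \<Longrightarrow> x \<odot> y = \<zero> \<longleftrightarrow> le x (\<ominus> y)"
  by (simp add: odot_eq_sub le_iff_sub)

text \<open>Read in the unit interval, neither \<open>x + y\<close> nor \<open>y + z\<close> exceeds
  1, and both sides are \<open>max 0 (x + y + z - 1)\<close>. This lemma and its variants below are
  the cases in the associativity of Chang's addition.\<close>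

lemma plus_odot_zero:
  assumes "x \<in> carrier A" "y \<in> carrier A" "z \<in> carrier A" "x \<odot> y = \<zero>" "y \<odot> z = \<zero>"
  shows "(x \<boxplus> y) \<odot> z = x \<odot> (y \<boxplus> z)"
proof -
  define d where "d = sub (\<ominus> z) y"
  have d: "\<ominus> z = y \<boxplus> d" "d \<in> carrier A"
    using assms sub_plus_cancel[of y "\<ominus> z"] by (simp_all add: d_def odot_zero_iff plus_comm)
  have "(x \<boxplus> y) \<odot> z = sub (sub (x \<boxplus> y) y) d"
    using assms d by (simp add: odot_eq_sub sub_sub)
  also have "\<dots> = sub x d" using assms by (simp add: plus_sub odot_zero_iff)
  also have "\<dots> = x \<odot> (y \<boxplus> z)" using assms by (simp add: d_def sub_def odot_def plus_comm)
  finally show ?thesis .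
qed

text \<open>The De Morgan dual of \<open>plus_odot_zero\<close>.\<close>

lemma odot_plus_one:
  assumes "x \<in> carrier A" "y \<in> carrier A" "z \<in> carrier A" "x \<boxplus> y = mv_one" "y \<boxplus> z = mv_one"
  shows "(x \<odot> y) \<boxplus> z = x \<boxplus> (y \<odot> z)"
proof -
  have "(\<ominus> x \<boxplus> \<ominus> y) \<odot> (\<ominus> z) = \<ominus> x \<odot> (\<ominus> y \<boxplus> \<ominus> z)"
    using assms by (intro plus_odot_zero) (simp_all add: odot_def)
  then have "\<ominus> ((x \<odot> y) \<boxplus> z) = \<ominus> (x \<boxplus> (y \<odot> z))" using assms by (simp add: odot_def)
  then show ?thesis using assms neg_eq_iff by simp
qed

text \<open>In the unit interval \<open>x + y\<close> reaches 1 and \<open>y + z\<close> does not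
  exceed it, so both sides are \<open>x + y + z - 1\<close> without truncation. Accordingly
  \<open>x\<close> is decomposed as \<open>e \<boxplus> z \<boxplus> f\<close>, where
  \<open>f\<close> is the complement of \<open>y \<boxplus> z\<close>, and \<open>f\<close> is
  removed.\<close>

lemma odot_plus_mixed:
  assumes "x \<in> carrier A" "y \<in> carrier A" "z \<in> carrier A" "x \<boxplus> y = mv_one" "y \<odot> z = \<zero>"
  shows "(x \<odot> y) \<boxplus> z = x \<odot> (y \<boxplus> z)"
proof -
  define e where "e = x \<odot> y"
  define f where "f = sub (\<ominus> y) z"
  have cl: "e \<in> carrier A" "f \<in> carrier A" using assms by (simp_all add: e_def f_def)
  have "le (\<ominus> y) x" using assms by (simp add: le_iff plus_comm)
  then have x: "x = e \<boxplus> \<ominus> y" using assms sub_plus_cancel[of "\<ominus> y" x] by (simp add: e_def odot_eq_sub)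
  have "le z (\<ominus> y)" using assms by (simp add: odot_comm flip: odot_zero_iff)
  then have y: "\<ominus> y = f \<boxplus> z" using assms sub_plus_cancel[of z "\<ominus> y"] by (simp add: f_def)
  have f: "\<ominus> f = y \<boxplus> z" using assms by (simp add: f_def sub_def)
  have "le e y" unfolding e_def using assms by (subst odot_comm) (simp_all add: odot_le)
  then have "le (e \<boxplus> z) (\<ominus> f)" using assms cl by (simp add: f plus_mono)
  then have "e \<boxplus> z = sub ((e \<boxplus> z) \<boxplus> f) f" using assms cl by (simp add: plus_sub)
  also have "(e \<boxplus> z) \<boxplus> f = x" using x y assms cl by (simp add: plus_assoc plus_comm plus_left_comm)
  also have "sub x f = x \<odot> (y \<boxplus> z)" using assms cl f by (simp add: odot_eq_sub) (metis neg_neg)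
  finally show ?thesis by (simp add: e_def)
qed

end

section \<open>Chains and Chang's ordered group\<close>

locale mv_chain = mv_algebra +
  assumes total: "\<lbrakk>x \<in> carrier A; y \<in> carrier A\<rbrakk> \<Longrightarrow> mv_le A x y \<or> mv_le A y x"
    and nontrivial: "\<zero> \<noteq> \<ominus> \<zero>"
begin

text \<open>By totality a sum that stays below the top leaves no product. Hence the exact sum of two
  elements is recorded either by \<open>x \<boxplus> y\<close> without carry or by
  \<open>x \<odot> y\<close> with carry 1.\<close>

lemma odot_zero: "x \<in> carrier A \<Longrightarrow> y \<in> carrier A \<Longrightarrow> x \<boxplus> y \<noteq> mv_one \<Longrightarrow> x \<odot> y = \<zero>"
  using total[of x "\<ominus> y"] by (auto simp: odot_zero_iff le_iff plus_comm)

lemma odot_not_one: "x \<in> carrier A \<Longrightarrow> y \<in> carrier A \<Longrightarrow> x \<noteq> mv_one \<Longrightarrow> x \<odot> y \<noteq> mv_one"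
  using odot_le[of x y] by (auto simp: le_iff)

lemma odot_not_one2: "x \<in> carrier A \<Longrightarrow> y \<in> carrier A \<Longrightarrow> y \<noteq> mv_one \<Longrightarrow> x \<odot> y \<noteq> mv_one"
  using odot_not_one[of y x] by (simp add: odot_comm)

lemma odot_plus_mixed2:
  assumes "x \<in> carrier A" "y \<in> carrier A" "z \<in> carrier A" "x \<odot> y = \<zero>" "y \<boxplus> z = mv_one"
  shows "(x \<boxplus> y) \<odot> z = x \<boxplus> (y \<odot> z)"
  using odot_plus_mixed[of z y x] assms by (simp add: odot_comm plus_comm)

text \<open>Chang's group: the pair \<open>(n, a)\<close> stands for \<open>n * u + a\<close>, where \<open>u\<close> is the top element.\<close>

definition chang_add :: "int \<times> 'a \<Rightarrow> int \<times> 'a \<Rightarrow> int \<times> 'a" where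
  "chang_add p q =
    (if snd p \<boxplus> snd q = mv_one then (fst p + fst q + 1, snd p \<odot> snd q) else (fst p + fst q, snd p \<boxplus> snd q))"

definition chang :: "(int \<times> 'a) monoid" where
  "chang = \<lparr>carrier = {p. snd p \<in> carrier A \<and> snd p \<noteq> mv_one}, mult = chang_add, one = (0, \<zero>)\<rparr>"

text \<open>The cases are which of the two inner sums carries; in each of them one of the four mixed
  associativity laws matches the remainders.\<close>

lemma chang_add_assoc:
  assumes "x \<in> carrier A" "x \<noteq> mv_one" "y \<in> carrier A" "z \<in> carrier A" "z \<noteq> mv_one"
  shows "chang_add (chang_add (m, x) (n, y)) (p, z) = chang_add (m, x) (chang_add (n, y) (p, z))"
proof (cases "x \<boxplus> y = mv_one"; cases "y \<boxplus> z = mv_one")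
  assume "x \<boxplus> y = mv_one" "y \<boxplus> z = mv_one"
  then show ?thesis
    using assms odot_plus_one[of x y z] by (simp add: chang_add_def odot_assoc)
next
  assume xy: "x \<boxplus> y = mv_one" and yz: "y \<boxplus> z \<noteq> mv_one"
  have "(x \<odot> y) \<boxplus> z = x \<odot> (y \<boxplus> z)" using assms xy yz by (simp add: odot_plus_mixed odot_zero)
  moreover have "x \<odot> (y \<boxplus> z) \<noteq> mv_one" using assms by (simp add: odot_not_one)
  moreover have "x \<boxplus> (y \<boxplus> z) = mv_one" using assms xy by (simp flip: plus_assoc)
  ultimately show ?thesis using assms xy yz by (simp add: chang_add_def)
next
  assume xy: "x \<boxplus> y \<noteq> mv_one" and yz: "y \<boxplus> z = mv_one"
  have "(x \<boxplus> y) \<odot> z = x \<boxplus> (y \<odot> z)" using assms xy yz by (simp add: odot_plus_mixed2 odot_zero)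
  moreover have "(x \<boxplus> y) \<odot> z \<noteq> mv_one" using assms by (simp add: odot_not_one2)
  moreover have "(x \<boxplus> y) \<boxplus> z = mv_one" using assms yz by (simp add: plus_assoc)
  ultimately show ?thesis using assms xy yz by (simp add: chang_add_def)
next
  assume "x \<boxplus> y \<noteq> mv_one" "y \<boxplus> z \<noteq> mv_one"
  then show ?thesis
    using assms plus_odot_zero[of x y z] by (simp add: chang_add_def odot_zero plus_assoc)
qed

lemma comm_group_chang: "comm_group chang"
proof (rule comm_groupI)
  fix p q r assume p: "p \<in> carrier chang" and q: "q \<in> carrier chang"
  show "p \<otimes>\<^bsub>chang\<^esub> q \<in> carrier chang" using p q by (auto simp: chang_def chang_add_def odot_not_one)
  show "p \<otimes>\<^bsub>chang\<^esub> q = q \<otimes>\<^bsub>chang\<^esub> p"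
    using p q by (auto simp: chang_def chang_add_def plus_comm odot_comm)
  assume r: "r \<in> carrier chang"
  show "p \<otimes>\<^bsub>chang\<^esub> q \<otimes>\<^bsub>chang\<^esub> r = p \<otimes>\<^bsub>chang\<^esub> (q \<otimes>\<^bsub>chang\<^esub> r)"
    using p q r chang_add_assoc[of "snd p" "snd q" "snd r" "fst p" "fst q" "fst r"] by (simp add: chang_def)
next
  show "\<one>\<^bsub>chang\<^esub> \<in> carrier chang" using nontrivial by (simp add: chang_def)
next
  fix p assume p: "p \<in> carrier chang"
  then show "\<one>\<^bsub>chang\<^esub> \<otimes>\<^bsub>chang\<^esub> p = p" by (auto simp: chang_def chang_add_def)
  \<comment> \<open>The negative of \<open>n * u + a\<close> is
    \<open>(- n - 1) * u + (u - a)\<close>; for \<open>a = \<zero>\<close> the remainder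
    \<open>u - a\<close> would be the excluded top, so that case is separate.\<close>
  show "\<exists>q\<in>carrier chang. q \<otimes>\<^bsub>chang\<^esub> p = \<one>\<^bsub>chang\<^esub>"
  proof (cases "snd p = \<zero>")
    case True
    then show ?thesis using p nontrivial
      by (intro bexI[of _ "(- fst p, \<zero>)"]) (auto simp: chang_def chang_add_def)
  next
    case False
    then have "\<ominus> snd p \<noteq> mv_one" using p neg_eq_iff[of "snd p" "\<zero>"] by (simp add: chang_def)
    then show ?thesis using p
      by (intro bexI[of _ "(- fst p - 1, \<ominus> snd p)"]) (auto simp: chang_def chang_add_def odot_def)
  qed
qed

definition emb :: "'a \<Rightarrow> int \<times> 'a" where
  "emb a = (if a = mv_one then (1, \<zero>) else (0, a))"

lemma emb_closed: "a \<in> carrier A \<Longrightarrow> emb a \<in> carrier chang"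
  using nontrivial by (auto simp: emb_def chang_def)

lemma emb_neg: "a \<in> carrier A \<Longrightarrow> emb (\<ominus> a) \<otimes>\<^bsub>chang\<^esub> emb a = (1, \<zero>)"
  using nontrivial neg_eq_iff[of a "\<zero>"]
  by (auto simp: emb_def chang_def chang_add_def odot_def)

end

section \<open>Values of integer forms in Chang's group\<close>

locale mv_chain_valuation = mv_chain A for A :: "('a, 'b) mv_scheme" (structure) +
  fixes Y :: "'k set" and h :: "'k \<Rightarrow> 'a"
  assumes Y: "finite Y" and h: "\<And>k. k \<in> Y \<Longrightarrow> h k \<in> carrier A"
begin

sublocale G: comm_group chang by (rule comm_group_chang)

text \<open>The homogenizing coordinate is sent to the unit of the group, which takes the place of
  the real number 1.\<close>

definition gam :: "'k option \<Rightarrow> int \<times> 'a" where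
  "gam = case_option (1, \<zero>) (\<lambda>k. emb (h k))"

text \<open>The value of a form in the group, which is written multiplicatively: integer multiples
  appear as powers and the sum as a product.\<close>

definition val :: "('k option \<Rightarrow> int) \<Rightarrow> int \<times> 'a" where
  "val l = finprod chang (\<lambda>v. gam v [^]\<^bsub>chang\<^esub> l v) (coords Y)"

text \<open>Chang's group is ordered lexicographically and remainders are nonnegative, so the
  integer part decides nonnegativity.\<close>

definition nn :: "('k option \<Rightarrow> int) \<Rightarrow> bool" where "nn l \<longleftrightarrow> 0 \<le> fst (val l)"

definition pp :: "('k option \<Rightarrow> int) \<Rightarrow> bool" where "pp l \<longleftrightarrow> 0 \<le> fst (val l) \<and> val l \<noteq> (0, \<zero>)"

lemma gam_closed: "v \<in> coords Y \<Longrightarrow> gam v \<in> carrier chang"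
  using h nontrivial by (auto simp: gam_def emb_closed) (simp add: chang_def)

lemma val_closed: "val l \<in> carrier chang"
  unfolding val_def by (rule G.finprod_closed) (use gam_closed in auto)

lemma val_add: "val (\<lambda>v. l v + m v) = val l \<otimes>\<^bsub>chang\<^esub> val m"
proof -
  have "val (\<lambda>v. l v + m v) = finprod chang (\<lambda>v. gam v [^]\<^bsub>chang\<^esub> l v \<otimes>\<^bsub>chang\<^esub> gam v [^]\<^bsub>chang\<^esub> m v) (coords Y)"
    unfolding val_def by (rule G.finprod_cong') (use gam_closed in \<open>auto simp: G.int_pow_mult\<close>)
  also have "\<dots> = val l \<otimes>\<^bsub>chang\<^esub> val m"
    unfolding val_def by (rule G.finprod_multf) (use gam_closed in auto)
  finally show ?thesis .
qed

lemma val_zero: "val (\<lambda>_. 0) = (0, \<zero>)"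
  unfolding val_def by simp (simp add: chang_def)

lemma val_diff:
  assumes "g \<in> carrier chang" "g \<otimes>\<^bsub>chang\<^esub> val m = val l"
  shows "val (\<lambda>v. l v - m v) = g"
proof -
  have "val (\<lambda>v. l v - m v) \<otimes>\<^bsub>chang\<^esub> val m = val l" using val_add[of "\<lambda>v. l v - m v" m] by simp
  then show ?thesis using assms val_closed G.right_cancel by metis
qed

lemma val_unit:
  assumes "w \<in> coords Y" shows "val (\<lambda>v. if v = w then 1 else 0) = gam w"
proof -
  have "val (\<lambda>v. if v = w then 1 else 0) = finprod chang (\<lambda>v. if w = v then gam v else \<one>\<^bsub>chang\<^esub>) (coords Y)"
    unfolding val_def by (rule G.finprod_cong') (use gam_closed in auto)
  also have "\<dots> = gam w" using assms Y gam_closed by (intro G.finprod_singleton) auto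
  finally show ?thesis .
qed

lemma cone_chang: "cone nn pp"
proof
  fix l m
  have mult: "p \<otimes>\<^bsub>chang\<^esub> q = chang_add p q" for p q by (simp add: chang_def)
  have cl: "snd (val l) \<in> carrier A" "snd (val m) \<in> carrier A" using val_closed by (auto simp: chang_def)
  show add: "nn (\<lambda>v. l v + m v)" if "nn l" "nn m"
    using that unfolding nn_def val_add mult by (simp add: chang_add_def)
  show "pp (\<lambda>v. l v + m v)" if "pp l" "nn m"
  proof -
    \<comment> \<open>A zero sum of nonnegative values admits no carry and forces both remainders to
      be zero.\<close>
    have "val l = (0, \<zero>)" if eq: "chang_add (val l) (val m) = (0, \<zero>)"
    proof -
      have "fst (val l) = 0" "snd (val l) \<boxplus> snd (val m) = \<zero>"
        using eq \<open>pp l\<close> \<open>nn m\<close> by (auto simp: chang_add_def pp_def nn_def split: if_splits)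
      then have "le (snd (val l)) \<zero>" using le_plus[OF cl] by simp
      then have "snd (val l) = \<zero>" using cl by (simp add: le_iff_sub)
      then show ?thesis using \<open>fst (val l) = 0\<close> by (simp add: prod_eq_iff)
    qed
    then show ?thesis using add that unfolding pp_def nn_def val_add mult by auto
  qed
  show "nn l" if "pp l" using that by (simp add: nn_def pp_def)
  show "\<not> pp (\<lambda>_. 0)" by (simp add: pp_def val_zero)
qed

lemma val_form_one: "val form_one = (1, \<zero>)"
  using val_unit[of None] by (simp add: gam_def)

lemma val_one_minus: "a \<in> carrier A \<Longrightarrow> val l = emb a \<Longrightarrow> val (\<lambda>v. form_one v - l v) = emb (\<ominus> a)"
  by (rule val_diff) (simp_all add: emb_closed emb_neg val_form_one)

lemma fst_emb: "0 \<le> fst (emb a)"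
  by (simp add: emb_def)

lemma mv_eval_closed: "t \<in> mv_terms Y \<Longrightarrow> mv_eval A h t \<in> carrier A"
  by (induction t) (auto simp: h)

text \<open>The pieces depend on the term alone. What \<open>pieces_cover\<close> and
  \<open>pieces_value\<close> say for real points holds for valuations in the chain as well, and
  this makes the two evaluations comparable.\<close>

lemma pieces_valuation:
  "t \<in> mv_terms Y \<Longrightarrow> \<exists>c l. (c, l) \<in> pieces t \<and> (\<forall>m\<in>c. nn m) \<and> val l = emb (mv_eval A h t)"
proof (induction t)
  case (Gen k)
  then show ?case using val_unit[of "Some k"] by (auto simp: gam_def)
next
  case Zero
  then show ?case using nontrivial by (simp add: val_zero emb_def)
next
  case (Neg s)
  then obtain c l where cl: "(c, l) \<in> pieces s" "\<forall>m\<in>c. nn m" "val l = emb (mv_eval A h s)" by auto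
  have "val (\<lambda>v. form_one v - l v) = emb (mv_eval A h (Neg s))"
    using val_one_minus[OF _ cl(3)] mv_eval_closed Neg.prems by simp
  then show ?case using pieces_NegI[OF cl(1)] cl(2) by blast
next
  case (Plus s t)
  define a b where "a = mv_eval A h s" and "b = mv_eval A h t"
  have ab: "a \<in> carrier A" "b \<in> carrier A" using mv_eval_closed Plus.prems by (auto simp: a_def b_def)
  obtain c l where cl: "(c, l) \<in> pieces s" "\<forall>m\<in>c. nn m" "val l = emb a"
    using Plus.IH(1) Plus.prems by (auto simp: a_def)
  obtain d m where dm: "(d, m) \<in> pieces t" "\<forall>m\<in>d. nn m" "val m = emb b"
    using Plus.IH(2) Plus.prems by (auto simp: b_def)
  have sum: "val (\<lambda>v. l v + m v) = chang_add (emb a) (emb b)"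
    using val_add[of l m] cl dm by (simp add: chang_def)
  show ?case
  proof (cases "a \<boxplus> b = mv_one")
    case False
    then have "a \<noteq> mv_one" "b \<noteq> mv_one" using ab by auto
    then have s: "val (\<lambda>v. l v + m v) = emb (a \<boxplus> b)" using sum False by (simp add: emb_def chang_add_def)
    then have "nn (\<lambda>v. form_one v - (l v + m v))"
      using val_one_minus[of "a \<boxplus> b"] ab by (simp add: nn_def fst_emb)
    then have "\<forall>m\<in>insert (\<lambda>v. form_one v - (l v + m v)) (c \<union> d). nn m"
      using cl(2) dm(2) by blast
    moreover have "val (\<lambda>v. l v + m v) = emb (mv_eval A h (Plus s t))" using s by (simp add: a_def b_def)
    ultimately show ?thesis using pieces_PlusI(1)[OF cl(1) dm(1)] by blast
  next
    case True
    \<comment> \<open>\<open>g\<close> is the excess of the exact sum over the unit. Its being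
      nonnegative shows that the truncated piece of \<open>pieces (Plus s t)\<close>
      applies.\<close>
    have "\<exists>g\<in>carrier chang. chang_add g (1, \<zero>) = chang_add (emb a) (emb b) \<and> 0 \<le> fst g"
    proof -
      consider "a = mv_one" | "b = mv_one" | "a \<noteq> mv_one" "b \<noteq> mv_one" by blast
      then show ?thesis
      proof cases
        case 1
        then show ?thesis using ab nontrivial emb_closed[of b]
          by (intro bexI[of _ "emb b"]) (auto simp: emb_def chang_add_def)
      next
        case 2
        then show ?thesis using ab nontrivial emb_closed[of a]
          by (intro bexI[of _ "emb a"]) (auto simp: emb_def chang_add_def)
      next
        case 3
        then show ?thesis using ab True odot_not_one[of a b]
          by (intro bexI[of _ "(0, a \<odot> b)"]) (auto simp: emb_def chang_add_def chang_def)
      qed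
    qed
    then obtain g where g: "g \<in> carrier chang" "chang_add g (1, \<zero>) = chang_add (emb a) (emb b)" "0 \<le> fst g"
      by blast
    have "val (\<lambda>v. (l v + m v) - form_one v) = g"
      by (rule val_diff) (use g in \<open>simp_all add: val_form_one sum chang_def\<close>)
    then have nn1: "nn (\<lambda>v. (l v + m v) - form_one v)" using g(3) by (simp add: nn_def)
    have "val form_one = emb (mv_eval A h (Plus s t))"
      using True by (simp add: val_form_one emb_def a_def b_def)
    moreover have "\<forall>m\<in>insert (\<lambda>v. (l v + m v) - form_one v) (c \<union> d). nn m"
      using nn1 cl(2) dm(2) by blast
    ultimately show ?thesis using pieces_PlusI(2)[OF cl(1) dm(1)] by blast
  qed
qed

text \<open>Choose the pieces of \<open>s\<close> and \<open>t\<close> that apply in the chain.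
  Their finitely many conditions hold in Chang's group, so \<open>feasible\<close> solves them over
  the reals, and dividing by the homogenizing coordinate gives the point.\<close>

theorem real_valuation:
  assumes s: "s \<in> mv_terms Y" "mv_eval A h s \<noteq> \<zero>" and t: "t \<in> mv_terms Y" "mv_eval A h t = \<zero>"
  shows "\<exists>f :: 'k \<Rightarrow> real. (\<forall>k\<in>Y. f k \<in> {0..1}) \<and> ev f s \<noteq> 0 \<and> ev f t = 0"
proof -
  interpret cone nn pp by (rule cone_chang)
  obtain c l where cl: "(c, l) \<in> pieces t" "\<forall>m\<in>c. nn m" "val l = (0, \<zero>)"
    using pieces_valuation[OF t(1)] t(2) nontrivial by (auto simp: emb_def)
  obtain d m where dm: "(d, m) \<in> pieces s" "\<forall>m\<in>d. nn m" "val m = emb (mv_eval A h s)"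
    using pieces_valuation[OF s(1)] by blast
  define e where "e k = (\<lambda>v. if v = Some k then 1 else 0 :: int)" for k :: 'k
  \<comment> \<open>\<open>0 - l\<close> forces the value of \<open>t\<close> to be at most 0, and
    the forms built from \<open>e\<close> place the normalized point in the cube.\<close>
  define N where "N = c \<union> d \<union> {\<lambda>v. 0 - l v} \<union> e ` Y \<union> (\<lambda>k v. form_one v - e k v) ` Y"
  \<comment> \<open>The strict constraint on \<open>m\<close> keeps \<open>s\<close> away from 0,
    and the one on \<open>form_one\<close> permits the division by \<open>r None\<close>.\<close>
  define T where "T = (\<lambda>l. (l, False)) ` N \<union> {(m, True), (form_one, True)}"
  have e: "val (e k) = emb (h k)" if "k \<in> Y" for k
    using val_unit[of "Some k"] that by (simp add: e_def gam_def)
  have "pp m" using dm(3) s(2) nontrivial by (auto simp: pp_def emb_def)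
  moreover have "pp form_one" by (simp add: pp_def val_form_one)
  moreover have "nn q" if q: "q \<in> N" for q
  proof -
    have "val (\<lambda>v. 0 - l v) = (0, \<zero>)"
      by (rule val_diff) (use cl(3) nontrivial in \<open>simp_all add: val_zero chang_def chang_add_def\<close>)
    then have 1: "nn (\<lambda>v. 0 - l v)" by (simp add: nn_def)
    have 2: "nn (e k)" "nn (\<lambda>v. form_one v - e k v)" if "k \<in> Y" for k
      using e[OF that] val_one_minus[of "h k" "e k"] h[OF that] by (simp_all add: nn_def fst_emb)
    show ?thesis using q cl(2) dm(2) 1 2 unfolding N_def by blast
  qed
  ultimately have holds: "\<forall>c\<in>T. holds nn pp c" by (auto simp: T_def holds_def)
  have vanish: "fst q v = 0" if q: "q \<in> T" and v: "v \<notin> coords Y" for q v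
  proof -
    have "p v = 0" if "p \<in> insert l c" for p using pieces_vanish[OF t(1) cl(1) that v] .
    moreover have "p v = 0" if "p \<in> insert m d" for p using pieces_vanish[OF s(1) dm(1) that v] .
    moreover have "e k v = 0" if "k \<in> Y" for k using v that by (auto simp: e_def)
    moreover have "form_one v = 0" using v by auto
    ultimately show ?thesis using q by (auto simp: T_def N_def)
  qed
  have "finite T" using finite_pieces_constraints[OF cl(1)] finite_pieces_constraints[OF dm(1)] Y
    by (simp add: T_def N_def)
  then obtain r :: "'k option \<Rightarrow> real" where r: "sat (coords Y) r T"
    using feasible[of "coords Y" T] holds vanish Y by auto
  have rT: "0 \<le> lin (coords Y) q r" if "q \<in> N" for q
    using r that unfolding sat_def holds_def T_def by force
  have rm: "0 < lin (coords Y) m r" "0 < lin (coords Y) form_one r"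
    using r unfolding sat_def holds_def T_def by force+
  then have r0: "0 < r None" by (simp add: lin_form_one[OF Y])
  define f where "f k = r (Some k) / r None" for k
  have lin_f: "lin (coords Y) q (homog f) = lin (coords Y) q r / r None" for q
  proof -
    have "lin (coords Y) q (homog f) = lin (coords Y) q (\<lambda>v. (1 / r None) * r v)"
      by (rule lin_cong) (use r0 in \<open>auto simp: f_def\<close>)
    then show ?thesis unfolding lin_scale_point by simp
  qed
  have f01: "f k \<in> {0..1}" if k: "k \<in> Y" for k
  proof -
    have "e k \<in> N" "(\<lambda>v. form_one v - e k v) \<in> N" using k unfolding N_def by blast+
    then have "0 \<le> lin (coords Y) (e k) r" "0 \<le> lin (coords Y) (\<lambda>v. form_one v - e k v) r"
      using rT by blast+
    then have "0 \<le> r (Some k)" "r (Some k) \<le> r None"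
      using lin_form_gen[OF Y k, of r] unfolding lin_diff lin_form_one[OF Y] by (simp_all add: e_def)
    then show ?thesis using r0 by (simp add: f_def)
  qed
  have nonneg: "0 \<le> lin (coords Y) q (homog f)" if "q \<in> N" for q
    using rT[OF that] r0 by (simp add: lin_f)
  have "lin (coords Y) l (homog f) = ev f t"
    by (rule pieces_value[OF Y f01 t(1) cl(1)]) (use nonneg in \<open>auto simp: N_def\<close>)
  moreover have "0 \<le> lin (coords Y) (\<lambda>v. 0 - l v) (homog f)"
    by (rule nonneg) (simp add: N_def)
  ultimately have "ev f t = 0" using ev_range(1)[where f = f, OF t(1) f01] by (simp add: lin_minus)
  moreover have "lin (coords Y) m (homog f) = ev f s"
    by (rule pieces_value[OF Y f01 s(1) dm(1)]) (use nonneg in \<open>auto simp: N_def\<close>)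
  then have "ev f s \<noteq> 0" using divide_pos_pos[OF rm(1) r0] by (simp add: lin_f)
  ultimately show ?thesis using f01 by blast
qed

end

section \<open>The Belluce lattice of a free MV-algebra\<close>

locale mv_prime = mv_algebra A for A :: "('a, 'b) mv_scheme" (structure) +
  fixes P :: "'a set"
  assumes prime: "mv_prime_ideal A P"
begin

lemma zero_in: "\<zero> \<in> P"
  and plus_in: "x \<in> P \<Longrightarrow> y \<in> P \<Longrightarrow> x \<boxplus> y \<in> P"
  and down: "x \<in> P \<Longrightarrow> y \<in> carrier A \<Longrightarrow> le y x \<Longrightarrow> y \<in> P"
  and meet_in: "x \<in> carrier A \<Longrightarrow> y \<in> carrier A \<Longrightarrow> mv_meet A x y \<in> P \<Longrightarrow> x \<in> P \<or> y \<in> P"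
  and P_subset: "P \<subseteq> carrier A" and P_proper: "P \<noteq> carrier A"
  using prime unfolding mv_prime_ideal_def mv_ideal_def by blast+

lemma one_notin: "mv_one \<notin> P"
proof
  assume "mv_one \<in> P"
  then have "x \<in> P" if "x \<in> carrier A" for x using down[of mv_one x] that by (simp add: le_iff)
  then show False using P_subset P_proper by blast
qed

definition eqv :: "'a \<Rightarrow> 'a \<Rightarrow> bool" where
  "eqv x y \<longleftrightarrow> x \<in> carrier A \<and> y \<in> carrier A \<and> sub x y \<in> P \<and> sub y x \<in> P"

lemma sub_self [simp]: "x \<in> carrier A \<Longrightarrow> sub x x = \<zero>"
  by (simp flip: le_iff_sub)

lemma eqv_refl: "x \<in> carrier A \<Longrightarrow> eqv x x"
  by (simp add: eqv_def zero_in)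

lemma eqv_sym: "eqv x y \<Longrightarrow> eqv y x"
  by (simp add: eqv_def)

lemma sub_trans_in:
  assumes "x \<in> carrier A" "y \<in> carrier A" "z \<in> carrier A" "sub x y \<in> P" "sub y z \<in> P"
  shows "sub x z \<in> P"
  using down[OF plus_in[OF assms(4,5)], of "sub x z"] sub_triangle[OF assms(1-3)] assms by simp

lemma eqv_trans: "eqv x y \<Longrightarrow> eqv y z \<Longrightarrow> eqv x z"
  unfolding eqv_def by (blast intro: sub_trans_in)

lemma eqv_neg: "eqv x y \<Longrightarrow> eqv (\<ominus> x) (\<ominus> y)"
  by (simp add: eqv_def sub_neg)

lemma eqv_plus_right:
  assumes "eqv x y" "z \<in> carrier A" shows "eqv (x \<boxplus> z) (y \<boxplus> z)"
proof -
  have c: "x \<in> carrier A" "y \<in> carrier A" "sub x y \<in> P" "sub y x \<in> P" using assms by (auto simp: eqv_def)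
  then show ?thesis
    using down[OF c(3), of "sub (x \<boxplus> z) (y \<boxplus> z)"] down[OF c(4), of "sub (y \<boxplus> z) (x \<boxplus> z)"]
      sub_plus_right_le[of x y z] sub_plus_right_le[of y x z] assms(2)
    by (simp add: eqv_def)
qed

text \<open>The quotient by \<open>P\<close> is carried by chosen representatives, so that it stays on the type of \<open>A\<close>.\<close>

definition rep :: "'a \<Rightarrow> 'a" where "rep x = (SOME y. eqv x y)"

lemma eqv_rep: "x \<in> carrier A \<Longrightarrow> eqv x (rep x)"
  unfolding rep_def by (rule someI) (rule eqv_refl)

lemma rep_closed [simp]: "x \<in> carrier A \<Longrightarrow> rep x \<in> carrier A"
  using eqv_rep by (auto simp: eqv_def)

lemma rep_eqI: "eqv x y \<Longrightarrow> rep x = rep y"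
  unfolding rep_def by (rule arg_cong[of _ _ Eps]) (blast intro: eqv_sym eqv_trans)

lemma rep_eq_iff: "x \<in> carrier A \<Longrightarrow> y \<in> carrier A \<Longrightarrow> rep x = rep y \<longleftrightarrow> eqv x y"
  using rep_eqI eqv_rep eqv_sym eqv_trans by metis

lemma rep_plus_left: "x \<in> carrier A \<Longrightarrow> y \<in> carrier A \<Longrightarrow> rep (rep x \<boxplus> y) = rep (x \<boxplus> y)"
  by (rule rep_eqI, rule eqv_plus_right, rule eqv_sym, rule eqv_rep)

lemma rep_plus_right: "x \<in> carrier A \<Longrightarrow> y \<in> carrier A \<Longrightarrow> rep (x \<boxplus> rep y) = rep (x \<boxplus> y)"
  using rep_plus_left[of y x] by (simp add: plus_comm)

lemma rep_neg: "x \<in> carrier A \<Longrightarrow> rep (\<ominus> rep x) = rep (\<ominus> x)"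
  by (rule rep_eqI, rule eqv_neg, rule eqv_sym, rule eqv_rep)

lemma rep_rep: "x \<in> carrier A \<Longrightarrow> rep (rep x) = rep x"
  by (rule rep_eqI, rule eqv_sym, rule eqv_rep)

definition quot :: "'a mv" where
  "quot = \<lparr>carrier = rep ` carrier A, mv_plus = (\<lambda>x y. rep (x \<boxplus> y)), mv_neg = (\<lambda>x. rep (\<ominus> x)), mv_zero = rep \<zero>\<rparr>"

text \<open>Totality is prelinearity: the meet of \<open>sub a b\<close> and \<open>sub b a\<close>
  is zero, hence lies in \<open>P\<close>, so primeness puts one of the two differences into
  \<open>P\<close>.\<close>

lemma mv_chain_quot: "mv_chain quot"
proof -
  note s = rep_plus_left rep_plus_right rep_neg rep_rep
  have q: "mv_algebra quot"
  proof (unfold_locales, goal_cases)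
    case (9 x y)
    then obtain a b where ab: "a \<in> carrier A" "b \<in> carrier A" "x = rep a" "y = rep b" by (auto simp: quot_def)
    then show ?case using lukasiewicz[of a b] by (simp add: quot_def s)
  next
    case (5 x y)
    then show ?case by (auto simp: quot_def plus_comm)
  qed (auto simp: quot_def s plus_assoc)
  interpret Q: mv_algebra quot by (rule q)
  have le_quot: "mv_le quot (rep a) (rep b)" if "a \<in> carrier A" "b \<in> carrier A" "sub a b \<in> P" for a b
  proof -
    have "eqv (\<ominus> a \<boxplus> b) mv_one"
      using that zero_in by (simp add: eqv_def) (simp add: sub_def)
    then have "rep (\<ominus> a \<boxplus> b) = rep mv_one" by (rule rep_eqI)
    then show ?thesis using that by (simp add: mv_le_def quot_def s)
  qed
  show ?thesis
  proof
    fix x y assume "x \<in> carrier quot" "y \<in> carrier quot"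
    then obtain a b where ab: "a \<in> carrier A" "b \<in> carrier A" "x = rep a" "y = rep b" by (auto simp: quot_def)
    have "sub a b \<in> P \<or> sub b a \<in> P"
      using meet_in[of "sub a b" "sub b a"] prelinearity[of a b] ab zero_in by simp
    then show "mv_le quot x y \<or> mv_le quot y x" using le_quot ab by auto
  next
    have "\<not> eqv \<zero> mv_one" using one_notin by (auto simp: eqv_def)
    then show "\<zero>\<^bsub>quot\<^esub> \<noteq> \<ominus>\<^bsub>quot\<^esub> \<zero>\<^bsub>quot\<^esub>" by (simp add: quot_def s rep_eq_iff)
  qed
qed

lemma mv_eval_quot:
  assumes "t \<in> mv_terms K" "\<And>k. k \<in> K \<Longrightarrow> h k \<in> carrier A"
  shows "mv_eval A h t \<in> carrier A \<and> mv_eval quot (\<lambda>k. rep (h k)) t = rep (mv_eval A h t)"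
  using assms(1)
  by (induction t) (use assms(2) in \<open>auto simp: quot_def rep_plus_left rep_plus_right rep_neg\<close>)

lemma rep_eq_zero_iff: "x \<in> carrier A \<Longrightarrow> rep x = rep \<zero> \<longleftrightarrow> x \<in> P"
  using zero_in by (simp add: rep_eq_iff eqv_def) (simp add: sub_def)

end

section \<open>Prime ideals of the free MV-algebra and points of the cube\<close>

lemma mv_eval_free_mv: "t \<in> mv_terms K \<Longrightarrow> mv_eval (free_mv K) (\<lambda>k. mv_cong K `` {Gen k}) t = mv_cong K `` {t}"
  by (induction t) (auto simp: free_mv_zero free_mv_neg free_mv_plus)

text \<open>Otherwise \<open>t\<close> would vanish and \<open>s\<close> would not in the chain
  quotient, and \<open>real_valuation\<close> would give a point of the cube in the zero set of
  \<open>t\<close> but not in that of \<open>s\<close>.\<close>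

theorem prime_ideal_zero_set:
  assumes P: "mv_prime_ideal (free_mv K) P"
    and s: "s \<in> mv_terms K" and t: "t \<in> mv_terms K" "mv_cong K `` {t} \<in> P"
    and sub: "zero_set K t \<subseteq> zero_set K s"
  shows "mv_cong K `` {s} \<in> P"
proof (rule ccontr)
  assume notin: "mv_cong K `` {s} \<notin> P"
  interpret mv_prime "free_mv K" P
    using mv_algebra_free_mv[of K] P by (simp add: mv_prime_def mv_prime_axioms_def)
  define h where "h k = rep (mv_cong K `` {Gen k})" for k
  define Y where "Y = set_mv_term s \<union> set_mv_term t"
  have Y: "finite Y" "Y \<subseteq> K" "s \<in> mv_terms Y" "t \<in> mv_terms Y"
    using s t by (auto simp: Y_def mv_terms_def)
  have ev_quot: "mv_eval quot h r = rep (mv_cong K `` {r})" if "r \<in> mv_terms K" for r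
    using mv_eval_quot[OF that, of "\<lambda>k. mv_cong K `` {Gen k}"] that
    by (simp add: mv_eval_free_mv free_mv_carrierI h_def[abs_def])
  have V: "mv_chain_valuation quot Y h"
    unfolding mv_chain_valuation_def mv_chain_valuation_axioms_def
    using mv_chain_quot Y by (auto simp: h_def quot_def intro!: imageI free_mv_carrierI)
  have "mv_eval quot h s \<noteq> \<zero>\<^bsub>quot\<^esub>" "mv_eval quot h t = \<zero>\<^bsub>quot\<^esub>"
    using s t notin by (simp_all add: ev_quot) (simp_all add: quot_def rep_eq_zero_iff free_mv_carrierI)
  then obtain f :: "'a \<Rightarrow> real" where f: "\<And>k. k \<in> Y \<Longrightarrow> f k \<in> {0..1}" "ev f s \<noteq> 0" "ev f t = 0"
    using mv_chain_valuation.real_valuation[OF V Y(3) _ Y(4)] by blast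
  \<comment> \<open>The point is known on the variables of \<open>s\<close> and \<open>t\<close>
    only; the other coordinates get the value 0, which affects neither term.\<close>
  define f' where "f' = (\<lambda>k\<in>K. if k \<in> Y then f k else 0)"
  have "ev f' r = ev f r" if "r \<in> mv_terms Y" for r
    using that by (rule mv_eval_cong) (use Y in \<open>auto simp: f'_def\<close>)
  moreover have "f' \<in> K \<rightarrow>\<^sub>E {0..1}" using f(1) by (auto simp: f'_def)
  ultimately show False using sub f(2,3) Y(3,4) by (auto simp: zero_set_def)
qed

lemma free_mv_meet:
  "s \<in> mv_terms K \<Longrightarrow> t \<in> mv_terms K \<Longrightarrow>
    mv_meet (free_mv K) (mv_cong K `` {s}) (mv_cong K `` {t}) = mv_cong K `` {meet_term s t}"
  by (simp add: mv_meet_def mv_join_def meet_term_def free_mv_neg free_mv_plus)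

text \<open>The ideal is the kernel of the homomorphism into the unit interval that extends
  \<open>f\<close>; it is prime because meets are evaluated as minima of numbers.\<close>

lemma mv_prime_ideal_at_point:
  assumes f: "f \<in> K \<rightarrow>\<^sub>E {0..1}"
  shows "\<exists>P. mv_prime_ideal (free_mv K) P \<and> (\<forall>t\<in>mv_terms K. mv_cong K `` {t} \<in> P \<longleftrightarrow> ev f t = 0)"
proof -
  obtain g where g: "g \<in> mv_homs (free_mv K) unit_mv" "\<forall>k\<in>K. g (mv_cong K `` {Gen k}) = f k"
    using free_mv_universal[OF mv_algebra_unit_mv, of f K] f by auto
  have hom: "g (mv_cong K `` {Neg s}) = 1 - g (mv_cong K `` {s})"
    "g (mv_cong K `` {Plus s t}) = min 1 (g (mv_cong K `` {s}) + g (mv_cong K `` {t}))"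
    if "s \<in> mv_terms K" "t \<in> mv_terms K" for s t
    using g(1) that unfolding mv_homs_def
    by (simp_all add: free_mv_carrierI flip: free_mv_neg free_mv_plus)
  have hom_zero: "g (mv_cong K `` {Zero}) = 0"
    using g(1) unfolding mv_homs_def by (simp flip: free_mv_zero)
  have gev: "g (mv_cong K `` {t}) = ev f t" if "t \<in> mv_terms K" for t
    using that by (induction t) (simp_all add: hom hom_zero g(2))
  have ev01: "0 \<le> ev f t" "ev f t \<le> 1" if "t \<in> mv_terms K" for t
    using ev_range[OF that, of f] f by (auto simp: PiE_iff)
  define P where "P = {x \<in> carrier (free_mv K). g x = 0}"
  have mem: "mv_cong K `` {t} \<in> P \<longleftrightarrow> ev f t = 0" if "t \<in> mv_terms K" for t
    using that by (simp add: P_def free_mv_carrierI gev)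
  have elim: "\<exists>t\<in>mv_terms K. x = mv_cong K `` {t}" if "x \<in> carrier (free_mv K)" for x
    using that by (elim free_mv_carrierE) blast
  have le: "ev f s \<le> ev f t"
    if "s \<in> mv_terms K" "t \<in> mv_terms K" "mv_le (free_mv K) (mv_cong K `` {s}) (mv_cong K `` {t})" for s t
  proof -
    have "mv_cong K `` {Plus (Neg s) t} = mv_cong K `` {Neg Zero}"
      using that by (simp add: mv_le_def free_mv_neg free_mv_plus free_mv_zero)
    then have "ev f (Plus (Neg s) t) = ev f (Neg Zero)"
      using gev[of "Plus (Neg s) t"] gev[of "Neg Zero"] that by simp
    then show ?thesis by simp
  qed
  have meet0: "ev f s = 0 \<or> ev f t = 0" if "s \<in> mv_terms K" "t \<in> mv_terms K" "ev f (meet_term s t) = 0" for s t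
    using zero_set_meet_term[OF that(1,2)] f that(3) by (auto simp: zero_set_def)
  have "mv_ideal (free_mv K) P"
    unfolding mv_ideal_def
  proof (intro conjI ballI impI)
    show "P \<subseteq> carrier (free_mv K)" by (auto simp: P_def)
    show "\<zero>\<^bsub>free_mv K\<^esub> \<in> P" by (simp add: free_mv_zero mem)
    fix x assume x: "x \<in> P"
    then obtain s where s: "s \<in> mv_terms K" "x = mv_cong K `` {s}" using elim by (auto simp: P_def)
    show "x \<boxplus>\<^bsub>free_mv K\<^esub> y \<in> P" if y: "y \<in> P" for y
    proof -
      obtain t where "t \<in> mv_terms K" "y = mv_cong K `` {t}" using y elim by (auto simp: P_def)
      then show ?thesis using s x y by (simp add: free_mv_plus mem)
    qed
    show "y \<in> P" if y: "y \<in> carrier (free_mv K)" "mv_le (free_mv K) y x" for y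
    proof -
      obtain t where t: "t \<in> mv_terms K" "y = mv_cong K `` {t}" using y elim by blast
      then have "ev f t \<le> 0" using le[of t s] s x y mem by simp
      then show ?thesis using t ev01(1)[of t] by (simp add: mem)
    qed
  qed
  moreover have "P \<noteq> carrier (free_mv K)"
    using mem[of "Neg Zero"] free_mv_carrierI[of "Neg Zero" K] by auto
  moreover have "x \<in> P \<or> y \<in> P"
    if x: "x \<in> carrier (free_mv K)" and y: "y \<in> carrier (free_mv K)" and xy: "mv_meet (free_mv K) x y \<in> P" for x y
  proof -
    obtain s where s: "s \<in> mv_terms K" "x = mv_cong K `` {s}" using elim[OF x] by blast
    obtain t where t: "t \<in> mv_terms K" "y = mv_cong K `` {t}" using elim[OF y] by blast
    have "meet_term s t \<in> mv_terms K" using s t by (simp add: meet_term_def)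
    then show ?thesis using xy meet0[of s t] s t by (simp add: free_mv_meet mem)
  qed
  ultimately have "mv_prime_ideal (free_mv K) P" unfolding mv_prime_ideal_def by blast
  then show ?thesis using mem by blast
qed

text \<open>The prime ideals at points detect a difference of zero sets, and
  \<open>prime_ideal_zero_set\<close> shows that no other prime ideal detects more.\<close>

lemma belluce_rel_iff_zero_set:
  assumes s: "s \<in> mv_terms K" and t: "t \<in> mv_terms K"
  shows "(mv_cong K `` {s}, mv_cong K `` {t}) \<in> belluce_rel (free_mv K) \<longleftrightarrow> zero_set K s = zero_set K t"
proof
  assume rel: "(mv_cong K `` {s}, mv_cong K `` {t}) \<in> belluce_rel (free_mv K)"
  have "ev f s = 0 \<longleftrightarrow> ev f t = 0" if f: "f \<in> K \<rightarrow>\<^sub>E {0..1}" for f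
    using mv_prime_ideal_at_point[OF f] rel s t unfolding belluce_rel_def by blast
  then show "zero_set K s = zero_set K t" unfolding zero_set_def by blast
next
  assume "zero_set K s = zero_set K t"
  then show "(mv_cong K `` {s}, mv_cong K `` {t}) \<in> belluce_rel (free_mv K)"
    using prime_ideal_zero_set[OF _ s t] prime_ideal_zero_set[OF _ t s] s t
    unfolding belluce_rel_def by (auto simp: free_mv_carrierI)
qed

section \<open>The Belluce lattice as a lattice of zero sets\<close>

definition belluce_class :: "'k set \<Rightarrow> 'k mv_term \<Rightarrow> 'k belluce_element" where
  "belluce_class K s = belluce_rel (free_mv K) `` {mv_cong K `` {s}}"

lemma carrier_belluce: "carrier (belluce (free_mv K)) = belluce_class K ` mv_terms K"
proof -
  have "carrier (free_mv K) = (\<lambda>s. mv_cong K `` {s}) ` mv_terms K"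
    by (auto simp: free_mv_carrierI elim: free_mv_carrierE)
  then have "carrier (belluce (free_mv K)) = (\<lambda>x. belluce_rel (free_mv K) `` {x}) ` (\<lambda>s. mv_cong K `` {s}) ` mv_terms K"
    by (auto simp: belluce_def quotient_def)
  then show ?thesis by (simp add: image_image belluce_class_def)
qed

lemma belluce_classE:
  assumes "x \<in> belluce_class K s" "s \<in> mv_terms K"
  obtains s' where "s' \<in> mv_terms K" "x = mv_cong K `` {s'}" "zero_set K s' = zero_set K s"
proof -
  have "x \<in> carrier (free_mv K)" using assms by (auto simp: belluce_class_def belluce_rel_def)
  then obtain s' where s': "s' \<in> mv_terms K" "x = mv_cong K `` {s'}" by (rule free_mv_carrierE)
  then have "zero_set K s' = zero_set K s"
    using assms belluce_rel_iff_zero_set[OF assms(2) s'(1)] by (auto simp: belluce_class_def)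
  then show ?thesis using that s' by blast
qed

lemma belluce_class_self: "s \<in> mv_terms K \<Longrightarrow> mv_cong K `` {s} \<in> belluce_class K s"
  by (simp add: belluce_class_def belluce_rel_iff_zero_set)

lemma belluce_class_eq_iff:
  assumes s: "s \<in> mv_terms K" and t: "t \<in> mv_terms K"
  shows "belluce_class K s = belluce_class K t \<longleftrightarrow> zero_set K s = zero_set K t"
proof
  assume "belluce_class K s = belluce_class K t"
  then have "(mv_cong K `` {t}, mv_cong K `` {s}) \<in> belluce_rel (free_mv K)"
    using belluce_class_self[OF s] by (simp add: belluce_class_def)
  then show "zero_set K s = zero_set K t" using belluce_rel_iff_zero_set[OF t s] by simp
next
  assume eq: "zero_set K s = zero_set K t"
  have "x \<in> belluce_class K s \<longleftrightarrow> x \<in> belluce_class K t" for x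
  proof -
    have "x \<in> belluce_class K r \<longleftrightarrow> (\<exists>s'\<in>mv_terms K. x = mv_cong K `` {s'} \<and> zero_set K s' = zero_set K r)"
      if "r \<in> mv_terms K" for r
      using that belluce_rel_iff_zero_set[OF that]
      by (auto elim!: belluce_classE) (auto simp: belluce_class_def)
    then show ?thesis using s t eq by simp
  qed
  then show "belluce_class K s = belluce_class K t" by blast
qed

text \<open>The meet of two terms has the union of their zero sets as its zero set, which is why the
  order is reversed.\<close>

lemma belluce_le_iff:
  assumes s: "s \<in> mv_terms K" and t: "t \<in> mv_terms K"
  shows "belluce_class K s \<sqsubseteq>\<^bsub>belluce (free_mv K)\<^esub> belluce_class K t \<longleftrightarrow> zero_set K t \<subseteq> zero_set K s"
proof -
  have meet: "(mv_meet (free_mv K) (mv_cong K `` {s'}) (mv_cong K `` {t'}), mv_cong K `` {s'}) \<in> belluce_rel (free_mv K) \<longleftrightarrow>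
      zero_set K t' \<subseteq> zero_set K s'" if "s' \<in> mv_terms K" "t' \<in> mv_terms K" for s' t'
  proof -
    have "meet_term s' t' \<in> mv_terms K" using that by (simp add: meet_term_def)
    then show ?thesis
      using that by (simp add: free_mv_meet belluce_rel_iff_zero_set zero_set_meet_term) blast
  qed
  show ?thesis
  proof
    assume "belluce_class K s \<sqsubseteq>\<^bsub>belluce (free_mv K)\<^esub> belluce_class K t"
    then obtain x y where xy: "x \<in> belluce_class K s" "y \<in> belluce_class K t"
      "(mv_meet (free_mv K) x y, x) \<in> belluce_rel (free_mv K)"
      by (auto simp: belluce_def)
    obtain s' where s': "s' \<in> mv_terms K" "x = mv_cong K `` {s'}" "zero_set K s' = zero_set K s"
      using xy(1) s by (rule belluce_classE)
    obtain t' where t': "t' \<in> mv_terms K" "y = mv_cong K `` {t'}" "zero_set K t' = zero_set K t"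
      using xy(2) t by (rule belluce_classE)
    show "zero_set K t \<subseteq> zero_set K s" using meet[OF s'(1) t'(1)] xy s' t' by simp
  next
    assume "zero_set K t \<subseteq> zero_set K s"
    then show "belluce_class K s \<sqsubseteq>\<^bsub>belluce (free_mv K)\<^esub> belluce_class K t"
      using meet[OF s t] belluce_class_self[OF s] belluce_class_self[OF t] by (auto simp: belluce_def)
  qed
qed

theorem belluce_iso_Cypol: "lattices_isomorphic (belluce (free_mv K)) (inv_gorder (Cypol K))"
proof -
  \<comment> \<open>By \<open>belluce_class_eq_iff\<close> the zero set does not depend on the
    chosen representative.\<close>
  define \<phi> where "\<phi> S = zero_set K (SOME s. s \<in> mv_terms K \<and> belluce_class K s = S)" for S
  have \<phi>: "\<phi> (belluce_class K s) = zero_set K s" if s: "s \<in> mv_terms K" for s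
  proof -
    have "\<exists>r. r \<in> mv_terms K \<and> belluce_class K r = belluce_class K s" using s by blast
    from someI_ex[OF this] show ?thesis unfolding \<phi>_def using belluce_class_eq_iff s by blast
  qed
  have "inj_on \<phi> (carrier (belluce (free_mv K)))"
  proof (rule inj_onI)
    fix S T assume "S \<in> carrier (belluce (free_mv K))" "T \<in> carrier (belluce (free_mv K))" and eq: "\<phi> S = \<phi> T"
    then obtain s t where "s \<in> mv_terms K" "S = belluce_class K s" "t \<in> mv_terms K" "T = belluce_class K t"
      unfolding carrier_belluce by blast
    then show "S = T" using eq by (simp add: \<phi> belluce_class_eq_iff)
  qed
  moreover have "\<phi> ` carrier (belluce (free_mv K)) = cylinder_polyhedra K"
    unfolding carrier_belluce cylinder_polyhedra_eq_zero_sets image_image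
    by (rule image_cong[OF HOL.refl]) (rule \<phi>)
  ultimately have "bij_betw \<phi> (carrier (belluce (free_mv K))) (carrier (inv_gorder (Cypol K)))"
    by (simp add: bij_betw_def Cypol_def inclusion_order_def)
  then show ?thesis
    unfolding lattices_isomorphic_def
    by (intro exI[of _ \<phi>]) (auto simp: carrier_belluce belluce_le_iff \<phi> Cypol_def inclusion_order_def)
qed

text \<open>The infinite set \<open>?W\<close> has a pairing function, with which terms are coded;
  the tags \<open>Inr 0\<close> to \<open>Inr 3\<close> keep the constructors apart. The bound
  controls the size of the Belluce lattice and of its spectrum.\<close>

lemma mv_terms_lepoll: "mv_terms K \<lesssim> K <+> (UNIV :: nat set)"
proof -
  let ?W = "K <+> (UNIV :: nat set)"
  have "infinite ?W" by simp
  then have "?W \<times> ?W \<lesssim> ?W"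
    using card_of_Times_same_infinite[of ?W] by (simp add: lepoll_def card_of_ordLeq ordIso_imp_ordLeq)
  then obtain p where p: "inj_on p (?W \<times> ?W)" "p ` (?W \<times> ?W) \<subseteq> ?W"
    unfolding lepoll_def by blast
  define code where "code = rec_mv_term (\<lambda>k. p (Inr 0, Inl k)) (p (Inr 1, Inr 0))
    (\<lambda>s c. p (Inr 2, c)) (\<lambda>s t c d. p (Inr 3, p (c, d)))"
  have code [simp]: "code (Gen k) = p (Inr 0, Inl k)" "code Zero = p (Inr 1, Inr 0)"
    "code (Neg s) = p (Inr 2, code s)" "code (Plus s t) = p (Inr 3, p (code s, code t))" for k s t
    by (simp_all add: code_def)
  have pW: "p (x, y) \<in> ?W" if "x \<in> ?W" "y \<in> ?W" for x y using p(2) that by blast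
  have pinj: "p (x, y) = p (x', y') \<longleftrightarrow> x = x' \<and> y = y'"
    if "x \<in> ?W" "y \<in> ?W" "x' \<in> ?W" "y' \<in> ?W" for x y x' y'
    using inj_on_eq_iff[OF p(1), of "(x, y)" "(x', y')"] that by simp
  have nat: "Inr n \<in> ?W" for n by (rule InrI) simp
  have codeW: "code t \<in> ?W" if "t \<in> mv_terms K" for t
    using that by (induction t) (simp_all add: pW nat InlI)
  have "s = t" if "s \<in> mv_terms K" "t \<in> mv_terms K" "code s = code t" for s t
    using that
  proof (induction s arbitrary: t)
    case (Gen k)
    then show ?case by (cases t) (simp_all add: pinj pW codeW nat InlI)
  next
    case Zero
    then show ?case by (cases t) (simp_all add: pinj pW codeW nat InlI)
  next
    case (Neg s)
    then show ?case by (cases t) (simp_all add: pinj pW codeW nat InlI)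
  next
    case (Plus s1 s2)
    then show ?case by (cases t) (simp_all add: pinj pW codeW nat InlI)
  qed
  then have "inj_on code (mv_terms K)" by (rule inj_onI)
  then show ?thesis using codeW unfolding lepoll_def by blast
qed

section \<open>Stone duality\<close>

subsection \<open>Lattices of sets\<close>

definition sets_rep :: "'a gorder \<Rightarrow> ('a \<Rightarrow> 'x set) \<Rightarrow> 'x set set \<Rightarrow> bool" where
  "sets_rep L e \<A> \<longleftrightarrow> eq L = (=) \<and> bij_betw e (carrier L) \<A> \<and>
    (\<forall>a\<in>carrier L. \<forall>b\<in>carrier L. a \<sqsubseteq>\<^bsub>L\<^esub> b \<longleftrightarrow> e a \<subseteq> e b)"

text \<open>Identifies the operations of a lattice given only by its order with union and
  intersection. The instances are compact open sets and, for the Belluce lattice, complements of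
  zero sets.\<close>

locale set_lattice =
  fixes L :: "'a gorder" (structure) and e :: "'a \<Rightarrow> 'x set" and \<A> T
  assumes rep: "sets_rep L e \<A>"
    and Un: "U \<in> \<A> \<Longrightarrow> V \<in> \<A> \<Longrightarrow> U \<union> V \<in> \<A>"
    and Int: "U \<in> \<A> \<Longrightarrow> V \<in> \<A> \<Longrightarrow> U \<inter> V \<in> \<A>"
    and empty: "{} \<in> \<A>" and top: "T \<in> \<A>" and top_greatest: "U \<in> \<A> \<Longrightarrow> U \<subseteq> T"
begin

lemma e_in: "a \<in> carrier L \<Longrightarrow> e a \<in> \<A>"
  using rep by (auto simp: sets_rep_def bij_betw_def)

lemma e_surj: "U \<in> \<A> \<Longrightarrow> \<exists>a\<in>carrier L. e a = U"
  using rep unfolding sets_rep_def bij_betw_def by blast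

lemma e_inj: "a \<in> carrier L \<Longrightarrow> b \<in> carrier L \<Longrightarrow> e a = e b \<longleftrightarrow> a = b"
  using rep by (auto simp: sets_rep_def bij_betw_def inj_on_def)

lemma le_iff: "a \<in> carrier L \<Longrightarrow> b \<in> carrier L \<Longrightarrow> a \<sqsubseteq> b \<longleftrightarrow> e a \<subseteq> e b"
  using rep by (auto simp: sets_rep_def)

lemma eq_L: "(.=) = (=)"
  using rep by (auto simp: sets_rep_def)

lemma partial_order_L: "partial_order L"
  by unfold_locales (auto simp: eq_L le_iff e_inj[symmetric])

lemma least_union:
  assumes "x \<in> carrier L" "y \<in> carrier L" "s \<in> carrier L" "e s = e x \<union> e y"
  shows "least L s (Upper L {x, y})"
proof (rule least_UpperI)
  fix z assume "z \<in> Upper L {x, y}"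
  then have "z \<in> carrier L" "x \<sqsubseteq> z" "y \<sqsubseteq> z" using assms by (auto simp: Upper_def)
  then show "s \<sqsubseteq> z" using assms by (simp add: le_iff)
qed (use assms in \<open>auto simp: le_iff\<close>)

lemma greatest_inter:
  assumes "x \<in> carrier L" "y \<in> carrier L" "s \<in> carrier L" "e s = e x \<inter> e y"
  shows "greatest L s (Lower L {x, y})"
proof (rule greatest_LowerI)
  fix z assume "z \<in> Lower L {x, y}"
  then have "z \<in> carrier L" "z \<sqsubseteq> x" "z \<sqsubseteq> y" using assms by (auto simp: Lower_def)
  then show "z \<sqsubseteq> s" using assms by (simp add: le_iff)
qed (use assms in \<open>auto simp: le_iff\<close>)

lemma least_empty: "s \<in> carrier L \<Longrightarrow> e s = {} \<Longrightarrow> least L s (carrier L)"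
  by (auto simp: least_def le_iff)

lemma greatest_top: "s \<in> carrier L \<Longrightarrow> e s = T \<Longrightarrow> greatest L s (carrier L)"
  unfolding greatest_def using top_greatest[OF e_in] le_iff by blast

lemma bounded_lattice_L: "bounded_lattice L"
proof -
  interpret partial_order L by (rule partial_order_L)
  show ?thesis
  proof
    fix x y assume xy: "x \<in> carrier L" "y \<in> carrier L"
    obtain s where "s \<in> carrier L" "e s = e x \<union> e y" using e_surj[OF Un[OF e_in e_in, OF xy]] by blast
    then show "\<exists>s. least L s (Upper L {x, y})" using least_union xy by blast
    obtain s where "s \<in> carrier L" "e s = e x \<inter> e y" using e_surj[OF Int[OF e_in e_in, OF xy]] by blast
    then show "\<exists>s. greatest L s (Lower L {x, y})" using greatest_inter xy by blast
  next
    show "\<exists>x. least L x (carrier L)" using e_surj[OF empty] least_empty by blast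
    show "\<exists>x. greatest L x (carrier L)" using e_surj[OF top] greatest_top by blast
  qed
qed

sublocale BL: bounded_lattice L by (rule bounded_lattice_L)

lemma e_join: assumes xy: "x \<in> carrier L" "y \<in> carrier L" shows "e (x \<squnion> y) = e x \<union> e y"
proof -
  obtain s where s: "s \<in> carrier L" "e s = e x \<union> e y" using e_surj[OF Un[OF e_in e_in, OF xy]] by blast
  have "e l = e x \<union> e y" if "least L l (Upper L {x, y})" for l
    using BL.least_unique[OF that least_union[OF xy s]] s by simp
  then show ?thesis by (rule BL.joinI) (use xy in auto)
qed

lemma e_meet: assumes xy: "x \<in> carrier L" "y \<in> carrier L" shows "e (x \<sqinter> y) = e x \<inter> e y"
proof -
  obtain s where s: "s \<in> carrier L" "e s = e x \<inter> e y" using e_surj[OF Int[OF e_in e_in, OF xy]] by blast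
  have "e l = e x \<inter> e y" if "greatest L l (Lower L {x, y})" for l
    using BL.greatest_unique[OF that greatest_inter[OF xy s]] s by simp
  then show ?thesis by (rule BL.meetI) (use xy in auto)
qed

lemma e_bot: "e \<bottom> = {}"
proof -
  obtain s where "s \<in> carrier L" "e s = {}" using e_surj[OF empty] by blast
  then show ?thesis using BL.least_unique[OF BL.bottom_least least_empty] by simp
qed

lemma e_top: "e \<top> = T"
proof -
  obtain s where "s \<in> carrier L" "e s = T" using e_surj[OF top] by blast
  then show ?thesis using BL.greatest_unique[OF BL.top_greatest greatest_top] by simp
qed

lemma bounded_distributive_lattice_L: "bounded_distributive_lattice L"
  unfolding bounded_distributive_lattice_def
proof (intro conjI ballI)
  fix x y z assume "x \<in> carrier L" "y \<in> carrier L" "z \<in> carrier L"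
  moreover from this have "e (x \<sqinter> (y \<squnion> z)) = e ((x \<sqinter> y) \<squnion> (x \<sqinter> z))"
    by (simp add: e_meet e_join Int_Un_distrib)
  ultimately show "x \<sqinter> (y \<squnion> z) = (x \<sqinter> y) \<squnion> (x \<sqinter> z)"
    by (simp add: e_inj)
qed (rule bounded_lattice_L)

end

subsection \<open>Spectral spaces and their lattices of compact open sets\<close>

lemma compact_openin_Un: "compact_openin X U \<Longrightarrow> compact_openin X V \<Longrightarrow> compact_openin X (U \<union> V)"
  by (simp add: compact_openin_def compactin_Un openin_Un)

lemma compact_openin_empty: "compact_openin X {}"
  by (simp add: compact_openin_def)

lemma compact_openin_Union:
  "finite \<U> \<Longrightarrow> (\<And>U. U \<in> \<U> \<Longrightarrow> compact_openin X U) \<Longrightarrow> compact_openin X (\<Union>\<U>)"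
  by (induction rule: finite_induct) (auto simp: compact_openin_empty compact_openin_Un)

lemma compact_openin_subset: "compact_openin X U \<Longrightarrow> U \<subseteq> topspace X"
  by (simp add: compact_openin_def openin_subset)

lemma spectral_space_topspace: "spectral_space X \<Longrightarrow> compact_openin X (topspace X)"
  using openin_topspace[of X] unfolding spectral_space_def compact_openin_def compact_space_def by blast

lemma spectral_basis:
  assumes "spectral_space X" "openin X U"
  obtains \<U> where "\<And>V. V \<in> \<U> \<Longrightarrow> compact_openin X V" "U = \<Union>\<U>"
proof -
  have "(arbitrary union_of (compact_openin X)) U" using assms by (simp add: spectral_space_def)
  then show ?thesis using that unfolding union_of_def arbitrary_def by auto
qed

lemma spectral_basis_point:
  assumes "spectral_space X" "openin X U" "x \<in> U"
  obtains V where "compact_openin X V" "x \<in> V" "V \<subseteq> U"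
  by (rule spectral_basis[OF assms(1,2)]) (use assms(3) that in blast)

text \<open>The elements of \<open>L\<close> name the compact open sets through \<open>e\<close>.
  Space and lattice can thus live on unrelated types, and neither has to be constructed from the
  other.\<close>

definition dual_pair :: "'x topology \<Rightarrow> 'a gorder \<Rightarrow> ('a \<Rightarrow> 'x set) \<Rightarrow> bool" where
  "dual_pair X L e \<longleftrightarrow> spectral_space X \<and> sets_rep L e {U. compact_openin X U}"

locale stone_dual =
  fixes X :: "'x topology" and L :: "'a gorder" (structure) and e :: "'a \<Rightarrow> 'x set"
  assumes dual: "dual_pair X L e"
begin

lemma spectral: "spectral_space X"
  using dual by (simp add: dual_pair_def)

sublocale set_lattice L e "{U. compact_openin X U}" "topspace X"
proof
  show "U \<inter> V \<in> {U. compact_openin X U}" if "U \<in> {U. compact_openin X U}" "V \<in> {U. compact_openin X U}" for U V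
    using spectral that by (simp add: spectral_space_def)
qed (use dual spectral in \<open>auto simp: dual_pair_def compact_openin_Un compact_openin_empty
    spectral_space_topspace dest: compact_openin_subset\<close>)

lemma e_open: "a \<in> carrier L \<Longrightarrow> openin X (e a)"
  using e_in by (auto simp: compact_openin_def)

lemma e_basis:
  assumes "openin X U" "x \<in> U" obtains a where "a \<in> carrier L" "x \<in> e a" "e a \<subseteq> U"
  by (rule spectral_basis_point[OF spectral assms]) (use e_surj that in blast)

lemma e_subset: "a \<in> carrier L \<Longrightarrow> e a \<subseteq> topspace X"
  using e_open openin_subset by blast

text \<open>Points lying in the same compact open sets have the same closure. This closure is
  irreducible, and by sobriety it has a single generic point.\<close>

lemma points_eq:
  assumes x: "x \<in> topspace X" and y: "y \<in> topspace X" and eq: "\<And>a. a \<in> carrier L \<Longrightarrow> x \<in> e a \<longleftrightarrow> y \<in> e a"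
  shows "x = y"
proof -
  have in_cl: "z \<in> X closure_of {w} \<longleftrightarrow> z \<in> topspace X \<and> (\<forall>a\<in>carrier L. z \<in> e a \<longrightarrow> w \<in> e a)" for z w
    unfolding in_closure_of using e_open by (auto elim!: e_basis)
  have cl: "X closure_of {y} = X closure_of {x}"
    using eq by (auto simp: in_cl)
  have "irreducible_closedin X (X closure_of {x})"
    unfolding irreducible_closedin_def
  proof (intro conjI allI impI)
    show "closedin X (X closure_of {x})" by simp
    show "X closure_of {x} \<noteq> {}" using in_cl[of x x] x by blast
    fix A B assume AB: "closedin X A \<and> closedin X B \<and> X closure_of {x} = A \<union> B"
    have "x \<in> A \<union> B" using AB in_cl[of x x] x by blast
    then have "X closure_of {x} \<subseteq> A \<or> X closure_of {x} \<subseteq> B"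
      using AB closure_of_minimal[of "{x}" A X] closure_of_minimal[of "{x}" B X] by blast
    then show "A = X closure_of {x} \<or> B = X closure_of {x}" using AB by blast
  qed
  then have "\<exists>!z. z \<in> topspace X \<and> X closure_of {z} = X closure_of {x}"
    using spectral by (simp add: spectral_space_def sober_space_def)
  then show ?thesis using x y cl by blast
qed

text \<open>By compactness finitely many members of \<open>F\<close> cover \<open>e b\<close>, and
  their join belongs to the ideal.\<close>

lemma prime_ideal_cover:
  assumes F: "F \<in> prime_ideals L" and b: "b \<in> carrier L" "e b \<subseteq> \<Union> (e ` F)"
  shows "b \<in> F"
proof -
  have FL: "F \<subseteq> carrier L" "F \<noteq> {}" and down: "\<And>x y. x \<in> F \<Longrightarrow> y \<in> carrier L \<Longrightarrow> y \<sqsubseteq> x \<Longrightarrow> y \<in> F"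
    and join: "\<And>x y. x \<in> F \<Longrightarrow> y \<in> F \<Longrightarrow> x \<squnion> y \<in> F"
    using F unfolding prime_ideals_def by blast+
  have "compactin X (e b)" using e_in[OF b(1)] by (simp add: compact_openin_def)
  moreover have "\<forall>U\<in>e ` F. openin X U" using FL e_open by blast
  ultimately obtain \<F> where \<F>: "finite \<F>" "\<F> \<subseteq> e ` F" "e b \<subseteq> \<Union>\<F>"
    using b(2) unfolding compactin_def by meson
  then obtain G where G: "finite G" "G \<subseteq> F" "\<F> = e ` G" by (metis finite_subset_image)
  have "\<exists>c\<in>F. \<Union> (e ` G) \<subseteq> e c" using G(1,2)
  proof (induction rule: finite_induct)
    case empty
    then show ?case using FL by auto
  next
    case (insert g G)
    then obtain c where c: "c \<in> F" "\<Union> (e ` G) \<subseteq> e c" by blast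
    then have "\<Union> (e ` insert g G) \<subseteq> e (g \<squnion> c)" using insert.prems FL e_join[of g c] by blast
    then show ?case using join[of g c] insert.prems c by blast
  qed
  then obtain c where c: "c \<in> F" "e b \<subseteq> e c" using \<F>(3) G(3) by blast
  then have "b \<sqsubseteq> c" using le_iff[OF b(1)] FL(1) by blast
  then show ?thesis using down c(1) b(1) by blast
qed

text \<open>The points outside all \<open>e a\<close> with \<open>a\<close> in \<open>F\<close> form
  a closed set. Primeness of \<open>F\<close> makes it irreducible, and its generic point is the one
  sought.\<close>

lemma prime_ideal_point:
  assumes F: "F \<in> prime_ideals L"
  shows "\<exists>x\<in>topspace X. \<forall>b\<in>carrier L. x \<in> e b \<longleftrightarrow> b \<notin> F"
proof -
  have FL: "F \<subseteq> carrier L" "F \<noteq> carrier L"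
    and meet: "\<And>x y. x \<in> carrier L \<Longrightarrow> y \<in> carrier L \<Longrightarrow> x \<sqinter> y \<in> F \<Longrightarrow> x \<in> F \<or> y \<in> F"
    using F unfolding prime_ideals_def by blast+
  define S where "S = topspace X - \<Union> (e ` F)"
  have meets: "e b \<inter> S \<noteq> {}" if "b \<in> carrier L" "b \<notin> F" for b
    using prime_ideal_cover[OF F that(1)] that(2) e_subset[OF that(1)] by (auto simp: S_def)
  have misses: "e b \<inter> S = {}" if "b \<in> F" for b
    using that by (auto simp: S_def)
  have "openin X (\<Union> (e ` F))" using FL e_open by blast
  then have closed: "closedin X S" by (simp add: S_def closedin_diff)
  have "irreducible_closedin X S"
    unfolding irreducible_closedin_def
  proof (intro conjI allI impI)
    obtain b where "b \<in> carrier L" "b \<notin> F" using FL by blast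
    then show "S \<noteq> {}" using meets by blast
    fix A B assume AB: "closedin X A \<and> closedin X B \<and> S = A \<union> B"
    have pick: "\<exists>b\<in>carrier L. b \<notin> F \<and> e b \<inter> Z = {}" if "closedin X Z" "Z \<subseteq> S" "Z \<noteq> S" for Z
    proof -
      obtain x where x: "x \<in> S" "x \<notin> Z" using \<open>Z \<subseteq> S\<close> \<open>Z \<noteq> S\<close> by blast
      have "openin X (topspace X - Z)" "x \<in> topspace X - Z" using \<open>closedin X Z\<close> x by (auto simp: S_def)
      then obtain b where b: "b \<in> carrier L" "x \<in> e b" "e b \<subseteq> topspace X - Z" by (rule e_basis)
      moreover have "b \<notin> F" using misses b x by blast
      ultimately show ?thesis by blast
    qed
    show "A = S \<or> B = S"
    proof (rule ccontr)
      assume neg: "\<not> (A = S \<or> B = S)"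
      obtain a where a: "a \<in> carrier L" "a \<notin> F" "e a \<inter> A = {}" using pick[of A] AB neg by blast
      obtain b where b: "b \<in> carrier L" "b \<notin> F" "e b \<inter> B = {}" using pick[of B] AB neg by blast
      have "a \<sqinter> b \<notin> F" using meet a b by blast
      then have "e (a \<sqinter> b) \<inter> S \<noteq> {}" using meets a b by simp
      then show False using a b AB e_meet[of a b] by blast
    qed
  qed (rule closed)
  then obtain x where x: "x \<in> topspace X" "X closure_of {x} = S"
    using spectral unfolding spectral_space_def sober_space_def by blast
  have "x \<in> e b \<longleftrightarrow> b \<notin> F" if b: "b \<in> carrier L" for b
  proof
    assume "x \<in> e b"
    moreover have "x \<in> S" using x closure_of_subset[of "{x}" X] by auto
    ultimately show "b \<notin> F" using misses by blast
  next
    assume "b \<notin> F"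
    then obtain y where "y \<in> e b" "y \<in> X closure_of {x}" using meets[OF b] x by blast
    then show "x \<in> e b" using e_open[OF b] unfolding in_closure_of by blast
  qed
  then show ?thesis using x by blast
qed

lemma point_prime_ideal:
  assumes "x \<in> topspace X" shows "{b \<in> carrier L. x \<notin> e b} \<in> prime_ideals L"
  unfolding prime_ideals_def
  using assms e_bot e_top le_iff
  by (auto simp: e_join e_meet)

end

subsection \<open>Spectral maps and lattice homomorphisms\<close>

text \<open>The homomorphism dual to \<open>s\<close>: preimages of compact open sets, expressed in
  the names that \<open>d\<close> and \<open>e\<close> give to them.\<close>

definition hat :: "'x topology \<Rightarrow> 'a gorder \<Rightarrow> ('a \<Rightarrow> 'x set) \<Rightarrow> 'b gorder \<Rightarrow> ('b \<Rightarrow> 'y set) \<Rightarrow> ('x \<Rightarrow> 'y) \<Rightarrow> 'b \<Rightarrow> 'a" where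
  "hat X L e M d s = (\<lambda>b\<in>carrier M. inv_into (carrier L) e {x \<in> topspace X. s x \<in> d b})"

locale stone_dual2 = X: stone_dual X L e + Y: stone_dual Y M d
  for X :: "'x topology" and L :: "'a gorder" and e and Y :: "'y topology" and M :: "'b gorder" and d
begin

abbreviation "hatXY \<equiv> hat X L e M d"

lemma hat_val:
  assumes "s \<in> spectral_maps X Y" "b \<in> carrier M"
  shows "hatXY s b \<in> carrier L" "e (hatXY s b) = {x \<in> topspace X. s x \<in> d b}"
proof -
  have "compact_openin X {x \<in> topspace X. s x \<in> d b}"
    using assms Y.e_in by (simp add: spectral_maps_def)
  then have "{x \<in> topspace X. s x \<in> d b} \<in> e ` carrier L" using X.e_surj by blast
  then show "hatXY s b \<in> carrier L" "e (hatXY s b) = {x \<in> topspace X. s x \<in> d b}"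
    using assms(2) by (simp_all add: hat_def inv_into_into f_inv_into_f)
qed

lemma hat_eqI:
  assumes "s \<in> spectral_maps X Y" "\<phi> \<in> extensional (carrier M)"
    "\<And>b. b \<in> carrier M \<Longrightarrow> \<phi> b \<in> carrier L \<and> e (\<phi> b) = {x \<in> topspace X. s x \<in> d b}"
  shows "hatXY s = \<phi>"
proof (rule extensionalityI[of _ "carrier M"])
  show "hatXY s \<in> extensional (carrier M)" by (simp add: hat_def)
  fix b assume b: "b \<in> carrier M"
  then have "e (hatXY s b) = e (\<phi> b)" using hat_val[OF assms(1) b] assms(3)[OF b] by simp
  then show "hatXY s b = \<phi> b" using X.e_inj[of "hatXY s b" "\<phi> b"] hat_val(1)[OF assms(1) b] assms(3)[OF b] by simp
qed (rule assms)

lemma maps_to: "s \<in> spectral_maps X Y \<Longrightarrow> x \<in> topspace X \<Longrightarrow> s x \<in> topspace Y"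
  by (auto simp: spectral_maps_def)

lemma hat_hom:
  assumes s: "s \<in> spectral_maps X Y" shows "hatXY s \<in> lattice_homs M L"
proof -
  note v = hat_val[OF s]
  have "hatXY s \<in> carrier M \<rightarrow>\<^sub>E carrier L" using v(1) by (auto simp: hat_def)
  moreover have "hatXY s (x \<squnion>\<^bsub>M\<^esub> y) = hatXY s x \<squnion>\<^bsub>L\<^esub> hatXY s y" if "x \<in> carrier M" "y \<in> carrier M" for x y
    using that v X.e_join[of "hatXY s x" "hatXY s y"] Y.e_join[of x y]
    by (subst X.e_inj[symmetric]) auto
  moreover have "hatXY s (x \<sqinter>\<^bsub>M\<^esub> y) = hatXY s x \<sqinter>\<^bsub>L\<^esub> hatXY s y" if "x \<in> carrier M" "y \<in> carrier M" for x y
    using that v X.e_meet[of "hatXY s x" "hatXY s y"] Y.e_meet[of x y]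
    by (subst X.e_inj[symmetric]) auto
  moreover have "hatXY s \<bottom>\<^bsub>M\<^esub> = \<bottom>\<^bsub>L\<^esub>"
    using v[of "\<bottom>\<^bsub>M\<^esub>"] X.e_bot Y.e_bot by (subst X.e_inj[symmetric]) auto
  moreover have "hatXY s \<top>\<^bsub>M\<^esub> = \<top>\<^bsub>L\<^esub>"
    using v[of "\<top>\<^bsub>M\<^esub>"] X.e_top Y.e_top maps_to[OF s] by (subst X.e_inj[symmetric]) auto
  ultimately show ?thesis
    unfolding lattice_homs_def join_pres_def meet_pres_def
    using X.BL.lattice_axioms Y.BL.lattice_axioms by blast
qed

lemma hat_inj:
  assumes s: "s \<in> spectral_maps X Y" and s': "s' \<in> spectral_maps X Y" and eq: "hatXY s = hatXY s'"
  shows "s = s'"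
proof (rule extensionalityI[of _ "topspace X"])
  fix x assume x: "x \<in> topspace X"
  show "s x = s' x"
  proof (rule Y.points_eq)
    fix b assume "b \<in> carrier M"
    then show "s x \<in> d b \<longleftrightarrow> s' x \<in> d b"
      using hat_val(2)[OF s] hat_val(2)[OF s'] x unfolding eq by blast
  qed (use x s s' maps_to in auto)
qed (use s s' in \<open>auto simp: spectral_maps_def PiE_def\<close>)

text \<open>A point \<open>x\<close> determines the prime ideal of all \<open>b\<close> with
  \<open>x\<close> outside \<open>e (\<phi> b)\<close>, and \<open>prime_ideal_point\<close> in
  \<open>Y\<close> turns it into the image of \<open>x\<close>.\<close>

lemma hat_surj:
  assumes \<phi>: "\<phi> \<in> lattice_homs M L"
  shows "\<exists>s\<in>spectral_maps X Y. hatXY s = \<phi>"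
proof -
  have \<phi>_ext: "\<phi> \<in> carrier M \<rightarrow>\<^sub>E carrier L"
    and join: "\<And>x y. x \<in> carrier M \<Longrightarrow> y \<in> carrier M \<Longrightarrow> \<phi> (x \<squnion>\<^bsub>M\<^esub> y) = \<phi> x \<squnion>\<^bsub>L\<^esub> \<phi> y"
    and meet: "\<And>x y. x \<in> carrier M \<Longrightarrow> y \<in> carrier M \<Longrightarrow> \<phi> (x \<sqinter>\<^bsub>M\<^esub> y) = \<phi> x \<sqinter>\<^bsub>L\<^esub> \<phi> y"
    and bot: "\<phi> \<bottom>\<^bsub>M\<^esub> = \<bottom>\<^bsub>L\<^esub>" and top: "\<phi> \<top>\<^bsub>M\<^esub> = \<top>\<^bsub>L\<^esub>"
    using \<phi> unfolding lattice_homs_def join_pres_def meet_pres_def by blast+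
  have cl: "\<phi> b \<in> carrier L" if "b \<in> carrier M" for b using \<phi>_ext that by blast
  have mono: "\<phi> x \<sqsubseteq>\<^bsub>L\<^esub> \<phi> y" if "x \<in> carrier M" "y \<in> carrier M" "x \<sqsubseteq>\<^bsub>M\<^esub> y" for x y
    using that join[OF that(1,2)] X.BL.le_iff_meet Y.BL.le_iff_meet cl by metis
  have ideal: "{b \<in> carrier M. x \<notin> e (\<phi> b)} \<in> prime_ideals M" if x: "x \<in> topspace X" for x
    unfolding prime_ideals_def
  proof (rule CollectI, intro conjI ballI impI)
    have "\<bottom>\<^bsub>M\<^esub> \<in> {b \<in> carrier M. x \<notin> e (\<phi> b)}" using bot X.e_bot by simp
    then show "{b \<in> carrier M. x \<notin> e (\<phi> b)} \<noteq> {}" by blast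
    have "\<top>\<^bsub>M\<^esub> \<notin> {b \<in> carrier M. x \<notin> e (\<phi> b)}" using top X.e_top x by simp
    then show "{b \<in> carrier M. x \<notin> e (\<phi> b)} \<noteq> carrier M" using Y.BL.top_closed by blast
    fix a b assume "a \<in> {b \<in> carrier M. x \<notin> e (\<phi> b)}" "b \<in> carrier M" "b \<sqsubseteq>\<^bsub>M\<^esub> a"
    then show "b \<in> {b \<in> carrier M. x \<notin> e (\<phi> b)}" using mono[of b a] X.le_iff[of "\<phi> b" "\<phi> a"] cl[of a] cl[of b] by auto
  next
    fix a b assume "a \<in> {b \<in> carrier M. x \<notin> e (\<phi> b)}" "b \<in> {b \<in> carrier M. x \<notin> e (\<phi> b)}"
    then show "a \<squnion>\<^bsub>M\<^esub> b \<in> {b \<in> carrier M. x \<notin> e (\<phi> b)}" using join[of a b] X.e_join[of "\<phi> a" "\<phi> b"] cl[of a] cl[of b] by simp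
  next
    fix a b assume "a \<in> carrier M" "b \<in> carrier M" "a \<sqinter>\<^bsub>M\<^esub> b \<in> {b \<in> carrier M. x \<notin> e (\<phi> b)}"
    then show "a \<in> {b \<in> carrier M. x \<notin> e (\<phi> b)} \<or> b \<in> {b \<in> carrier M. x \<notin> e (\<phi> b)}"
      using meet[of a b] X.e_meet[of "\<phi> a" "\<phi> b"] cl[of a] cl[of b] by auto
  qed auto
  have "\<exists>y\<in>topspace Y. \<forall>b\<in>carrier M. y \<in> d b \<longleftrightarrow> x \<in> e (\<phi> b)" if "x \<in> topspace X" for x
    using Y.prime_ideal_point[OF ideal[OF that]] by simp
  then obtain s0 where s0: "\<And>x. x \<in> topspace X \<Longrightarrow> s0 x \<in> topspace Y"
    "\<And>x b. x \<in> topspace X \<Longrightarrow> b \<in> carrier M \<Longrightarrow> s0 x \<in> d b \<longleftrightarrow> x \<in> e (\<phi> b)"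
    by metis
  define s where "s = (\<lambda>x\<in>topspace X. s0 x)"
  have pre: "{x \<in> topspace X. s x \<in> d b} = e (\<phi> b)" if "b \<in> carrier M" for b
    using s0(2)[OF _ that] X.e_subset[OF cl[OF that]] by (auto simp: s_def)
  have s: "s \<in> spectral_maps X Y"
    unfolding spectral_maps_def
  proof (intro CollectI conjI allI impI)
    show "s \<in> topspace X \<rightarrow>\<^sub>E topspace Y" using s0 by (auto simp: s_def)
    fix U assume "compact_openin Y U"
    then obtain b where "b \<in> carrier M" "U = d b" using Y.e_surj by blast
    then show "compact_openin X {x \<in> topspace X. s x \<in> U}" using pre X.e_in cl by simp
  qed
  moreover have "hatXY s = \<phi>"
    by (rule hat_eqI[OF s]) (use \<phi>_ext cl pre in \<open>simp_all add: PiE_def\<close>)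
  ultimately show ?thesis by blast
qed

end

lemma spectral_maps_compose:
  assumes "s \<in> spectral_maps X Y" "t \<in> spectral_maps Y Z"
  shows "compose (topspace X) t s \<in> spectral_maps X Z"
proof -
  have "{x \<in> topspace X. compose (topspace X) t s x \<in> U} = {x \<in> topspace X. s x \<in> {y \<in> topspace Y. t y \<in> U}}" for U
    using assms(1) by (auto simp: spectral_maps_def compose_def)
  then show ?thesis using assms by (auto simp: spectral_maps_def compose_def PiE_iff)
qed

lemma spectral_maps_id: "(\<lambda>x\<in>topspace X. x) \<in> spectral_maps X X"
proof -
  have "{x \<in> topspace X. (\<lambda>x\<in>topspace X. x) x \<in> U} = U" if "compact_openin X U" for U
    using compact_openin_subset[OF that] by auto
  then show ?thesis by (auto simp: spectral_maps_def)
qed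

lemma hat_compose:
  assumes X: "dual_pair X L e" and Y: "dual_pair Y M d" and Z: "dual_pair Z N c"
    and s: "s \<in> spectral_maps X Y" and t: "t \<in> spectral_maps Y Z"
  shows "hat X L e N c (compose (topspace X) t s) = compose (carrier N) (hat X L e M d s) (hat Y M d N c t)"
proof -
  interpret XY: stone_dual2 X L e Y M d using X Y by (simp add: stone_dual2_def stone_dual_def)
  interpret YZ: stone_dual2 Y M d Z N c using Y Z by (simp add: stone_dual2_def stone_dual_def)
  interpret XZ: stone_dual2 X L e Z N c using X Z by (simp add: stone_dual2_def stone_dual_def)
  show ?thesis
  proof (rule XZ.hat_eqI[OF spectral_maps_compose[OF s t]])
    show "compose (carrier N) (hat X L e M d s) (hat Y M d N c t) \<in> extensional (carrier N)" by simp
    fix b assume b: "b \<in> carrier N"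
    show "compose (carrier N) (hat X L e M d s) (hat Y M d N c t) b \<in> carrier L \<and>
      e (compose (carrier N) (hat X L e M d s) (hat Y M d N c t) b) =
        {x \<in> topspace X. compose (topspace X) t s x \<in> c b}"
      using b YZ.hat_val[OF t b] XY.hat_val[OF s] XY.maps_to[OF s] by (auto simp: compose_def)
  qed
qed

lemma hat_id:
  assumes X: "dual_pair X L e" shows "hat X L e L e (\<lambda>x\<in>topspace X. x) = (\<lambda>x\<in>carrier L. x)"
proof -
  interpret XX: stone_dual2 X L e X L e using X by (simp add: stone_dual2_def stone_dual_def)
  show ?thesis
    by (rule XX.hat_eqI[OF spectral_maps_id]) (use XX.X.e_subset in auto)
qed

subsection \<open>The prime spectrum of a bounded distributive lattice\<close>

lemma spectral_spaceI:
  assumes sober: "sober_space X" and compact: "compact_space X"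
    and basis: "\<And>U x. openin X U \<Longrightarrow> x \<in> U \<Longrightarrow> \<exists>V. compact_openin X V \<and> x \<in> V \<and> V \<subseteq> U"
    and Int: "\<And>U V. compact_openin X U \<Longrightarrow> compact_openin X V \<Longrightarrow> compact_openin X (U \<inter> V)"
  shows "spectral_space X"
proof -
  have "openin X U \<longleftrightarrow> (arbitrary union_of (compact_openin X)) U" for U
  proof
    assume U: "openin X U"
    have "U = \<Union> {V. compact_openin X V \<and> V \<subseteq> U}" using basis[OF U] by blast
    then show "(arbitrary union_of (compact_openin X)) U"
      unfolding union_of_def arbitrary_def by (intro exI[of _ "{V. compact_openin X V \<and> V \<subseteq> U}"]) auto
  next
    assume "(arbitrary union_of (compact_openin X)) U"
    then show "openin X U"
      unfolding union_of_def arbitrary_def compact_openin_def by auto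
  qed
  then show ?thesis using sober compact Int by (auto simp: spectral_space_def)
qed

section \<open>Ideals and prime ideals of a distributive lattice\<close>

locale bounded_distrib_lattice = bounded_lattice L for L :: "'a gorder" (structure) +
  assumes distrib: "\<lbrakk>x \<in> carrier L; y \<in> carrier L; z \<in> carrier L\<rbrakk> \<Longrightarrow>
    x \<sqinter> (y \<squnion> z) = (x \<sqinter> y) \<squnion> (x \<sqinter> z)"
begin

definition lat_ideal :: "'a set \<Rightarrow> bool" where
  "lat_ideal I \<longleftrightarrow> I \<subseteq> carrier L \<and> I \<noteq> {} \<and> (\<forall>x\<in>I. \<forall>y\<in>carrier L. y \<sqsubseteq> x \<longrightarrow> y \<in> I) \<and>
    (\<forall>x\<in>I. \<forall>y\<in>I. x \<squnion> y \<in> I)"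

lemma prime_ideals_iff:
  "P \<in> prime_ideals L \<longleftrightarrow> lat_ideal P \<and> P \<noteq> carrier L \<and>
    (\<forall>x\<in>carrier L. \<forall>y\<in>carrier L. x \<sqinter> y \<in> P \<longrightarrow> x \<in> P \<or> y \<in> P)"
  by (simp add: prime_ideals_def lat_ideal_def conj_ac)

lemma lat_idealD:
  assumes "lat_ideal I"
  shows "I \<subseteq> carrier L" "\<bottom> \<in> I" "\<And>x y. x \<in> I \<Longrightarrow> y \<in> carrier L \<Longrightarrow> y \<sqsubseteq> x \<Longrightarrow> y \<in> I"
    "\<And>x y. x \<in> I \<Longrightarrow> y \<in> I \<Longrightarrow> x \<squnion> y \<in> I"
proof -
  show sub: "I \<subseteq> carrier L" and down: "\<And>x y. x \<in> I \<Longrightarrow> y \<in> carrier L \<Longrightarrow> y \<sqsubseteq> x \<Longrightarrow> y \<in> I"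
    and "\<And>x y. x \<in> I \<Longrightarrow> y \<in> I \<Longrightarrow> x \<squnion> y \<in> I"
    using assms unfolding lat_ideal_def by blast+
  obtain x where "x \<in> I" using assms unfolding lat_ideal_def by blast
  then show "\<bottom> \<in> I" using down[of x "\<bottom>"] sub by auto
qed

text \<open>This is the ideal generated by \<open>M\<close> and \<open>x\<close>, with which the
  maximality of an ideal is tested below.\<close>

lemma lat_ideal_extend:
  assumes M: "lat_ideal M" and x: "x \<in> carrier L"
  shows "lat_ideal {z \<in> carrier L. \<exists>m\<in>M. z \<sqsubseteq> m \<squnion> x}"
  unfolding lat_ideal_def
proof (intro conjI ballI impI)
  note M' = lat_idealD[OF M]
  show "{z \<in> carrier L. \<exists>m\<in>M. z \<sqsubseteq> m \<squnion> x} \<noteq> {}"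
    using M'(1,2) x join_right[of "\<bottom>" x] by auto
  fix a assume "a \<in> {z \<in> carrier L. \<exists>m\<in>M. z \<sqsubseteq> m \<squnion> x}"
  then obtain m where m: "a \<in> carrier L" "m \<in> M" "a \<sqsubseteq> m \<squnion> x" by blast
  have mL: "m \<in> carrier L" using m M' by blast
  show "b \<in> {z \<in> carrier L. \<exists>m\<in>M. z \<sqsubseteq> m \<squnion> x}" if b: "b \<in> carrier L" "b \<sqsubseteq> a" for b
    using le_trans[OF b(2) m(3) b(1) m(1)] mL x b m by auto
  fix b assume "b \<in> {z \<in> carrier L. \<exists>m\<in>M. z \<sqsubseteq> m \<squnion> x}"
  then obtain n where n: "b \<in> carrier L" "n \<in> M" "b \<sqsubseteq> n \<squnion> x" by blast
  have nL: "n \<in> carrier L" using n M' by blast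
  let ?j = "(m \<squnion> n) \<squnion> x"
  have j: "?j \<in> carrier L" "m \<squnion> n \<in> M" "m \<squnion> n \<in> carrier L" using mL nL x M'(4) m n by auto
  have "m \<sqsubseteq> ?j" "n \<sqsubseteq> ?j"
    using le_trans[OF join_left[OF mL nL] join_left[OF j(3) x]] le_trans[OF join_right[OF mL nL] join_left[OF j(3) x]]
      mL nL x j by auto
  then have "m \<squnion> x \<sqsubseteq> ?j" "n \<squnion> x \<sqsubseteq> ?j"
    using join_le[of m ?j x] join_le[of n ?j x] join_right[OF j(3) x] mL nL x j by auto
  then have "a \<sqsubseteq> ?j" "b \<sqsubseteq> ?j"
    using le_trans[OF m(3)] le_trans[OF n(3)] mL nL x j m n by auto
  then have "a \<squnion> b \<sqsubseteq> ?j" using join_le m n j by simp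
  then show "a \<squnion> b \<in> {z \<in> carrier L. \<exists>m\<in>M. z \<sqsubseteq> m \<squnion> x}" using j m n by auto
qed auto

text \<open>By Zorn's lemma there is an ideal maximal among those that contain \<open>I\<close> and
  avoid \<open>a\<close>; distributivity makes it prime.\<close>

lemma prime_ideal_exists:
  assumes I: "lat_ideal I" and a: "a \<in> carrier L" "a \<notin> I"
  shows "\<exists>P\<in>prime_ideals L. I \<subseteq> P \<and> a \<notin> P"
proof -
  define \<A> where "\<A> = {J. lat_ideal J \<and> I \<subseteq> J \<and> a \<notin> J}"
  have "\<exists>M\<in>\<A>. \<forall>J\<in>\<A>. M \<subseteq> J \<longrightarrow> J = M"
  proof (rule subset_Zorn_nonempty)
    show "\<A> \<noteq> {}" using I a by (auto simp: \<A>_def)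
    fix \<C> assume ne: "\<C> \<noteq> {}" and chain: "subset.chain \<A> \<C>"
    have A: "lat_ideal J" "I \<subseteq> J" "a \<notin> J" if "J \<in> \<C>" for J
      using chain that by (auto simp: subset.chain_def \<A>_def)
    have "lat_ideal (\<Union>\<C>)"
      unfolding lat_ideal_def
    proof (intro conjI ballI impI)
      show "\<Union>\<C> \<subseteq> carrier L" using lat_idealD(1)[OF A(1)] by blast
      show "\<Union>\<C> \<noteq> {}" using lat_idealD(2)[OF A(1)] ne by blast
      show "y \<in> \<Union>\<C>" if "x \<in> \<Union>\<C>" "y \<in> carrier L" "y \<sqsubseteq> x" for x y
        using that lat_idealD(3)[OF A(1)] by blast
      fix x y assume "x \<in> \<Union>\<C>" "y \<in> \<Union>\<C>"
      then obtain J K where JK: "J \<in> \<C>" "x \<in> J" "K \<in> \<C>" "y \<in> K" by blast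
      then have "J \<subseteq> K \<or> K \<subseteq> J" using chain by (auto simp: subset.chain_def)
      then have "x \<squnion> y \<in> J \<or> x \<squnion> y \<in> K"
        using JK lat_idealD(4)[OF A(1)[OF JK(1)], of x y] lat_idealD(4)[OF A(1)[OF JK(3)], of x y] by blast
      then show "x \<squnion> y \<in> \<Union>\<C>" using JK by blast
    qed
    moreover have "I \<subseteq> \<Union>\<C>" "a \<notin> \<Union>\<C>" using A ne by blast+
    ultimately show "\<Union>\<C> \<in> \<A>" by (simp add: \<A>_def)
  qed
  then obtain M where "M \<in> \<A>" "\<forall>J\<in>\<A>. M \<subseteq> J \<longrightarrow> J = M" ..
  then have M: "lat_ideal M" "I \<subseteq> M" "a \<notin> M"
    and max: "\<And>J. lat_ideal J \<Longrightarrow> I \<subseteq> J \<Longrightarrow> a \<notin> J \<Longrightarrow> M \<subseteq> J \<Longrightarrow> J = M"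
    by (simp_all add: \<A>_def)
  note M' = lat_idealD[OF M(1)]
  \<comment> \<open>Adjoining \<open>x\<close> to the maximal ideal must capture
    \<open>a\<close>.\<close>
  have bound: "\<exists>m\<in>M. a \<sqsubseteq> m \<squnion> x" if x: "x \<in> carrier L" "x \<notin> M" for x
  proof (rule ccontr)
    assume neg: "\<not> (\<exists>m\<in>M. a \<sqsubseteq> m \<squnion> x)"
    let ?J = "{z \<in> carrier L. \<exists>m\<in>M. z \<sqsubseteq> m \<squnion> x}"
    have "M \<subseteq> ?J" using M'(1) x join_left by blast
    moreover then have "I \<subseteq> ?J" using M by blast
    moreover have "a \<notin> ?J" using neg by blast
    ultimately have "?J = M" using max[OF lat_ideal_extend[OF M(1) x(1)]] by blast
    moreover have "x \<in> ?J" using x M'(1,2) join_right[of "\<bottom>" x] by auto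
    ultimately show False using x by blast
  qed
  have "x \<in> M \<or> y \<in> M" if xy: "x \<in> carrier L" "y \<in> carrier L" "x \<sqinter> y \<in> M" for x y
  proof (rule ccontr)
    assume neg: "\<not> (x \<in> M \<or> y \<in> M)"
    obtain m where m: "m \<in> M" "a \<sqsubseteq> m \<squnion> x" using bound[of x] xy neg by blast
    obtain n where n: "n \<in> M" "a \<sqsubseteq> n \<squnion> y" using bound[of y] xy neg by blast
    have mn: "m \<in> carrier L" "n \<in> carrier L" using m n M' by blast+
    \<comment> \<open>If neither \<open>x\<close> nor \<open>y\<close> is in \<open>M\<close>, then
      \<open>a\<close> lies below this meet. Expanded by distributivity it is a join of members of
      \<open>M\<close>, which would put \<open>a\<close> into \<open>M\<close>.\<close>
    have d: "(m \<squnion> x) \<sqinter> (n \<squnion> y) = ((m \<squnion> x) \<sqinter> n) \<squnion> ((y \<sqinter> m) \<squnion> (y \<sqinter> x))"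
    proof -
      have "(m \<squnion> x) \<sqinter> (n \<squnion> y) = ((m \<squnion> x) \<sqinter> n) \<squnion> ((m \<squnion> x) \<sqinter> y)"
        using mn xy by (intro distrib) simp_all
      also have "(m \<squnion> x) \<sqinter> y = y \<sqinter> (m \<squnion> x)" by (rule meet_comm)
      also have "\<dots> = (y \<sqinter> m) \<squnion> (y \<sqinter> x)" using mn xy by (intro distrib) simp_all
      finally show ?thesis .
    qed
    have "(m \<squnion> x) \<sqinter> n \<in> M" using M'(3)[OF n(1), of "(m \<squnion> x) \<sqinter> n"] meet_right[of "m \<squnion> x" n] mn xy by simp
    moreover have "y \<sqinter> m \<in> M" using M'(3)[OF m(1), of "y \<sqinter> m"] meet_right[of y m] mn xy by simp
    moreover have "y \<sqinter> x \<in> M" using xy(3) meet_comm[of L y x] by simp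
    ultimately have "(m \<squnion> x) \<sqinter> (n \<squnion> y) \<in> M" unfolding d by (intro M'(4))
    moreover have "a \<sqsubseteq> (m \<squnion> x) \<sqinter> (n \<squnion> y)" using meet_le[of a "m \<squnion> x" "n \<squnion> y"] m n mn xy a by simp
    ultimately show False using M'(3) a M(3) by blast
  qed
  then have "M \<in> prime_ideals L" using M(1,3) a unfolding prime_ideals_iff by blast
  then show ?thesis using M by blast
qed

section \<open>The topology of the spectrum\<close>

definition basic :: "'a \<Rightarrow> 'a set set" where
  "basic a = {P \<in> prime_ideals L. a \<notin> P}"

lemma prime_ideal_simps:
  assumes "P \<in> prime_ideals L"
  shows "\<bottom> \<in> P" "\<top> \<notin> P"
    "\<And>x y. x \<in> carrier L \<Longrightarrow> y \<in> carrier L \<Longrightarrow> x \<squnion> y \<in> P \<longleftrightarrow> x \<in> P \<and> y \<in> P"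
    "\<And>x y. x \<in> carrier L \<Longrightarrow> y \<in> carrier L \<Longrightarrow> x \<sqinter> y \<in> P \<longleftrightarrow> x \<in> P \<or> y \<in> P"
    "\<And>x y. x \<in> carrier L \<Longrightarrow> y \<in> P \<Longrightarrow> x \<sqsubseteq> y \<Longrightarrow> x \<in> P"
proof -
  have P: "lat_ideal P" "P \<noteq> carrier L" "\<And>x y. x \<in> carrier L \<Longrightarrow> y \<in> carrier L \<Longrightarrow> x \<sqinter> y \<in> P \<Longrightarrow> x \<in> P \<or> y \<in> P"
    using assms unfolding prime_ideals_iff by blast+
  note P' = lat_idealD[OF P(1)]
  show "\<bottom> \<in> P" by (rule P')
  show "\<top> \<notin> P"
  proof
    assume "\<top> \<in> P"
    then have "x \<in> P" if "x \<in> carrier L" for x using P'(3)[of "\<top>" x] that by simp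
    then show False using P(2) P'(1) by blast
  qed
  show "x \<squnion> y \<in> P \<longleftrightarrow> x \<in> P \<and> y \<in> P" if "x \<in> carrier L" "y \<in> carrier L" for x y
    using P'(3)[of "x \<squnion> y" x] P'(3)[of "x \<squnion> y" y] P'(4)[of x y] that join_left join_right by blast
  show "x \<sqinter> y \<in> P \<longleftrightarrow> x \<in> P \<or> y \<in> P" if "x \<in> carrier L" "y \<in> carrier L" for x y
    using P'(3)[of x "x \<sqinter> y"] P'(3)[of y "x \<sqinter> y"] P(3)[of x y] that meet_left meet_right by auto
  show "x \<in> P" if "x \<in> carrier L" "y \<in> P" "x \<sqsubseteq> y" for x y using P'(3) that by blast
qed

lemma basic_meet: "x \<in> carrier L \<Longrightarrow> y \<in> carrier L \<Longrightarrow> basic (x \<sqinter> y) = basic x \<inter> basic y"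
  by (auto simp: basic_def prime_ideal_simps(1-4))

lemma basic_join: "x \<in> carrier L \<Longrightarrow> y \<in> carrier L \<Longrightarrow> basic (x \<squnion> y) = basic x \<union> basic y"
  by (auto simp: basic_def prime_ideal_simps(1-4))

lemma basic_bot: "basic \<bottom> = {}" and basic_top: "basic \<top> = prime_ideals L"
  by (auto simp: basic_def prime_ideal_simps(1-4))

text \<open>If \<open>x\<close> is not below \<open>y\<close>, a prime ideal containing the
  principal ideal of \<open>y\<close> but not \<open>x\<close> tells the basic sets apart.\<close>

lemma basic_le_iff:
  assumes "x \<in> carrier L" "y \<in> carrier L"
  shows "x \<sqsubseteq> y \<longleftrightarrow> basic x \<subseteq> basic y"
proof
  show "x \<sqsubseteq> y \<Longrightarrow> basic x \<subseteq> basic y" using assms prime_ideal_simps(5) unfolding basic_def by blast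
  assume sub: "basic x \<subseteq> basic y"
  show "x \<sqsubseteq> y"
  proof (rule ccontr)
    assume "\<not> x \<sqsubseteq> y"
    then have "x \<notin> {z \<in> carrier L. z \<sqsubseteq> y}" by blast
    moreover have "lat_ideal {z \<in> carrier L. z \<sqsubseteq> y}"
      unfolding lat_ideal_def
    proof (intro conjI ballI impI)
      show "{z \<in> carrier L. z \<sqsubseteq> y} \<noteq> {}" using assms by auto
      show "b \<in> {z \<in> carrier L. z \<sqsubseteq> y}"
        if "a \<in> {z \<in> carrier L. z \<sqsubseteq> y}" "b \<in> carrier L" "b \<sqsubseteq> a" for a b
        using that assms le_trans[of b a y] by auto
      show "a \<squnion> b \<in> {z \<in> carrier L. z \<sqsubseteq> y}"
        if "a \<in> {z \<in> carrier L. z \<sqsubseteq> y}" "b \<in> {z \<in> carrier L. z \<sqsubseteq> y}" for a b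
        using that assms join_le[of a y b] by auto
    qed auto
    ultimately obtain P where "P \<in> prime_ideals L" "{z \<in> carrier L. z \<sqsubseteq> y} \<subseteq> P" "x \<notin> P"
      using prime_ideal_exists[of "{z \<in> carrier L. z \<sqsubseteq> y}" x] assms by blast
    moreover have "y \<in> {z \<in> carrier L. z \<sqsubseteq> y}" using assms by auto
    ultimately show False using sub by (auto simp: basic_def)
  qed
qed

lemma topspace_Spec: "topspace (Spec L) = prime_ideals L"
proof -
  have "topspace (Spec L) = \<Union> (basic ` carrier L)" by (simp add: Spec_def basic_def)
  also have "\<dots> = prime_ideals L" using basic_top by (auto simp: basic_def)
  finally show ?thesis .
qed

lemma openin_basic: "a \<in> carrier L \<Longrightarrow> openin (Spec L) (basic a)"
  unfolding Spec_def by (rule topology_generated_by_Basis) (simp add: basic_def)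

lemma Spec_basis:
  assumes "openin (Spec L) U" "P \<in> U"
  shows "\<exists>a\<in>carrier L. P \<in> basic a \<and> basic a \<subseteq> U"
proof -
  have "generate_topology_on ((\<lambda>a. {P \<in> prime_ideals L. a \<notin> P}) ` carrier L) U"
    using assms(1) unfolding Spec_def by (rule openin_topology_generated_by)
  then have "\<forall>P\<in>U. \<exists>a\<in>carrier L. P \<in> basic a \<and> basic a \<subseteq> U"
  proof induction
    case (Int U V)
    show ?case
    proof
      fix P assume "P \<in> U \<inter> V"
      then obtain a b where "a \<in> carrier L" "P \<in> basic a" "basic a \<subseteq> U" "b \<in> carrier L" "P \<in> basic b" "basic b \<subseteq> V"
        using Int.IH by blast
      then show "\<exists>a\<in>carrier L. P \<in> basic a \<and> basic a \<subseteq> U \<inter> V"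
        using basic_meet[of a b] by (intro bexI[of _ "a \<sqinter> b"]) auto
    qed
  next
    case (UN K)
    then show ?case by blast
  next
    case (Basis s)
    then show ?case by (auto simp: basic_def)
  qed auto
  then show ?thesis using assms(2) by blast
qed

text \<open>The elements whose basic set is covered by finitely many basic sets, each inside a
  member of the cover, form an ideal \<open>I\<close>. If \<open>a\<close> were not in it, a prime
  ideal containing \<open>I\<close> but not \<open>a\<close> would be a point of
  \<open>basic a\<close> that the cover misses.\<close>

lemma compactin_basic:
  assumes a: "a \<in> carrier L" shows "compactin (Spec L) (basic a)"
  unfolding compactin_def
proof (intro conjI allI impI)
  show "basic a \<subseteq> topspace (Spec L)" by (auto simp: topspace_Spec basic_def)
  fix \<U> assume \<U>: "(\<forall>U\<in>\<U>. openin (Spec L) U) \<and> basic a \<subseteq> \<Union>\<U>"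
  define J where "J = {b \<in> carrier L. \<exists>U\<in>\<U>. basic b \<subseteq> U}"
  define I where "I = {z \<in> carrier L. \<exists>F. finite F \<and> F \<subseteq> J \<and> basic z \<subseteq> \<Union> (basic ` F)}"
  have "lat_ideal I"
    unfolding lat_ideal_def
  proof (intro conjI ballI impI)
    show "I \<subseteq> carrier L" by (auto simp: I_def)
    have "basic \<bottom> \<subseteq> \<Union> (basic ` {})" by (simp add: basic_bot)
    then have "\<bottom> \<in> I" unfolding I_def using bottom_closed by (blast intro: finite.emptyI)
    then show "I \<noteq> {}" by blast
    fix x assume "x \<in> I"
    then obtain F where F: "x \<in> carrier L" "finite F" "F \<subseteq> J" "basic x \<subseteq> \<Union> (basic ` F)" by (auto simp: I_def)
    show "y \<in> I" if "y \<in> carrier L" "y \<sqsubseteq> x" for y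
      using that basic_le_iff[of y x] F unfolding I_def by blast
    fix y assume "y \<in> I"
    then obtain G where G: "y \<in> carrier L" "finite G" "G \<subseteq> J" "basic y \<subseteq> \<Union> (basic ` G)" by (auto simp: I_def)
    have "basic (x \<squnion> y) \<subseteq> \<Union> (basic ` (F \<union> G))" using F G by (auto simp: basic_join)
    moreover have "finite (F \<union> G)" "F \<union> G \<subseteq> J" using F G by auto
    moreover have "x \<squnion> y \<in> carrier L" using F(1) G(1) by simp
    ultimately show "x \<squnion> y \<in> I" unfolding I_def by blast
  qed
  have J_I: "J \<subseteq> I"
  proof
    fix b assume "b \<in> J"
    moreover then have "b \<in> carrier L" by (simp add: J_def)
    ultimately show "b \<in> I" unfolding I_def by (intro CollectI conjI exI[of _ "{b}"]) auto
  qed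
  have "a \<in> I"
  proof (rule ccontr)
    assume "a \<notin> I"
    then obtain P where P: "P \<in> prime_ideals L" "I \<subseteq> P" "a \<notin> P"
      using prime_ideal_exists[OF \<open>lat_ideal I\<close> a] by blast
    then have "P \<in> basic a" by (simp add: basic_def)
    then obtain U where U: "U \<in> \<U>" "P \<in> U" using \<U> by blast
    have "openin (Spec L) U" using \<U> U by blast
    from Spec_basis[OF this U(2)]
    obtain b where b: "b \<in> carrier L" "P \<in> basic b" "basic b \<subseteq> U" by blast
    then have "b \<in> P" using U J_I P unfolding J_def by blast
    then show False using b by (simp add: basic_def)
  qed
  then obtain F where F: "finite F" "F \<subseteq> J" "basic a \<subseteq> \<Union> (basic ` F)" by (auto simp: I_def)
  have "\<forall>b\<in>F. \<exists>U\<in>\<U>. basic b \<subseteq> U" using F by (auto simp: J_def)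
  then obtain u where u: "\<forall>b\<in>F. u b \<in> \<U> \<and> basic b \<subseteq> u b" by metis
  then have "\<Union> (basic ` F) \<subseteq> \<Union> (u ` F)" by blast
  then show "\<exists>\<F>. finite \<F> \<and> \<F> \<subseteq> \<U> \<and> basic a \<subseteq> \<Union>\<F>"
    using F u by (intro exI[of _ "u ` F"]) auto
qed

lemma compact_openin_basic: "a \<in> carrier L \<Longrightarrow> compact_openin (Spec L) (basic a)"
  by (simp add: compact_openin_def openin_basic compactin_basic)

text \<open>A compact open set is a finite union of basic sets, and joins make it a single
  one.\<close>

lemma compact_openin_Spec_iff: "compact_openin (Spec L) U \<longleftrightarrow> U \<in> basic ` carrier L"
proof
  assume U: "compact_openin (Spec L) U"
  let ?\<U> = "basic ` {a \<in> carrier L. basic a \<subseteq> U}"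
  have "\<forall>V\<in>?\<U>. openin (Spec L) V" using openin_basic by blast
  moreover have "U \<subseteq> \<Union> ?\<U>" using Spec_basis U unfolding compact_openin_def by blast
  ultimately obtain \<F> where \<F>: "finite \<F>" "\<F> \<subseteq> ?\<U>" "U \<subseteq> \<Union>\<F>"
    using U unfolding compact_openin_def compactin_def by meson
  then obtain F where F: "finite F" "F \<subseteq> {a \<in> carrier L. basic a \<subseteq> U}" "\<F> = basic ` F"
    using finite_subset_image[OF \<F>(1,2)] by blast
  have "\<exists>c\<in>carrier L. basic c = \<Union> (basic ` F)" using F(1,2)
  proof (induction rule: finite_induct)
    case empty
    then show ?case using basic_bot bottom_closed by auto
  next
    case (insert g G)
    then obtain c where "c \<in> carrier L" "basic c = \<Union> (basic ` G)" by blast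
    then show ?case using insert.prems basic_join[of g c] by (intro bexI[of _ "g \<squnion> c"]) auto
  qed
  moreover have "\<Union> (basic ` F) = U" using F \<F> by blast
  ultimately show "U \<in> basic ` carrier L" by blast
qed (use compact_openin_basic in blast)

text \<open>The generic point of \<open>S\<close> is the set \<open>F\<close> of all
  \<open>a\<close> with \<open>basic a\<close> disjoint from \<open>S\<close>; irreducibility of
  \<open>S\<close> is its primeness. It is unique because the closure of a point consists of the
  prime ideals that contain it.\<close>

lemma sober_Spec: "sober_space (Spec L)"
  unfolding sober_space_def
proof (intro allI impI)
  fix S assume irr: "irreducible_closedin (Spec L) S"
  then have closed: "closedin (Spec L) S" and ne: "S \<noteq> {}"
    and split: "\<And>A B. closedin (Spec L) A \<Longrightarrow> closedin (Spec L) B \<Longrightarrow> S = A \<union> B \<Longrightarrow> A = S \<or> B = S"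
    unfolding irreducible_closedin_def by blast+
  have SP: "S \<subseteq> prime_ideals L" using closedin_subset[OF closed] topspace_Spec by simp
  have in_cl: "Q \<in> (Spec L) closure_of {P} \<longleftrightarrow> Q \<in> prime_ideals L \<and> P \<subseteq> Q"
    if "P \<in> prime_ideals L" for P Q
  proof -
    have "Q \<in> (Spec L) closure_of {P} \<longleftrightarrow> Q \<in> prime_ideals L \<and> (\<forall>a\<in>carrier L. Q \<in> basic a \<longrightarrow> P \<in> basic a)"
    proof (intro iffI conjI ballI impI)
      assume Q: "Q \<in> (Spec L) closure_of {P}"
      then show "Q \<in> prime_ideals L" by (simp add: in_closure_of topspace_Spec)
      fix a assume "a \<in> carrier L" "Q \<in> basic a"
      then show "P \<in> basic a" using Q openin_basic[of a] by (simp add: in_closure_of)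
    next
      assume Q: "Q \<in> prime_ideals L \<and> (\<forall>a\<in>carrier L. Q \<in> basic a \<longrightarrow> P \<in> basic a)"
      have "P \<in> T" if "Q \<in> T" "openin (Spec L) T" for T
        using Spec_basis[OF that(2,1)] Q by blast
      then show "Q \<in> (Spec L) closure_of {P}" using Q by (simp add: in_closure_of topspace_Spec)
    qed
    moreover have "P \<subseteq> carrier L" using that by (auto simp: prime_ideals_def)
    ultimately show ?thesis using that by (auto simp: basic_def)
  qed
  define F where "F = {a \<in> carrier L. basic a \<inter> S = {}}"
  have F: "F \<in> prime_ideals L"
    unfolding prime_ideals_def
  proof (rule CollectI, intro conjI ballI impI)
    have "\<bottom> \<in> F" by (simp add: F_def basic_bot)
    then show "F \<noteq> {}" by blast
    have "\<top> \<notin> F" using ne SP by (auto simp: F_def basic_top)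
    then show "F \<noteq> carrier L" using top_closed by blast
    show "y \<in> F" if "x \<in> F" "y \<in> carrier L" "y \<sqsubseteq> x" for x y
      using that basic_le_iff[of y x] by (auto simp: F_def)
    show "x \<squnion> y \<in> F" if "x \<in> F" "y \<in> F" for x y
      using that by (auto simp: F_def basic_join)
    show "x \<in> F \<or> y \<in> F" if xy: "x \<in> carrier L" "y \<in> carrier L" "x \<sqinter> y \<in> F" for x y
    proof -
      have "S = (S - basic x) \<union> (S - basic y)" using xy by (auto simp: F_def basic_meet)
      then have "S - basic x = S \<or> S - basic y = S"
        using split[of "S - basic x" "S - basic y"] closedin_diff[OF closed openin_basic] xy by blast
      then show ?thesis using xy by (auto simp: F_def)
    qed
  qed (auto simp: F_def)
  have "F \<in> S"
  proof (rule ccontr)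
    assume "F \<notin> S"
    then have "F \<in> topspace (Spec L) - S" using F topspace_Spec by simp
    moreover have "openin (Spec L) (topspace (Spec L) - S)" using closed by (simp add: closedin_def)
    ultimately obtain a where "a \<in> carrier L" "F \<in> basic a" "basic a \<subseteq> topspace (Spec L) - S"
      using Spec_basis by blast
    moreover from this have "a \<in> F" by (auto simp: F_def)
    ultimately show False by (simp add: basic_def)
  qed
  have "(Spec L) closure_of {F} = S"
  proof
    show "(Spec L) closure_of {F} \<subseteq> S" using closure_of_minimal[OF _ closed, of "{F}"] \<open>F \<in> S\<close> by simp
    show "S \<subseteq> (Spec L) closure_of {F}" using SP by (auto simp: in_cl[OF F]) (auto simp: F_def basic_def)
  qed
  moreover have "P = F" if "P \<in> prime_ideals L" "(Spec L) closure_of {P} = S" for P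
    using in_cl[OF that(1), of P] in_cl[OF that(1), of F] in_cl[OF F, of P] \<open>F \<in> S\<close> that
      \<open>(Spec L) closure_of {F} = S\<close> by blast
  ultimately show "\<exists>!x. x \<in> topspace (Spec L) \<and> (Spec L) closure_of {x} = S"
    using F topspace_Spec by blast
qed

theorem dual_pair_Spec: "dual_pair (Spec L) L basic"
proof -
  have "spectral_space (Spec L)"
  proof (rule spectral_spaceI[OF sober_Spec])
    show "compact_space (Spec L)"
      using compactin_basic[of "\<top>"] by (simp add: compact_space_def topspace_Spec basic_top)
    show "\<exists>V. compact_openin (Spec L) V \<and> P \<in> V \<and> V \<subseteq> U" if "openin (Spec L) U" "P \<in> U" for U P
      using Spec_basis[OF that] compact_openin_basic by blast
    show "compact_openin (Spec L) (U \<inter> V)" if "compact_openin (Spec L) U" "compact_openin (Spec L) V" for U V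
      using that unfolding compact_openin_Spec_iff by (auto simp flip: basic_meet)
  qed
  moreover have "sets_rep L basic {U. compact_openin (Spec L) U}"
    unfolding sets_rep_def
  proof (intro conjI ballI)
    show "(.=) = (=)" by (rule eq_is_equal)
    show "bij_betw basic (carrier L) {U. compact_openin (Spec L) U}"
      unfolding bij_betw_def
    proof
      show "inj_on basic (carrier L)"
        by (rule inj_onI) (metis basic_le_iff le_antisym order.refl)
      show "basic ` carrier L = {U. compact_openin (Spec L) U}"
        by (auto simp: compact_openin_Spec_iff)
    qed
  qed (rule basic_le_iff)
  ultimately show ?thesis by (simp add: dual_pair_def)
qed

end

lemma bounded_distributive_lattice_iff: "bounded_distributive_lattice L \<longleftrightarrow> bounded_distrib_lattice L"
  by (auto simp: bounded_distributive_lattice_def bounded_distrib_lattice_def bounded_distrib_lattice_axioms_def)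

text \<open>Up to homeomorphism every dual pair is a spectrum. Through this the closedness condition
  of \<open>LIC\<close>, stated on spectra, reaches arbitrary dual spaces.\<close>

lemma (in stone_dual) homeomorphic_map_Spec:
  "homeomorphic_map X (Spec L) (\<lambda>x. {a \<in> carrier L. x \<notin> e a})"
proof -
  interpret S: bounded_distrib_lattice L
    using bounded_distributive_lattice_L by (simp add: bounded_distributive_lattice_iff)
  define \<eta> where "\<eta> x = {a \<in> carrier L. x \<notin> e a}" for x
  have pre: "x \<in> topspace X \<Longrightarrow> a \<in> carrier L \<Longrightarrow> \<eta> x \<in> S.basic a \<longleftrightarrow> x \<in> e a" for x a
    using point_prime_ideal[of x] by (auto simp: S.basic_def \<eta>_def)
  have surj: "\<eta> ` topspace X = topspace (Spec L)"
  proof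
    show "\<eta> ` topspace X \<subseteq> topspace (Spec L)" using point_prime_ideal by (auto simp: S.topspace_Spec \<eta>_def)
    show "topspace (Spec L) \<subseteq> \<eta> ` topspace X"
    proof
      fix P assume "P \<in> topspace (Spec L)"
      then have P: "P \<in> prime_ideals L" by (simp add: S.topspace_Spec)
      then have "P \<subseteq> carrier L" by (simp add: prime_ideals_def)
      moreover obtain x where "x \<in> topspace X" "\<forall>b\<in>carrier L. x \<in> e b \<longleftrightarrow> b \<notin> P"
        using prime_ideal_point[OF P] by blast
      ultimately show "P \<in> \<eta> ` topspace X" by (intro image_eqI[of _ _ x]) (auto simp: \<eta>_def)
    qed
  qed
  have inj: "inj_on \<eta> (topspace X)"
    by (rule inj_onI) (rule points_eq, auto simp: \<eta>_def)
  have img: "\<eta> ` e a = S.basic a" if "a \<in> carrier L" for a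
  proof
    show "\<eta> ` e a \<subseteq> S.basic a" using pre e_subset that by blast
    show "S.basic a \<subseteq> \<eta> ` e a"
    proof
      fix P assume P: "P \<in> S.basic a"
      then have "P \<in> \<eta> ` topspace X" using surj by (simp add: S.basic_def S.topspace_Spec)
      then show "P \<in> \<eta> ` e a" using pre that P by blast
    qed
  qed
  have "homeomorphic_map X (Spec L) \<eta>"
  proof (rule bijective_open_imp_homeomorphic_map[OF _ _ surj inj])
    show "continuous_map X (Spec L) \<eta>"
      unfolding continuous_map_def
    proof (intro conjI allI impI)
      show "\<eta> \<in> topspace X \<rightarrow> topspace (Spec L)" using surj by blast
      fix U assume U: "openin (Spec L) U"
      show "openin X {x \<in> topspace X. \<eta> x \<in> U}"
        unfolding openin_subopen[of X "{x \<in> topspace X. \<eta> x \<in> U}"]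
      proof
        fix x assume "x \<in> {x \<in> topspace X. \<eta> x \<in> U}"
        then obtain a where "x \<in> topspace X" "a \<in> carrier L" "\<eta> x \<in> S.basic a" "S.basic a \<subseteq> U"
          using S.Spec_basis[OF U] by blast
        then show "\<exists>T. openin X T \<and> x \<in> T \<and> T \<subseteq> {x \<in> topspace X. \<eta> x \<in> U}"
          using e_open[of a] e_subset[of a] pre by (intro exI[of _ "e a"]) blast
      qed
    qed
    show "open_map X (Spec L) \<eta>"
      unfolding open_map_def
    proof (intro allI impI)
      fix U assume U: "openin X U"
      show "openin (Spec L) (\<eta> ` U)"
        unfolding openin_subopen[of "Spec L" "\<eta> ` U"]
      proof
        fix P assume "P \<in> \<eta> ` U"
        then obtain x where x: "x \<in> U" "P = \<eta> x" by blast
        obtain a where "a \<in> carrier L" "x \<in> e a" "e a \<subseteq> U" using U x(1) by (rule e_basis)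
        then show "\<exists>T. openin (Spec L) T \<and> P \<in> T \<and> T \<subseteq> \<eta> ` U"
          using S.openin_basic[of a] img[of a] x by (intro exI[of _ "S.basic a"]) blast
      qed
    qed
  qed
  then show ?thesis by (simp add: \<eta>_def[abs_def])
qed

subsection \<open>Transport along injections\<close>

text \<open>The points of a spectrum are sets of lattice elements, whereas the spaces of
  \<open>SIC\<close> have their points in the universe; hence the need to push a topology forward
  along an injection.\<close>

lemma transported_topology:
  assumes j: "inj_on j (topspace X)"
  shows "\<exists>X'. homeomorphic_map X X' j"
proof -
  have "istopology (\<lambda>U. \<exists>V. openin X V \<and> U = j ` V)"
    unfolding istopology_def
  proof (intro conjI allI impI)
    fix S T assume "\<exists>V. openin X V \<and> S = j ` V" "\<exists>V. openin X V \<and> T = j ` V"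
    then obtain V W where "openin X V" "S = j ` V" "openin X W" "T = j ` W" by blast
    moreover from this have "j ` V \<inter> j ` W = j ` (V \<inter> W)"
      using inj_on_image_Int[OF j] openin_subset by blast
    ultimately show "\<exists>V. openin X V \<and> S \<inter> T = j ` V" using openin_Int by metis
  next
    fix \<K> assume "\<forall>K\<in>\<K>. \<exists>V. openin X V \<and> K = j ` V"
    then obtain v where v: "\<forall>K\<in>\<K>. openin X (v K) \<and> K = j ` v K" by metis
    have "\<Union>\<K> = j ` (\<Union>K\<in>\<K>. v K)" unfolding image_UN using v by auto
    moreover have "openin X (\<Union>K\<in>\<K>. v K)" using v by blast
    ultimately show "\<exists>V. openin X V \<and> \<Union>\<K> = j ` V" by blast
  qed
  note istop = this
  define X' where "X' = topology (\<lambda>U. \<exists>V. openin X V \<and> U = j ` V)"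
  have X': "openin X' U \<longleftrightarrow> (\<exists>V. openin X V \<and> U = j ` V)" for U
    unfolding X'_def topology_inverse'[OF istop] ..
  have top: "topspace X' = j ` topspace X"
    unfolding topspace_def[of X'] X' using openin_subset[of X] openin_topspace[of X] by blast
  have "homeomorphic_map X X' j"
  proof (rule bijective_open_imp_homeomorphic_map[OF _ _ _ j])
    show "open_map X X' j" unfolding open_map_def X' by blast
    show "continuous_map X X' j"
      unfolding continuous_map_def
    proof (intro conjI allI impI)
      show "j \<in> topspace X \<rightarrow> topspace X'" using top by blast
      fix U assume "openin X' U"
      then obtain V where V: "openin X V" "U = j ` V" using X' by blast
      then have "{x \<in> topspace X. j x \<in> U} = V"
        using openin_subset[OF V(1)] inj_on_image_mem_iff[OF j _ openin_subset[OF V(1)]] by blast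
      then show "openin X {x \<in> topspace X. j x \<in> U}" using V by simp
    qed
  qed (simp add: top)
  then show ?thesis by blast
qed

lemma homeomorphic_compact_openin:
  assumes j: "homeomorphic_map X X' j" and U: "U \<subseteq> topspace X"
  shows "compact_openin X' (j ` U) \<longleftrightarrow> compact_openin X U"
  by (simp add: compact_openin_def homeomorphic_map_openness[OF j U] homeomorphic_map_compactness[OF j U])

lemma homeomorphic_spectral_space:
  assumes j: "homeomorphic_map X X' j" and X: "spectral_space X"
  shows "spectral_space X'"
proof -
  have inj: "inj_on j (topspace X)" and surj: "j ` topspace X = topspace X'"
    using j by (auto simp: homeomorphic_eq_everything_map)
  have lift: "\<exists>V\<subseteq>topspace X. U = j ` V" if "U \<subseteq> topspace X'" for U
    using that surj by (metis subset_imageE)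
  note inj_eq = inj_on_image_eq_iff[OF inj]
  show ?thesis
  proof (rule spectral_spaceI)
    show "compact_space X'"
      using homeomorphic_compact_openin[OF j order.refl] spectral_space_topspace[OF X] surj
      by (simp add: compact_space_def compact_openin_def)
  next
    fix U x assume U: "openin X' U" "x \<in> U"
    obtain V where V: "V \<subseteq> topspace X" "U = j ` V" using lift openin_subset[OF U(1)] by blast
    then have "openin X V" using U homeomorphic_map_openness[OF j V(1)] by simp
    moreover obtain y where "y \<in> V" "x = j y" using U V by blast
    ultimately obtain W where "compact_openin X W" "y \<in> W" "W \<subseteq> V" using spectral_basis_point[OF X] by metis
    then show "\<exists>V. compact_openin X' V \<and> x \<in> V \<and> V \<subseteq> U"
      using homeomorphic_compact_openin[OF j, of W] V \<open>x = j y\<close> by (intro exI[of _ "j ` W"]) auto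
  next
    fix U V assume UV: "compact_openin X' U" "compact_openin X' V"
    obtain A where A: "A \<subseteq> topspace X" "U = j ` A" using lift compact_openin_subset[OF UV(1)] by blast
    obtain B where B: "B \<subseteq> topspace X" "V = j ` B" using lift compact_openin_subset[OF UV(2)] by blast
    have "compact_openin X (A \<inter> B)"
      using X UV homeomorphic_compact_openin[OF j A(1)] homeomorphic_compact_openin[OF j B(1)] A B
      by (simp add: spectral_space_def)
    then show "compact_openin X' (U \<inter> V)"
      using homeomorphic_compact_openin[OF j, of "A \<inter> B"] A B inj_on_image_Int[OF inj A(1) B(1)] by auto
  next
    show "sober_space X'"
      unfolding sober_space_def
    proof (intro allI impI)
      fix S' assume irr: "irreducible_closedin X' S'"
      then have S': "closedin X' S'" "S' \<noteq> {}"
        "\<And>A B. closedin X' A \<Longrightarrow> closedin X' B \<Longrightarrow> S' = A \<union> B \<Longrightarrow> A = S' \<or> B = S'"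
        unfolding irreducible_closedin_def by blast+
      obtain S where S: "S \<subseteq> topspace X" "S' = j ` S" using lift closedin_subset[OF S'(1)] by blast
      have "irreducible_closedin X S"
        unfolding irreducible_closedin_def
      proof (intro conjI allI impI)
        show "closedin X S" using homeomorphic_map_closedness[OF j S(1)] S' S by simp
        show "S \<noteq> {}" using S S' by blast
        fix A B assume AB: "closedin X A \<and> closedin X B \<and> S = A \<union> B"
        then have sub: "A \<subseteq> topspace X" "B \<subseteq> topspace X" using S by auto
        have "j ` A = S' \<or> j ` B = S'"
          using S'(3)[of "j ` A" "j ` B"] AB homeomorphic_map_closedness[OF j sub(1)]
            homeomorphic_map_closedness[OF j sub(2)] S(2) by blast
        then show "A = S \<or> B = S" unfolding S(2) using inj_eq sub S(1) by blast
      qed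
      then have ex1: "\<exists>!x. x \<in> topspace X \<and> X closure_of {x} = S"
        using X unfolding spectral_space_def sober_space_def by blast
      have cl: "X' closure_of {j x} = S' \<longleftrightarrow> X closure_of {x} = S" if "x \<in> topspace X" for x
        using homeomorphic_map_closure_of[OF j, of "{x}"] that S
          inj_eq[OF closure_of_subset_topspace S(1)] by simp
      show "\<exists>!x. x \<in> topspace X' \<and> X' closure_of {x} = S'"
        using ex1 cl unfolding surj[symmetric] by blast
    qed
  qed
qed

lemma dual_pair_transport:
  assumes D: "dual_pair X L e" and j: "homeomorphic_map X X' j"
  shows "dual_pair X' L (\<lambda>a. j ` e a)"
proof -
  interpret stone_dual X L e using D by (simp add: stone_dual_def)
  have inj: "inj_on j (topspace X)" and surj: "j ` topspace X = topspace X'"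
    using j by (auto simp: homeomorphic_eq_everything_map)
  have sub: "j ` e a \<subseteq> j ` e b \<longleftrightarrow> e a \<subseteq> e b" if "a \<in> carrier L" "b \<in> carrier L" for a b
    using e_subset[OF that(1)] e_subset[OF that(2)] inj unfolding inj_on_def by blast
  have "bij_betw (\<lambda>a. j ` e a) (carrier L) {U. compact_openin X' U}"
    unfolding bij_betw_def
  proof
    show "inj_on (\<lambda>a. j ` e a) (carrier L)"
    proof (rule inj_onI)
      fix a b assume ab: "a \<in> carrier L" "b \<in> carrier L" "j ` e a = j ` e b"
      then have "e a = e b" using sub by blast
      then show "a = b" using e_inj ab by blast
    qed
    show "(\<lambda>a. j ` e a) ` carrier L = {U. compact_openin X' U}"
    proof (intro equalityI subsetI)
      fix U assume "U \<in> (\<lambda>a. j ` e a) ` carrier L"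
      then show "U \<in> {U. compact_openin X' U}"
        using e_in e_subset homeomorphic_compact_openin[OF j] by auto
    next
      fix U assume U: "U \<in> {U. compact_openin X' U}"
      then have "U \<subseteq> j ` topspace X" using compact_openin_subset surj by blast
      then obtain V where V: "V \<subseteq> topspace X" "U = j ` V" by (rule subset_imageE)
      then have "compact_openin X V" using U homeomorphic_compact_openin[OF j V(1)] by simp
      then show "U \<in> (\<lambda>a. j ` e a) ` carrier L" using e_surj V by blast
    qed
  qed
  then show ?thesis
    using homeomorphic_spectral_space[OF j spectral] sub le_iff eq_L by (simp add: dual_pair_def sets_rep_def)
qed

lemma closed_map_transfer:
  assumes h: "homeomorphic_map C C' h" and k: "homeomorphic_map X X' k"
    and m: "\<And>c. c \<in> topspace C \<Longrightarrow> m c \<in> topspace X" and comm: "\<And>c. c \<in> topspace C \<Longrightarrow> m' (h c) = k (m c)"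
  shows "closed_map C X m \<longleftrightarrow> closed_map C' X' m'"
proof -
  have "closed_map C' X' m' \<longleftrightarrow> (\<forall>U. closedin C U \<longrightarrow> closedin X' (m' ` h ` U))"
    unfolding closed_map_def by (rule all_closedin_homeomorphic_image[OF h])
  also have "\<dots> \<longleftrightarrow> (\<forall>U. closedin C U \<longrightarrow> closedin X (m ` U))"
  proof (intro all_cong1 imp_cong HOL.refl)
    fix U assume "closedin C U"
    then have U: "U \<subseteq> topspace C" by (rule closedin_subset)
    then have "m' ` h ` U = k ` m ` U"
      unfolding image_image by (intro image_cong HOL.refl comm) auto
    moreover have "m ` U \<subseteq> topspace X" using U m by blast
    ultimately show "closedin X' (m' ` h ` U) \<longleftrightarrow> closedin X (m ` U)"
      using homeomorphic_map_closedness[OF k] by simp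
  qed
  finally show ?thesis unfolding closed_map_def by simp
qed

text \<open>The homeomorphisms onto the spectra carry \<open>m\<close> to the Stone dual of its own
  dual homomorphism.\<close>

lemma closed_map_stone_dual:
  assumes X: "dual_pair X B e" and C: "dual_pair C L e'" and m: "m \<in> spectral_maps C X"
  shows "closed_map C X m \<longleftrightarrow> closed_map (Spec L) (Spec B) (stone_dual_map B L (hat C L e' B e m))"
proof -
  interpret CX: stone_dual2 C L e' X B e using X C by (simp add: stone_dual2_def stone_dual_def)
  show ?thesis
  proof (rule closed_map_transfer[OF CX.X.homeomorphic_map_Spec CX.Y.homeomorphic_map_Spec])
    fix c assume c: "c \<in> topspace C"
    show "m c \<in> topspace X" using CX.maps_to[OF m c] .
    show "stone_dual_map B L (hat C L e' B e m) {a \<in> carrier L. c \<notin> e' a} = {b \<in> carrier B. m c \<notin> e b}"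
      using CX.X.point_prime_ideal[OF c] CX.hat_val[OF m] c by (auto simp: stone_dual_map_def)
  qed
qed

subsection \<open>Monomorphisms and epimorphisms\<close>

lemma compact_openin_discrete_singleton: "compact_openin (discrete_topology {a}) U \<longleftrightarrow> U \<subseteq> {a}"
  by (auto simp: compact_openin_def compactin_discrete_topology finite_subset)

lemma spectral_space_discrete_singleton: "spectral_space (discrete_topology {a})"
proof (rule spectral_spaceI)
  show "sober_space (discrete_topology {a})"
    unfolding sober_space_def
  proof (intro allI impI)
    fix S assume "irreducible_closedin (discrete_topology {a}) S"
    then have "S = {a}" by (auto simp: irreducible_closedin_def)
    then show "\<exists>!x. x \<in> topspace (discrete_topology {a}) \<and> (discrete_topology {a}) closure_of {x} = S"
      by (auto simp: discrete_topology_closure_of)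
  qed
qed (auto simp: compact_space_def compactin_discrete_topology compact_openin_discrete_singleton)

lemma const_spectral_map:
  "x \<in> topspace X \<Longrightarrow> (\<lambda>_\<in>{a}. x) \<in> spectral_maps (discrete_topology {a}) X"
  by (auto simp: spectral_maps_def compact_openin_discrete_singleton)

text \<open>Two points with the same image are two maps from a one-point space. That space is
  carried by \<open>{x}\<close>, because the test spaces have their points in the type of
  \<open>C\<close>.\<close>

lemma spectral_mono_iff_inj:
  assumes m: "m \<in> spectral_maps C X"
  shows "spectral_mono C X m \<longleftrightarrow> inj_on m (topspace C)"
proof
  assume mono: "spectral_mono C X m"
  show "inj_on m (topspace C)"
  proof (rule inj_onI)
    fix x y assume xy: "x \<in> topspace C" "y \<in> topspace C" "m x = m y"
    let ?T = "discrete_topology {x}"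
    have "compose (topspace ?T) m (\<lambda>_\<in>{x}. x) = compose (topspace ?T) m (\<lambda>_\<in>{x}. y)"
      using xy by (auto simp: compose_def)
    then have "(\<lambda>_\<in>{x}. x) = (\<lambda>_\<in>{x}. y)"
      using mono const_spectral_map[OF xy(1), of x] const_spectral_map[OF xy(2), of x]
        spectral_space_discrete_singleton[of x] unfolding spectral_mono_def by blast
    then show "x = y" by (metis restrict_apply' singletonI)
  qed
next
  assume inj: "inj_on m (topspace C)"
  show "spectral_mono C X m"
    unfolding spectral_mono_def
  proof (intro conjI m allI impI ballI)
    fix T :: "'a topology" and g h
    assume g: "g \<in> spectral_maps T C" and h: "h \<in> spectral_maps T C"
      and eq: "compose (topspace T) m g = compose (topspace T) m h"
    show "g = h"
    proof (rule extensionalityI[of _ "topspace T"])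
      fix x assume x: "x \<in> topspace T"
      then have "m (g x) = m (h x)" using fun_cong[OF eq, of x] by (simp add: compose_def)
      moreover have "g x \<in> topspace C" "h x \<in> topspace C" using g h x by (auto simp: spectral_maps_def)
      ultimately show "g x = h x" using inj by (auto dest: inj_onD)
    qed (use g h in \<open>auto simp: spectral_maps_def PiE_def\<close>)
  qed
qed

definition two_chain :: "'a \<Rightarrow> 'a \<Rightarrow> 'a gorder" where
  "two_chain p q = \<lparr>carrier = {p, q}, eq = (=), le = (\<lambda>a b. a = b \<or> a = p \<and> b = q)\<rparr>"

lemma dual_pair_two_chain:
  assumes "p \<noteq> q"
  shows "dual_pair (discrete_topology {a}) (two_chain p q) (\<lambda>x. if x = q then {a} else {})"
proof -
  have "{U. U \<subseteq> {a}} = {{}, {a}}" by blast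
  then show ?thesis
    using assms spectral_space_discrete_singleton[of a]
    by (auto simp: dual_pair_def sets_rep_def two_chain_def compact_openin_discrete_singleton
        bij_betw_def inj_on_def)
qed

text \<open>
  Points of \<open>C\<close> are the maps into \<open>C\<close> from the one-point space, which is dual to the two-element chain.
\<close>

lemma epi_imp_inj:
  fixes L :: "'u gorder" and p q :: 'u
  assumes C: "dual_pair C L e'" and X: "dual_pair X B e" and m: "m \<in> spectral_maps C X"
    and epi: "lattice_epi B L (hat C L e' B e m)" and pq: "p \<noteq> q"
  shows "inj_on m (topspace C)"
proof (rule inj_onI)
  fix x y assume xy: "x \<in> topspace C" "y \<in> topspace C" "m x = m y"
  define T where "T = discrete_topology {()}"
  \<comment> \<open>The test lattices of \<open>lattice_epi\<close> live on the type of
    \<open>L\<close>, so the two-element chain is built from two elements of that type.\<close>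
  define N where "N = two_chain p q"
  define d where "d z = (if z = q then {()} else {})" for z
  have T: "dual_pair T N d" unfolding T_def N_def d_def[abs_def] by (rule dual_pair_two_chain[OF pq])
  interpret TC: stone_dual2 T N d C L e' using T C by (simp add: stone_dual2_def stone_dual_def)
  define g where "g = (\<lambda>_\<in>{()}. x)"
  define h where "h = (\<lambda>_\<in>{()}. y)"
  have gh: "g \<in> spectral_maps T C" "h \<in> spectral_maps T C"
    unfolding T_def g_def h_def using xy by (simp_all only: const_spectral_map)
  have "compose (topspace T) m g = compose (topspace T) m h"
    using xy by (auto simp: compose_def g_def h_def T_def)
  then have "compose (carrier B) (hat T N d L e' g) (hat C L e' B e m) =
      compose (carrier B) (hat T N d L e' h) (hat C L e' B e m)"
    using hat_compose[OF T C X gh(1) m] hat_compose[OF T C X gh(2) m] by simp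
  moreover have "bounded_distributive_lattice N" by (rule TC.X.bounded_distributive_lattice_L)
  ultimately have "hat T N d L e' g = hat T N d L e' h"
    using epi TC.hat_hom[OF gh(1)] TC.hat_hom[OF gh(2)] unfolding lattice_epi_def by blast
  then have "g = h" by (rule TC.hat_inj[OF gh])
  then show "x = y" by (metis g_def h_def restrict_apply' singletonI)
qed

lemma surj_imp_epi:
  assumes f: "f \<in> lattice_homs B L" and surj: "carrier L \<subseteq> f ` carrier B"
  shows "lattice_epi B L f"
  unfolding lattice_epi_def
proof (intro conjI f allI impI ballI)
  fix N :: "'b gorder" and g h
  assume g: "g \<in> lattice_homs L N" and h: "h \<in> lattice_homs L N"
    and eq: "compose (carrier B) g f = compose (carrier B) h f"
  show "g = h"
  proof (rule extensionalityI[of _ "carrier L"])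
    fix y assume "y \<in> carrier L"
    then obtain x where "x \<in> carrier B" "y = f x" using surj by blast
    then show "g y = h y" using fun_cong[OF eq, of x] by (simp add: compose_def)
  qed (use g h in \<open>auto simp: lattice_homs_def PiE_def\<close>)
qed

lemma closed_inj_preimage:
  assumes X: "spectral_space X" and m: "m \<in> spectral_maps C X"
    and closed: "closed_map C X m" and inj: "inj_on m (topspace C)" and U: "compact_openin C U"
  shows "\<exists>W. compact_openin X W \<and> U = {x \<in> topspace C. m x \<in> W}"
proof -
  have mC: "m x \<in> topspace X" if "x \<in> topspace C" for x using m that by (auto simp: spectral_maps_def)
  define V where "V = topspace X - m ` (topspace C - U)"
  have "closedin C (topspace C - U)" using U by (simp add: compact_openin_def closedin_diff)
  then have "openin X V" using closed by (simp add: V_def closed_map_def openin_diff)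
  then obtain \<U> where \<U>: "\<And>W. W \<in> \<U> \<Longrightarrow> compact_openin X W" "V = \<Union>\<U>" using spectral_basis[OF X] by metis
  \<comment> \<open>Injectivity keeps the image of a point of \<open>U\<close> out of the image of
    the complement.\<close>
  have pre: "{x \<in> topspace C. m x \<in> V} = U"
  proof
    show "{x \<in> topspace C. m x \<in> V} \<subseteq> U" by (auto simp: V_def)
    show "U \<subseteq> {x \<in> topspace C. m x \<in> V}"
    proof
      fix x assume x: "x \<in> U"
      then have xC: "x \<in> topspace C" using compact_openin_subset[OF U] by blast
      have "m x \<notin> m ` (topspace C - U)" using inj_on_image_mem_iff[OF inj xC, of "topspace C - U"] x by blast
      then show "x \<in> {x \<in> topspace C. m x \<in> V}" using xC mC by (simp add: V_def)
    qed
  qed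
  \<comment> \<open>\<open>V\<close> need not be compact, but \<open>U\<close> is: finitely many of
    the compact open sets that make up \<open>V\<close> have preimages covering \<open>U\<close>,
    and their union is the required set.\<close>
  define pre' where "pre' W = {x \<in> topspace C. m x \<in> W}" for W
  have "\<forall>W\<in>pre' ` \<U>. openin C W"
    using m \<U>(1) by (auto simp: spectral_maps_def compact_openin_def pre'_def)
  moreover have "U \<subseteq> \<Union> (pre' ` \<U>)" using pre \<U>(2) by (auto simp: pre'_def)
  moreover have "compactin C U" using U by (simp add: compact_openin_def)
  ultimately obtain \<F> where \<F>: "finite \<F>" "\<F> \<subseteq> pre' ` \<U>" "U \<subseteq> \<Union>\<F>"
    unfolding compactin_def by meson
  obtain F where F: "F \<subseteq> \<U>" "finite F" "\<F> = pre' ` F"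
    using finite_subset_image[OF \<F>(1,2)] by blast
  have "compact_openin X (\<Union>F)" using F \<U>(1) by (intro compact_openin_Union) auto
  moreover have "U = {x \<in> topspace C. m x \<in> \<Union>F}"
  proof
    show "U \<subseteq> {x \<in> topspace C. m x \<in> \<Union>F}" using \<F>(3) F(3) by (auto simp: pre'_def)
    show "{x \<in> topspace C. m x \<in> \<Union>F} \<subseteq> U" using pre F(1) \<U>(2) by blast
  qed
  ultimately show ?thesis by blast
qed

subsection \<open>Correspondence of the objects\<close>

lemma double_diff_subset_iff: "A \<subseteq> Q \<Longrightarrow> B \<subseteq> Q \<Longrightarrow> Q - A \<subseteq> Q - B \<longleftrightarrow> B \<subseteq> A"
  by blast

text \<open>Complements in the cube undo the reversal of the order and present the Belluce lattice
  as a lattice of sets, to which \<open>set_lattice\<close> applies.\<close>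

lemma bounded_distributive_lattice_belluce: "bounded_distributive_lattice (belluce (free_mv K))"
proof -
  let ?Q = "K \<rightarrow>\<^sub>E {0..1::real}"
  obtain \<phi> where bij: "bij_betw \<phi> (carrier (belluce (free_mv K))) (cylinder_polyhedra K)"
    and le: "\<forall>x\<in>carrier (belluce (free_mv K)). \<forall>y\<in>carrier (belluce (free_mv K)).
      x \<sqsubseteq>\<^bsub>belluce (free_mv K)\<^esub> y \<longleftrightarrow> \<phi> y \<subseteq> \<phi> x"
    using belluce_iso_Cypol[of K] by (auto simp: lattices_isomorphic_def Cypol_def inclusion_order_def)
  have sub: "Z \<subseteq> ?Q" if "Z \<in> cylinder_polyhedra K" for Z
    using that by (auto simp: cylinder_polyhedra_eq_zero_sets zero_set_def)
  have \<phi>: "\<phi> x \<subseteq> ?Q" if "x \<in> carrier (belluce (free_mv K))" for x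
    using bij that sub by (auto simp: bij_betw_def)
  interpret set_lattice "belluce (free_mv K)" "\<lambda>x. ?Q - \<phi> x" "(\<lambda>Z. ?Q - Z) ` cylinder_polyhedra K" ?Q
  proof
    have "bij_betw (\<lambda>Z. ?Q - Z) (cylinder_polyhedra K) ((\<lambda>Z. ?Q - Z) ` cylinder_polyhedra K)"
      by (rule inj_on_imp_bij_betw) (rule inj_onI, use sub in blast)
    then have "bij_betw (\<lambda>x. ?Q - \<phi> x) (carrier (belluce (free_mv K))) ((\<lambda>Z. ?Q - Z) ` cylinder_polyhedra K)"
      using bij_betw_trans[OF bij] by (simp add: comp_def)
    moreover have "x \<sqsubseteq>\<^bsub>belluce (free_mv K)\<^esub> y \<longleftrightarrow> ?Q - \<phi> x \<subseteq> ?Q - \<phi> y"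
      if "x \<in> carrier (belluce (free_mv K))" "y \<in> carrier (belluce (free_mv K))" for x y
      using le that by (simp add: double_diff_subset_iff[OF \<phi>[OF that(1)] \<phi>[OF that(2)]])
    ultimately show "sets_rep (belluce (free_mv K)) (\<lambda>x. ?Q - \<phi> x) ((\<lambda>Z. ?Q - Z) ` cylinder_polyhedra K)"
      by (simp add: sets_rep_def) (simp add: belluce_def)
  next
    fix U V assume "U \<in> (\<lambda>Z. ?Q - Z) ` cylinder_polyhedra K" "V \<in> (\<lambda>Z. ?Q - Z) ` cylinder_polyhedra K"
    then obtain s t where st: "s \<in> mv_terms K" "t \<in> mv_terms K" "U = ?Q - zero_set K s" "V = ?Q - zero_set K t"
      unfolding cylinder_polyhedra_eq_zero_sets by blast
    have terms: "Plus s t \<in> mv_terms K" "meet_term s t \<in> mv_terms K"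
      using st by (simp_all add: meet_term_def)
    have "U \<union> V = ?Q - zero_set K (Plus s t)" using st by (simp add: zero_set_Plus Diff_Int)
    then show "U \<union> V \<in> (\<lambda>Z. ?Q - Z) ` cylinder_polyhedra K"
      unfolding cylinder_polyhedra_eq_zero_sets by (simp only: imageI terms)
    have "U \<inter> V = ?Q - zero_set K (meet_term s t)" using st by (simp add: zero_set_meet_term Diff_Un)
    then show "U \<inter> V \<in> (\<lambda>Z. ?Q - Z) ` cylinder_polyhedra K"
      unfolding cylinder_polyhedra_eq_zero_sets by (simp only: imageI terms)
  next
    have "zero_set K Zero = ?Q" "zero_set K (Neg Zero) = {}" by (auto simp: zero_set_def)
    then have "?Q \<in> cylinder_polyhedra K" "{} \<in> cylinder_polyhedra K"
      unfolding cylinder_polyhedra_eq_zero_sets by (metis imageI mv_terms_simps(2,3))+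
    then show "{} \<in> (\<lambda>Z. ?Q - Z) ` cylinder_polyhedra K" "?Q \<in> (\<lambda>Z. ?Q - Z) ` cylinder_polyhedra K"
      by (auto intro: rev_image_eqI)
  qed auto
  show ?thesis by (rule bounded_distributive_lattice_L)
qed

lemma lattices_isomorphic_sym:
  assumes "lattices_isomorphic L M" shows "lattices_isomorphic M L"
proof -
  obtain f where f: "bij_betw f (carrier L) (carrier M)"
    "\<forall>x\<in>carrier L. \<forall>y\<in>carrier L. x \<sqsubseteq>\<^bsub>L\<^esub> y \<longleftrightarrow> f x \<sqsubseteq>\<^bsub>M\<^esub> f y"
    using assms by (auto simp: lattices_isomorphic_def)
  let ?g = "inv_into (carrier L) f"
  have g: "bij_betw ?g (carrier M) (carrier L)" using f(1) by (rule bij_betw_inv_into)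
  have "x \<sqsubseteq>\<^bsub>M\<^esub> y \<longleftrightarrow> ?g x \<sqsubseteq>\<^bsub>L\<^esub> ?g y" if "x \<in> carrier M" "y \<in> carrier M" for x y
    using f(2) that bij_betwE[OF g] bij_betw_inv_into_right[OF f(1)] by simp
  then show ?thesis using g unfolding lattices_isomorphic_def by blast
qed

lemma lattices_isomorphic_trans:
  assumes "lattices_isomorphic L M" "lattices_isomorphic M N" shows "lattices_isomorphic L N"
proof -
  obtain f where f: "bij_betw f (carrier L) (carrier M)"
    "\<forall>x\<in>carrier L. \<forall>y\<in>carrier L. x \<sqsubseteq>\<^bsub>L\<^esub> y \<longleftrightarrow> f x \<sqsubseteq>\<^bsub>M\<^esub> f y"
    using assms(1) by (auto simp: lattices_isomorphic_def)
  obtain g where g: "bij_betw g (carrier M) (carrier N)"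
    "\<forall>x\<in>carrier M. \<forall>y\<in>carrier M. x \<sqsubseteq>\<^bsub>M\<^esub> y \<longleftrightarrow> g x \<sqsubseteq>\<^bsub>N\<^esub> g y"
    using assms(2) by (auto simp: lattices_isomorphic_def)
  have "x \<sqsubseteq>\<^bsub>L\<^esub> y \<longleftrightarrow> (g \<circ> f) x \<sqsubseteq>\<^bsub>N\<^esub> (g \<circ> f) y" if "x \<in> carrier L" "y \<in> carrier L" for x y
    using f(2) g(2) bij_betwE[OF f(1)] that by simp
  then show ?thesis using bij_betw_trans[OF f(1) g(1)] unfolding lattices_isomorphic_def by blast
qed

lemma dual_pair_iff_isomorphic:
  assumes "spectral_space X" "eq L = (=)"
  shows "(\<exists>e. dual_pair X L e) \<longleftrightarrow> lattices_isomorphic L (compact_opens X)"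
  using assms by (simp add: dual_pair_def sets_rep_def lattices_isomorphic_def compact_opens_def inclusion_order_def)

lemma cylinder_based_iff:
  "cylinder_based \<K> X \<longleftrightarrow> (\<exists>K\<in>\<K>. \<exists>e. dual_pair X (belluce (free_mv K)) e)"
proof -
  have eq: "eq (belluce (free_mv K)) = (=)" for K :: "'a set" by (simp add: belluce_def)
  have "(\<exists>e. dual_pair X (belluce (free_mv K)) e) \<longleftrightarrow>
    spectral_space X \<and> lattices_isomorphic (compact_opens X) (inv_gorder (Cypol K))" for K :: "'a set"
  proof (cases "spectral_space X")
    case True
    have "(\<exists>e. dual_pair X (belluce (free_mv K)) e) \<longleftrightarrow> lattices_isomorphic (belluce (free_mv K)) (compact_opens X)"
      by (rule dual_pair_iff_isomorphic[OF True eq])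
    also have "\<dots> \<longleftrightarrow> lattices_isomorphic (compact_opens X) (inv_gorder (Cypol K))"
      using lattices_isomorphic_trans[OF lattices_isomorphic_sym belluce_iso_Cypol[of K]]
        lattices_isomorphic_trans[OF belluce_iso_Cypol[of K] lattices_isomorphic_sym] by auto
    finally show ?thesis using True by simp
  qed (simp add: dual_pair_def)
  then show ?thesis by (simp add: cylinder_based_def)
qed

section \<open>Duals of objects inside the universe\<close>

lemma carrier_belluce_lepoll: "carrier (belluce (free_mv K)) \<lesssim> K <+> (UNIV :: nat set)"
  unfolding carrier_belluce using image_lepoll mv_terms_lepoll lepoll_trans by blast

lemma Pow_lepoll_mono: "A \<lesssim> B \<Longrightarrow> Pow A \<lesssim> Pow B"
proof -
  assume "A \<lesssim> B"
  then obtain f where f: "inj_on f A" "f ` A \<subseteq> B" by (auto simp: lepoll_def)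
  then show ?thesis unfolding lepoll_def
    by (intro exI[of _ "image f"]) (auto intro: inj_on_image_Pow)
qed

text \<open>The witnesses \<open>e\<close> and \<open>e'\<close> are arguments because the action on
  morphisms depends on them.\<close>

definition dual_objects ::
  "'u sic_object \<Rightarrow> ('k, 'u) lic_object \<Rightarrow> ('k belluce_element \<Rightarrow> 'u set) \<Rightarrow> ('u \<Rightarrow> 'u set) \<Rightarrow> bool" where
  "dual_objects = (\<lambda>(X, C, m) (B, L, f) e e'.
    dual_pair X B e \<and> dual_pair C L e' \<and> m \<in> spectral_maps C X \<and> f = hat C L e' B e m)"

theorem SIC_object_dual:
  fixes \<K> :: "'k set set"
  assumes universe: "\<And>K. K \<in> \<K> \<Longrightarrow> Pow (K <+> (UNIV :: nat set)) \<lesssim> (UNIV :: 'u set)"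
    and XCm: "(X, C, m) \<in> Obj (SIC \<K> :: ('u sic_object, 'u sic_morphism) category)"
  shows "\<exists>\<Lambda>\<in>Obj (LIC \<K>). \<exists>e e'. dual_objects (X, C, m) \<Lambda> e e'"
proof -
  have cyl: "cylinder_based \<K> X" and C: "spectral_space C" and mono: "spectral_mono C X m" and closed: "closed_map C X m"
    using XCm by (auto simp: SIC_def)
  have m: "m \<in> spectral_maps C X" using mono by (simp add: spectral_mono_def)
  have inj: "inj_on m (topspace C)" using spectral_mono_iff_inj[OF m] mono by simp
  obtain K e where K: "K \<in> \<K>" and e: "dual_pair X (belluce (free_mv K)) e"
    using cyl unfolding cylinder_based_iff by blast
  define B where "B = belluce (free_mv K)"
  interpret X: stone_dual X B e using e by (simp add: stone_dual_def B_def)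
  let ?CO = "{U. compact_openin C U}"
  have pre: "\<exists>b\<in>carrier B. U = {x \<in> topspace C. m x \<in> e b}" if U: "compact_openin C U" for U
  proof -
    obtain W where "compact_openin X W" "U = {x \<in> topspace C. m x \<in> W}"
      using closed_inj_preimage[OF X.spectral m closed inj U] by blast
    then show ?thesis using X.e_surj by blast
  qed
  \<comment> \<open>Every compact open set of \<open>C\<close> is the preimage of one named by an
    element of \<open>B\<close>. This bounds their number, so that they can be coded by elements of
    the universe, where the carrier of \<open>L\<close> has to lie.\<close>
  then have "?CO \<subseteq> (\<lambda>b. {x \<in> topspace C. m x \<in> e b}) ` carrier B" by blast
  then have "?CO \<lesssim> carrier B" by (rule subset_image_lepoll)
  also have "\<dots> \<lesssim> K <+> (UNIV :: nat set)" unfolding B_def by (rule carrier_belluce_lepoll)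
  also have "\<dots> \<lesssim> Pow (K <+> (UNIV :: nat set))" by (rule lepoll_Pow_self)
  also have "\<dots> \<lesssim> (UNIV :: 'u set)" by (rule universe[OF K])
  finally obtain j :: "'u set \<Rightarrow> 'u" where j: "inj_on j ?CO" by (auto simp: lepoll_def)
  define e' where "e' = inv_into ?CO j"
  define L where "L = (\<lparr>carrier = j ` ?CO, eq = (=), le = (\<lambda>a b. e' a \<subseteq> e' b)\<rparr> :: 'u gorder)"
  have "bij_betw e' (j ` ?CO) ?CO"
    unfolding e'_def by (rule bij_betw_inv_into) (rule inj_on_imp_bij_betw[OF j])
  then have L: "dual_pair C L e'" using C by (simp add: dual_pair_def sets_rep_def L_def)
  interpret CX: stone_dual2 C L e' X B e
    using e L by (simp add: stone_dual2_def stone_dual_def B_def)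
  define f where "f = hat C L e' B e m"
  have f: "f \<in> lattice_homs B L" unfolding f_def by (rule CX.hat_hom[OF m])
  have "carrier L \<subseteq> f ` carrier B"
  proof
    fix c assume c: "c \<in> carrier L"
    then obtain b where b: "b \<in> carrier B" "e' c = {x \<in> topspace C. m x \<in> e b}"
      using pre[of "e' c"] CX.X.e_in[OF c] by auto
    then have "e' (f b) = e' c" using CX.hat_val(2)[OF m b(1)] by (simp add: f_def)
    then have "f b = c" using CX.X.e_inj[of "f b" c] CX.hat_val(1)[OF m b(1)] c by (simp add: f_def)
    then show "c \<in> f ` carrier B" using b by blast
  qed
  then have "lattice_epi B L f" by (rule surj_imp_epi[OF f])
  moreover have "closed_map (Spec L) (Spec B) (stone_dual_map B L f)"
    using closed_map_stone_dual[OF _ L m, of B e] e closed by (simp add: B_def f_def)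
  moreover have "bounded_distributive_lattice L" by (rule CX.X.bounded_distributive_lattice_L)
  ultimately have "(B, L, f) \<in> Obj (LIC \<K>)" using K by (auto simp: LIC_def B_def)
  moreover have "dual_objects (X, C, m) (B, L, f) e e'"
    using e L m by (simp add: dual_objects_def B_def f_def)
  ultimately show ?thesis by blast
qed

text \<open>As \<open>f\<close> is an epimorphism its dual map of spectra is injective, so the
  spectrum of \<open>L\<close> is no larger than that of \<open>B\<close>. The points of the latter
  are subsets of the Belluce lattice, hence few enough for the universe.\<close>

theorem LIC_object_dual:
  fixes \<K> :: "'k set set"
  assumes universe: "\<And>K. K \<in> \<K> \<Longrightarrow> Pow (K <+> (UNIV :: nat set)) \<lesssim> (UNIV :: 'u set)"
    and \<Lambda>: "(B, L, f) \<in> Obj (LIC \<K> :: (('k, 'u) lic_object, ('k, 'u) lic_morphism) category)"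
  shows "\<exists>\<Omega>\<in>Obj (SIC \<K>). \<exists>e e'. dual_objects \<Omega> (B, L, f) e e'"
proof -
  obtain K where K: "K \<in> \<K>" "B = belluce (free_mv K)"
    and L: "bounded_distributive_lattice L" and epi: "lattice_epi B L f"
    and closed: "closed_map (Spec L) (Spec B) (stone_dual_map B L f)"
    using \<Lambda> by (auto simp: LIC_def)
  have f: "f \<in> lattice_homs B L" using epi by (simp add: lattice_epi_def)
  interpret B: bounded_distrib_lattice B
    using bounded_distributive_lattice_belluce[of K] K by (simp add: bounded_distributive_lattice_iff)
  interpret L: bounded_distrib_lattice L using L by (simp add: bounded_distributive_lattice_iff)
  have "Pow (UNIV :: nat set) \<lesssim> Pow (K <+> (UNIV :: nat set))"
    by (rule Pow_lepoll_mono) (auto simp: lepoll_def intro!: exI[of _ Inr])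
  then have "Pow (UNIV :: nat set) \<lesssim> (UNIV :: 'u set)" using universe[OF K(1)] lepoll_trans by blast
  \<comment> \<open>Supplies two distinct elements of the universe for the two-element test
    chain.\<close>
  then obtain i :: "nat set \<Rightarrow> 'u" where "inj i" by (auto simp: lepoll_def)
  then have pq: "i {} \<noteq> i UNIV" by (simp add: inj_eq)
  interpret LB: stone_dual2 "Spec L" L L.basic "Spec B" B B.basic
    using L.dual_pair_Spec B.dual_pair_Spec by (simp add: stone_dual2_def stone_dual_def)
  obtain m0 where m0: "m0 \<in> spectral_maps (Spec L) (Spec B)" "hat (Spec L) L L.basic B B.basic m0 = f"
    using LB.hat_surj[OF f] by blast
  have inj0: "inj_on m0 (topspace (Spec L))"
    using epi_imp_inj[OF L.dual_pair_Spec B.dual_pair_Spec m0(1) _ pq] epi m0(2) by simp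
  have "topspace (Spec B) \<subseteq> Pow (carrier B)" by (auto simp: B.topspace_Spec prime_ideals_def)
  then have "topspace (Spec B) \<lesssim> Pow (carrier B)" by (rule subset_imp_lepoll)
  also have "\<dots> \<lesssim> Pow (K <+> (UNIV :: nat set))"
    unfolding K(2) by (rule Pow_lepoll_mono[OF carrier_belluce_lepoll])
  also have "\<dots> \<lesssim> (UNIV :: 'u set)" by (rule universe[OF K(1)])
  finally have leB: "topspace (Spec B) \<lesssim> (UNIV :: 'u set)" .
  have "m0 ` topspace (Spec L) \<subseteq> topspace (Spec B)" using LB.maps_to[OF m0(1)] by blast
  then have "topspace (Spec L) \<lesssim> topspace (Spec B)" using inj0 by (auto simp: lepoll_def)
  then have leL: "topspace (Spec L) \<lesssim> (UNIV :: 'u set)" using leB lepoll_trans by blast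
  obtain j :: "'k belluce_element set \<Rightarrow> 'u" where "inj_on j (topspace (Spec B))"
    using leB by (auto simp: lepoll_def)
  then obtain X where X: "homeomorphic_map (Spec B) X j" using transported_topology by blast
  obtain j' :: "'u set \<Rightarrow> 'u" where "inj_on j' (topspace (Spec L))"
    using leL by (auto simp: lepoll_def)
  then obtain C where C: "homeomorphic_map (Spec L) C j'" using transported_topology by blast
  define e where "e b = j ` B.basic b" for b
  define e' where "e' b = j' ` L.basic b" for b
  have e: "dual_pair X B e" unfolding e_def[abs_def] by (rule dual_pair_transport[OF B.dual_pair_Spec X])
  have e': "dual_pair C L e'" unfolding e'_def[abs_def] by (rule dual_pair_transport[OF L.dual_pair_Spec C])
  interpret CX: stone_dual2 C L e' X B e using e e' by (simp add: stone_dual2_def stone_dual_def)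
  \<comment> \<open>The map is obtained anew from \<open>f\<close> on the transported spaces, so
    that it is dual to \<open>f\<close> by construction; \<open>m0\<close> served to bound the
    size.\<close>
  obtain m where m: "m \<in> spectral_maps C X" "hat C L e' B e m = f" using CX.hat_surj[OF f] by blast
  have "inj_on m (topspace C)" using epi_imp_inj[OF e' e m(1) _ pq] epi m(2) by simp
  then have "spectral_mono C X m" using spectral_mono_iff_inj[OF m(1)] by simp
  moreover have "closed_map C X m" using closed_map_stone_dual[OF e e' m(1)] closed m(2) by simp
  moreover have "cylinder_based \<K> X" using e K unfolding cylinder_based_iff by blast
  ultimately have "(X, C, m) \<in> Obj (SIC \<K>)" using CX.X.spectral by (simp add: SIC_def)
  moreover have "dual_objects (X, C, m) (B, L, f) e e'" using e e' m by (simp add: dual_objects_def)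
  ultimately show ?thesis by blast
qed

section \<open>The duality\<close>

lemma is_category_opposite:
  assumes "is_category C" shows "is_category (opposite C)"
proof -
  interpret is_category C by (rule assms)
  show ?thesis
    by unfold_locales
      (simp_all add: opposite_def Ident_in_Hom Comp_in_Hom Comp_Ident_right Comp_Ident_left Comp_assoc)
qed

text \<open>Essential surjectivity chooses for each \<open>P\<close> an object \<open>Go P\<close>
  and mutually inverse maps \<open>\<epsilon> P\<close> and \<open>\<delta> P\<close>. A morphism of
  \<open>D\<close> is conjugated by these, which is \<open>cnj\<close>, and pulled back along the
  bijection of hom-sets. The laws for \<open>Gm\<close> are checked after applying
  \<open>Fm\<close>, which is injective.\<close>

theorem equivalent_categoriesI:
  assumes C: "is_category C" and D: "is_category D" and F: "is_functor C D Fo Fm"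
    and ff: "\<And>A B. A \<in> Obj C \<Longrightarrow> B \<in> Obj C \<Longrightarrow> bij_betw (Fm A B) (Hom C A B) (Hom D (Fo A) (Fo B))"
    and es: "\<And>P. P \<in> Obj D \<Longrightarrow> \<exists>A\<in>Obj C. \<exists>p. isomorphism_in D (Fo A) P p"
  shows "equivalent_categories C D"
proof -
  interpret C: is_category C by (rule C)
  interpret D: is_category D by (rule D)
  interpret F: is_functor C D Fo Fm by (rule F)
  have "\<forall>P\<in>Obj D. \<exists>A p q. A \<in> Obj C \<and> p \<in> Hom D (Fo A) P \<and> q \<in> Hom D P (Fo A) \<and>
      Comp D (Fo A) P (Fo A) q p = Ident D (Fo A) \<and> Comp D P (Fo A) P p q = Ident D P"
    using es unfolding isomorphism_in_def by blast
  then obtain Go \<epsilon> \<delta> where G: "\<And>P. P \<in> Obj D \<Longrightarrow> Go P \<in> Obj C"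
    and \<epsilon>: "\<And>P. P \<in> Obj D \<Longrightarrow> \<epsilon> P \<in> Hom D (Fo (Go P)) P"
    and \<delta>: "\<And>P. P \<in> Obj D \<Longrightarrow> \<delta> P \<in> Hom D P (Fo (Go P))"
    and \<delta>\<epsilon>: "\<And>P. P \<in> Obj D \<Longrightarrow> Comp D (Fo (Go P)) P (Fo (Go P)) (\<delta> P) (\<epsilon> P) = Ident D (Fo (Go P))"
    and \<epsilon>\<delta>: "\<And>P. P \<in> Obj D \<Longrightarrow> Comp D P (Fo (Go P)) P (\<epsilon> P) (\<delta> P) = Ident D P"
    by metis
  note FO = F.functor_Obj
  have FG: "Fo (Go P) \<in> Obj D" if "P \<in> Obj D" for P using FO G that by blast
  have inj: "f = g" if "A \<in> Obj C" "B \<in> Obj C" "f \<in> Hom C A B" "g \<in> Hom C A B" "Fm A B f = Fm A B g" for A B f g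
    using ff[OF that(1,2)] that(3-5) by (auto simp: bij_betw_def inj_on_def)
  define unmap where "unmap A B = inv_into (Hom C A B) (Fm A B)" for A B
  have unmap: "unmap A B g \<in> Hom C A B" "Fm A B (unmap A B g) = g"
    if "A \<in> Obj C" "B \<in> Obj C" "g \<in> Hom D (Fo A) (Fo B)" for A B g
  proof -
    have "g \<in> Fm A B ` Hom C A B" using ff[OF that(1,2)] that(3) by (simp add: bij_betw_def)
    then show "unmap A B g \<in> Hom C A B" "Fm A B (unmap A B g) = g"
      unfolding unmap_def by (rule inv_into_into, rule f_inv_into_f)
  qed
  define cnj where "cnj P Q g = Comp D (Fo (Go P)) Q (Fo (Go Q)) (\<delta> Q) (Comp D (Fo (Go P)) P Q g (\<epsilon> P))" for P Q g
  have g_eps: "Comp D (Fo (Go P)) P Q g (\<epsilon> P) \<in> Hom D (Fo (Go P)) Q"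
    if "P \<in> Obj D" "Q \<in> Obj D" "g \<in> Hom D P Q" for P Q g
    using that FG \<epsilon> by (intro D.Comp_in_Hom[of _ P]) auto
  have cnj: "cnj P Q g \<in> Hom D (Fo (Go P)) (Fo (Go Q))"
    if "P \<in> Obj D" "Q \<in> Obj D" "g \<in> Hom D P Q" for P Q g
    unfolding cnj_def using that FG \<delta> g_eps by (intro D.Comp_in_Hom[of _ Q]) auto
  have eps_cnj: "Comp D (Fo (Go P)) (Fo (Go Q)) Q (\<epsilon> Q) (cnj P Q g) = Comp D (Fo (Go P)) P Q g (\<epsilon> P)"
    if PQ: "P \<in> Obj D" "Q \<in> Obj D" "g \<in> Hom D P Q" for P Q g
  proof -
    have "Comp D (Fo (Go P)) (Fo (Go Q)) Q (\<epsilon> Q) (cnj P Q g) =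
        Comp D (Fo (Go P)) Q Q (Comp D Q (Fo (Go Q)) Q (\<epsilon> Q) (\<delta> Q)) (Comp D (Fo (Go P)) P Q g (\<epsilon> P))"
      unfolding cnj_def using PQ FG \<delta> \<epsilon> g_eps by (intro D.Comp_assoc) auto
    then show ?thesis using PQ FG g_eps by (simp add: \<epsilon>\<delta> D.Comp_Ident_left)
  qed
  have cnj_del: "Comp D P (Fo (Go P)) (Fo (Go Q)) (cnj P Q g) (\<delta> P) = Comp D P Q (Fo (Go Q)) (\<delta> Q) g"
    if PQ: "P \<in> Obj D" "Q \<in> Obj D" "g \<in> Hom D P Q" for P Q g
  proof -
    have "Comp D P (Fo (Go P)) (Fo (Go Q)) (cnj P Q g) (\<delta> P) =
        Comp D P Q (Fo (Go Q)) (\<delta> Q) (Comp D P (Fo (Go P)) Q (Comp D (Fo (Go P)) P Q g (\<epsilon> P)) (\<delta> P))"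
      unfolding cnj_def using PQ FG \<delta> \<epsilon> g_eps by (intro D.Comp_assoc[symmetric]) auto
    also have "Comp D P (Fo (Go P)) Q (Comp D (Fo (Go P)) P Q g (\<epsilon> P)) (\<delta> P) =
        Comp D P P Q g (Comp D P (Fo (Go P)) P (\<epsilon> P) (\<delta> P))"
      using PQ FG \<delta> \<epsilon> by (intro D.Comp_assoc[symmetric]) auto
    finally show ?thesis using PQ by (simp add: \<epsilon>\<delta> D.Comp_Ident_right)
  qed
  define Gm where "Gm P Q g = unmap (Go P) (Go Q) (cnj P Q g)" for P Q g
  have Gm: "Gm P Q g \<in> Hom C (Go P) (Go Q)" "Fm (Go P) (Go Q) (Gm P Q g) = cnj P Q g"
    if "P \<in> Obj D" "Q \<in> Obj D" "g \<in> Hom D P Q" for P Q g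
    unfolding Gm_def using unmap[OF G G cnj] that by blast+
  have functor_G: "is_functor D C Go Gm"
  proof
    show "Go P \<in> Obj C" if "P \<in> Obj D" for P using G that .
    show "Gm P Q g \<in> Hom C (Go P) (Go Q)" if "P \<in> Obj D" "Q \<in> Obj D" "g \<in> Hom D P Q" for P Q g
      using Gm(1) that .
    show "Gm P P (Ident D P) = Ident C (Go P)" if P: "P \<in> Obj D" for P
    proof (rule inj[OF G[OF P] G[OF P]])
      have "cnj P P (Ident D P) = Ident D (Fo (Go P))"
        using P FG \<epsilon> by (simp add: cnj_def D.Comp_Ident_left \<delta>\<epsilon>)
      then show "Fm (Go P) (Go P) (Gm P P (Ident D P)) = Fm (Go P) (Go P) (Ident C (Go P))"
        using P G by (simp add: Gm D.Ident_in_Hom F.functor_Ident)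
    qed (use P G in \<open>auto intro: Gm D.Ident_in_Hom C.Ident_in_Hom\<close>)
    show "Gm P R (Comp D P Q R h g) = Comp C (Go P) (Go Q) (Go R) (Gm Q R h) (Gm P Q g)"
      if PQR: "P \<in> Obj D" "Q \<in> Obj D" "R \<in> Obj D" and g: "g \<in> Hom D P Q" and h: "h \<in> Hom D Q R"
      for P Q R g h
    proof (rule inj[OF G[OF PQR(1)] G[OF PQR(3)]])
      have hg: "Comp D P Q R h g \<in> Hom D P R" using D.Comp_in_Hom PQR g h .
      then show "Gm P R (Comp D P Q R h g) \<in> Hom C (Go P) (Go R)" using Gm PQR by blast
      show "Comp C (Go P) (Go Q) (Go R) (Gm Q R h) (Gm P Q g) \<in> Hom C (Go P) (Go R)"
        using PQR g h G Gm by (intro C.Comp_in_Hom) auto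
      have "cnj P R (Comp D P Q R h g) =
          Comp D (Fo (Go P)) R (Fo (Go R)) (\<delta> R) (Comp D (Fo (Go P)) Q R h (Comp D (Fo (Go P)) P Q g (\<epsilon> P)))"
        unfolding cnj_def using D.Comp_assoc[of "Fo (Go P)" P Q R "\<epsilon> P" g h] PQR g h FG \<epsilon> by simp
      also have "\<dots> = Comp D (Fo (Go P)) R (Fo (Go R)) (\<delta> R)
          (Comp D (Fo (Go P)) Q R h (Comp D (Fo (Go P)) (Fo (Go Q)) Q (\<epsilon> Q) (cnj P Q g)))"
        using eps_cnj PQR g by simp
      also have "\<dots> = Comp D (Fo (Go P)) R (Fo (Go R)) (\<delta> R)
          (Comp D (Fo (Go P)) (Fo (Go Q)) R (Comp D (Fo (Go Q)) Q R h (\<epsilon> Q)) (cnj P Q g))"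
        using D.Comp_assoc[of "Fo (Go P)" "Fo (Go Q)" Q R "cnj P Q g" "\<epsilon> Q" h] PQR g h FG \<epsilon> cnj by simp
      also have "\<dots> = Comp D (Fo (Go P)) (Fo (Go Q)) (Fo (Go R)) (cnj Q R h) (cnj P Q g)"
        unfolding cnj_def[of Q R] using PQR g h FG \<epsilon> \<delta> cnj g_eps by (intro D.Comp_assoc) auto
      finally have "cnj P R (Comp D P Q R h g) =
          Comp D (Fo (Go P)) (Fo (Go Q)) (Fo (Go R)) (cnj Q R h) (cnj P Q g)" .
      then show "Fm (Go P) (Go R) (Gm P R (Comp D P Q R h g)) =
          Fm (Go P) (Go R) (Comp C (Go P) (Go Q) (Go R) (Gm Q R h) (Gm P Q g))"
        using PQR g h hg G Gm by (simp add: F.functor_Comp)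
    qed
  qed
  \<comment> \<open>The unit is the morphism that the functor sends to
    \<open>\<delta> (Fo A)\<close>; its inverse \<open>\<theta>\<close> comes from
    \<open>\<epsilon> (Fo A)\<close> in the same way.\<close>
  define \<eta> where "\<eta> A = unmap A (Go (Fo A)) (\<delta> (Fo A))" for A
  have \<eta>: "\<eta> A \<in> Hom C A (Go (Fo A))" "Fm A (Go (Fo A)) (\<eta> A) = \<delta> (Fo A)" if "A \<in> Obj C" for A
    unfolding \<eta>_def using unmap[of A "Go (Fo A)" "\<delta> (Fo A)"] that G FO \<delta> by auto
  have iso_\<eta>: "isomorphism_in C A (Go (Fo A)) (\<eta> A)" if A: "A \<in> Obj C" for A
  proof -
    define \<theta> where "\<theta> = unmap (Go (Fo A)) A (\<epsilon> (Fo A))"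
    have \<theta>: "\<theta> \<in> Hom C (Go (Fo A)) A" "Fm (Go (Fo A)) A \<theta> = \<epsilon> (Fo A)"
      unfolding \<theta>_def using unmap[of "Go (Fo A)" A "\<epsilon> (Fo A)"] A G FO \<epsilon> by auto
    note GA = G[OF FO[OF A]]
    have "Comp C A (Go (Fo A)) A \<theta> (\<eta> A) = Ident C A"
      by (rule inj[OF A A])
        (use A GA \<theta> \<eta> FO in \<open>auto simp: F.functor_Comp F.functor_Ident \<epsilon>\<delta> intro: C.Comp_in_Hom C.Ident_in_Hom\<close>)
    moreover have "Comp C (Go (Fo A)) A (Go (Fo A)) (\<eta> A) \<theta> = Ident C (Go (Fo A))"
      by (rule inj[OF GA GA])
        (use A GA \<theta> \<eta> FO in \<open>auto simp: F.functor_Comp F.functor_Ident \<delta>\<epsilon> intro: C.Comp_in_Hom C.Ident_in_Hom\<close>)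
    ultimately show ?thesis using \<eta>[OF A] \<theta> unfolding isomorphism_in_def by blast
  qed
  have nat_\<eta>: "Comp C A B (Go (Fo B)) (\<eta> B) f =
      Comp C A (Go (Fo A)) (Go (Fo B)) (Gm (Fo A) (Fo B) (Fm A B f)) (\<eta> A)"
    if A: "A \<in> Obj C" and B: "B \<in> Obj C" and f: "f \<in> Hom C A B" for A B f
  proof (rule inj[OF A G[OF FO[OF B]]])
    have Ff: "Fm A B f \<in> Hom D (Fo A) (Fo B)" using F.functor_Hom A B f .
    note GA = G[OF FO[OF A]] and GB = G[OF FO[OF B]]
    show "Comp C A B (Go (Fo B)) (\<eta> B) f \<in> Hom C A (Go (Fo B))"
      using A B f GB \<eta>(1)[OF B] by (intro C.Comp_in_Hom) auto
    show "Comp C A (Go (Fo A)) (Go (Fo B)) (Gm (Fo A) (Fo B) (Fm A B f)) (\<eta> A) \<in> Hom C A (Go (Fo B))"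
      using A GA GB \<eta>(1)[OF A] Gm(1)[OF FO[OF A] FO[OF B] Ff] by (intro C.Comp_in_Hom) auto
    show "Fm A (Go (Fo B)) (Comp C A B (Go (Fo B)) (\<eta> B) f) =
        Fm A (Go (Fo B)) (Comp C A (Go (Fo A)) (Go (Fo B)) (Gm (Fo A) (Fo B) (Fm A B f)) (\<eta> A))"
      using A B f GA GB \<eta>[OF A] \<eta>[OF B] Gm[OF FO[OF A] FO[OF B] Ff] cnj_del[OF FO[OF A] FO[OF B] Ff]
      by (simp add: F.functor_Comp)
  qed
  have "natural_isomorphism C C (\<lambda>A. A) (\<lambda>A B f. f)
      (\<lambda>A. Go (Fo A)) (\<lambda>A B f. Gm (Fo A) (Fo B) (Fm A B f)) \<eta>"
    unfolding natural_isomorphism_def using iso_\<eta> nat_\<eta> by blast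
  moreover have "natural_isomorphism D D (\<lambda>A. Fo (Go A)) (\<lambda>A B f. Fm (Go A) (Go B) (Gm A B f))
      (\<lambda>A. A) (\<lambda>A B f. f) \<epsilon>"
    unfolding natural_isomorphism_def
  proof (intro conjI ballI)
    show "isomorphism_in D (Fo (Go P)) P (\<epsilon> P)" if "P \<in> Obj D" for P
      unfolding isomorphism_in_def using \<epsilon>[OF that] \<delta>[OF that] \<delta>\<epsilon>[OF that] \<epsilon>\<delta>[OF that] by blast
    show "Comp D (Fo (Go P)) (Fo (Go Q)) Q (\<epsilon> Q) (Fm (Go P) (Go Q) (Gm P Q g)) =
        Comp D (Fo (Go P)) P Q g (\<epsilon> P)"
      if "P \<in> Obj D" "Q \<in> Obj D" "g \<in> Hom D P Q" for P Q g
      unfolding Gm(2)[OF that] by (rule eps_cnj[OF that])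
  qed
  ultimately show ?thesis
    unfolding equivalent_categories_def using C D F functor_G by blast
qed

section \<open>The categories of spaces and of lattices in context\<close>

lemma SIC_simps:
  "Hom (SIC \<K>) (X, C, m) (Y, D, n) = {(s, t). s \<in> spectral_maps X Y \<and> t \<in> spectral_maps C D \<and>
     compose (topspace C) s m = compose (topspace C) n t}"
  "Ident (SIC \<K>) (X, C, m) = (\<lambda>x\<in>topspace X. x, \<lambda>x\<in>topspace C. x)"
  "Comp (SIC \<K>) (X, C, m) \<Omega> \<Omega>' (s', t') (s, t) = (compose (topspace X) s' s, compose (topspace C) t' t)"
  by (simp_all add: SIC_def)

lemma LIC_simps:
  "Hom (LIC \<K>) (B, L, f) (B', L', g) = {(s, t). s \<in> lattice_homs B B' \<and> t \<in> lattice_homs L L' \<and>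
     compose (carrier B) g s = compose (carrier B) t f}"
  "Ident (LIC \<K>) (B, L, f) = (\<lambda>x\<in>carrier B. x, \<lambda>x\<in>carrier L. x)"
  "Comp (LIC \<K>) (B, L, f) \<Lambda> \<Lambda>' (s', t') (s, t) = (compose (carrier B) s' s, compose (carrier L) t' t)"
  by (simp_all add: LIC_def)

lemma spectral_maps_funcset: "s \<in> spectral_maps X Y \<Longrightarrow> s \<in> topspace X \<rightarrow> topspace Y"
  and spectral_maps_extensional: "s \<in> spectral_maps X Y \<Longrightarrow> s \<in> extensional (topspace X)"
  by (auto simp: spectral_maps_def PiE_def)

lemma lattice_homs_funcset: "f \<in> lattice_homs L M \<Longrightarrow> f \<in> carrier L \<rightarrow> carrier M"
  and lattice_homs_extensional: "f \<in> lattice_homs L M \<Longrightarrow> f \<in> extensional (carrier L)"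
  by (auto simp: lattice_homs_def PiE_def)

lemma lattice_homs_compose:
  assumes L: "bounded_lattice L" and f: "f \<in> lattice_homs L M" and g: "g \<in> lattice_homs M N"
  shows "compose (carrier L) g f \<in> lattice_homs L N"
proof -
  interpret bounded_lattice L by (rule L)
  have fM: "f x \<in> carrier M" if "x \<in> carrier L" for x using lattice_homs_funcset[OF f] that by blast
  have "compose (carrier L) g f \<in> carrier L \<rightarrow>\<^sub>E carrier N"
    using fM lattice_homs_funcset[OF g] by (auto simp: compose_def)
  moreover have "compose (carrier L) g f (x \<squnion>\<^bsub>L\<^esub> y) = compose (carrier L) g f x \<squnion>\<^bsub>N\<^esub> compose (carrier L) g f y"
    "compose (carrier L) g f (x \<sqinter>\<^bsub>L\<^esub> y) = compose (carrier L) g f x \<sqinter>\<^bsub>N\<^esub> compose (carrier L) g f y"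
    if "x \<in> carrier L" "y \<in> carrier L" for x y
    using f g that fM by (simp_all add: lattice_homs_def join_pres_def meet_pres_def compose_def)
  moreover have "compose (carrier L) g f \<bottom>\<^bsub>L\<^esub> = \<bottom>\<^bsub>N\<^esub>" "compose (carrier L) g f \<top>\<^bsub>L\<^esub> = \<top>\<^bsub>N\<^esub>"
    using f g by (simp_all add: lattice_homs_def compose_def)
  moreover have "lattice L" "lattice N" using f g by (simp_all add: lattice_homs_def join_pres_def)
  ultimately show ?thesis unfolding lattice_homs_def join_pres_def meet_pres_def by blast
qed

lemma lattice_homs_id:
  assumes L: "bounded_lattice L" shows "(\<lambda>x\<in>carrier L. x) \<in> lattice_homs L L"
proof -
  interpret bounded_lattice L by (rule L)
  show ?thesis using lattice_axioms by (simp add: lattice_homs_def join_pres_def meet_pres_def)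
qed

lemma LIC_bounded_lattice:
  assumes "(B, L, f) \<in> Obj (LIC \<K>)" shows "bounded_lattice B" "bounded_lattice L"
  using assms bounded_distributive_lattice_belluce
  by (auto simp: LIC_def bounded_distributive_lattice_def)

lemma is_category_SIC: "is_category (SIC \<K>)"
proof (unfold_locales, goal_cases)
  case (1 A)
  then obtain X C m where A: "A = (X, C, m)" by (cases A)
  have m: "m \<in> spectral_maps C X" using 1 by (simp add: A SIC_def spectral_mono_def)
  show ?case
    using Id_compose[OF spectral_maps_funcset[OF m] spectral_maps_extensional[OF m]]
      compose_Id[OF spectral_maps_funcset[OF m] spectral_maps_extensional[OF m]]
    by (simp add: A SIC_simps spectral_maps_id)
next
  case (2 A B D p q)
  obtain X C m where A: "A = (X, C, m)" by (cases A)
  obtain X' C' m' where B: "B = (X', C', m')" by (cases B)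
  obtain X'' C'' m'' where D: "D = (X'', C'', m'')" by (cases D)
  obtain s t where p: "p = (s, t)" by (cases p)
  obtain s' t' where q: "q = (s', t')" by (cases q)
  have st: "s \<in> spectral_maps X X'" "t \<in> spectral_maps C C'" "compose (topspace C) s m = compose (topspace C) m' t"
    "s' \<in> spectral_maps X' X''" "t' \<in> spectral_maps C' C''" "compose (topspace C') s' m' = compose (topspace C') m'' t'"
    using 2(4,5) by (simp_all add: A B D p q SIC_simps)
  have m: "m \<in> spectral_maps C X" using 2(1) by (simp add: A SIC_def spectral_mono_def)
  have "compose (topspace C) (compose (topspace X) s' s) m = compose (topspace C) s' (compose (topspace C) s m)"
    by (rule compose_assoc[symmetric, OF spectral_maps_funcset[OF m]])
  also have "\<dots> = compose (topspace C) (compose (topspace C') s' m') t"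
    unfolding st(3) by (rule compose_assoc[OF spectral_maps_funcset[OF st(2)]])
  also have "\<dots> = compose (topspace C) m'' (compose (topspace C) t' t)"
    unfolding st(6) by (rule compose_assoc[symmetric, OF spectral_maps_funcset[OF st(2)]])
  finally show ?case using st by (simp add: A B D p q SIC_simps spectral_maps_compose)
next
  case (3 A B p)
  then show ?case
    by (cases A; cases B; cases p)
      (auto simp: SIC_simps intro!: compose_Id spectral_maps_funcset spectral_maps_extensional)
next
  case (4 A B p)
  then show ?case
    by (cases A; cases B; cases p)
      (auto simp: SIC_simps intro!: Id_compose spectral_maps_funcset spectral_maps_extensional)
next
  case (5 A B D E p q r)
  then show ?case
    by (cases A; cases B; cases D; cases E; cases p; cases q; cases r)
      (auto simp: SIC_simps intro!: compose_assoc spectral_maps_funcset)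
qed

lemma is_category_LIC: "is_category (LIC \<K>)"
proof (unfold_locales, goal_cases)
  case (1 A)
  then obtain B L f where A: "A = (B, L, f)" by (cases A)
  have f: "f \<in> lattice_homs B L" using 1 by (simp add: A LIC_def lattice_epi_def)
  show ?case
    using Id_compose[OF lattice_homs_funcset[OF f] lattice_homs_extensional[OF f]]
      compose_Id[OF lattice_homs_funcset[OF f] lattice_homs_extensional[OF f]]
      LIC_bounded_lattice[OF 1[unfolded A]]
    by (simp add: A LIC_simps lattice_homs_id)
next
  case (2 A1 A2 A3 p q)
  obtain B L f where A: "A1 = (B, L, f)" by (cases A1)
  obtain B' L' f' where B: "A2 = (B', L', f')" by (cases A2)
  obtain B'' L'' f'' where D: "A3 = (B'', L'', f'')" by (cases A3)
  obtain s t where p: "p = (s, t)" by (cases p)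
  obtain s' t' where q: "q = (s', t')" by (cases q)
  have st: "s \<in> lattice_homs B B'" "t \<in> lattice_homs L L'" "compose (carrier B) f' s = compose (carrier B) t f"
    "s' \<in> lattice_homs B' B''" "t' \<in> lattice_homs L' L''" "compose (carrier B') f'' s' = compose (carrier B') t' f'"
    using 2(4,5) by (simp_all add: A B D p q LIC_simps)
  have f: "f \<in> lattice_homs B L" using 2(1) by (simp add: A LIC_def lattice_epi_def)
  have "compose (carrier B) f'' (compose (carrier B) s' s) = compose (carrier B) (compose (carrier B') f'' s') s"
    by (rule compose_assoc[OF lattice_homs_funcset[OF st(1)]])
  also have "\<dots> = compose (carrier B) t' (compose (carrier B) f' s)"
    unfolding st(6) by (rule compose_assoc[symmetric, OF lattice_homs_funcset[OF st(1)]])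
  also have "\<dots> = compose (carrier B) (compose (carrier L) t' t) f"
    unfolding st(3) by (rule compose_assoc[OF lattice_homs_funcset[OF f]])
  finally show ?case
    using st LIC_bounded_lattice[OF 2(1)[unfolded A]] by (simp add: A B D p q LIC_simps lattice_homs_compose)
next
  case (3 A B p)
  then show ?case
    by (cases A; cases B; cases p)
      (auto simp: LIC_simps intro!: compose_Id lattice_homs_funcset lattice_homs_extensional)
next
  case (4 A B p)
  then show ?case
    by (cases A; cases B; cases p)
      (auto simp: LIC_simps intro!: Id_compose lattice_homs_funcset lattice_homs_extensional)
next
  case (5 A B D E p q r)
  then show ?case
    by (cases A; cases B; cases D; cases E; cases p; cases q; cases r)
      (auto simp: LIC_simps intro!: compose_assoc lattice_homs_funcset)
qed

section \<open>The contravariant action on morphisms\<close>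

definition hat_pair ::
  "'u sic_object \<Rightarrow> ('k, 'u) lic_object \<Rightarrow> ('k belluce_element \<Rightarrow> 'u set) \<Rightarrow> ('u \<Rightarrow> 'u set) \<Rightarrow>
    ('k, 'u) lic_object \<Rightarrow> ('k belluce_element \<Rightarrow> 'u set) \<Rightarrow> ('u \<Rightarrow> 'u set) \<Rightarrow>
    'u sic_morphism \<Rightarrow> ('k, 'u) lic_morphism" where
  "hat_pair = (\<lambda>(X, C, m) (B, L, f) e e' (B', L', f') d d' (s, t). (hat X B e B' d s, hat C L e' L' d' t))"

lemma hat_pair_bij:
  assumes "dual_objects \<Omega> \<Lambda> e e'" "dual_objects \<Omega>' \<Lambda>' d d'"
  shows "bij_betw (hat_pair \<Omega> \<Lambda> e e' \<Lambda>' d d') (Hom (SIC \<K>) \<Omega> \<Omega>') (Hom (LIC \<K>) \<Lambda>' \<Lambda>)"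
proof -
  obtain X C m where \<Omega>: "\<Omega> = (X, C, m)" by (cases \<Omega>)
  obtain Y D n where \<Omega>': "\<Omega>' = (Y, D, n)" by (cases \<Omega>')
  obtain B L f where \<Lambda>: "\<Lambda> = (B, L, f)" by (cases \<Lambda>)
  obtain B' L' f' where \<Lambda>': "\<Lambda>' = (B', L', f')" by (cases \<Lambda>')
  have X: "dual_pair X B e" and C: "dual_pair C L e'" and m: "m \<in> spectral_maps C X" and f: "f = hat C L e' B e m"
    using assms(1) by (simp_all add: dual_objects_def \<Omega> \<Lambda>)
  have Y: "dual_pair Y B' d" and D: "dual_pair D L' d'" and n: "n \<in> spectral_maps D Y" and f': "f' = hat D L' d' B' d n"
    using assms(2) by (simp_all add: dual_objects_def \<Omega>' \<Lambda>')
  interpret XY: stone_dual2 X B e Y B' d using X Y by (simp add: stone_dual2_def stone_dual_def)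
  interpret CD: stone_dual2 C L e' D L' d' using C D by (simp add: stone_dual2_def stone_dual_def)
  interpret CY: stone_dual2 C L e' Y B' d using C Y by (simp add: stone_dual2_def stone_dual_def)
  \<comment> \<open>Both composites are spectral maps from \<open>C\<close> to \<open>Y\<close>.
    Dualizing such maps is injective and reverses composition, so one square commutes exactly when
    the other does.\<close>
  have square: "compose (topspace C) s m = compose (topspace C) n t \<longleftrightarrow>
      compose (carrier B') f (XY.hatXY s) = compose (carrier B') (CD.hatXY t) f'"
    if s: "s \<in> spectral_maps X Y" and t: "t \<in> spectral_maps C D" for s t
  proof -
    have "compose (topspace C) s m = compose (topspace C) n t \<longleftrightarrow>
        CY.hatXY (compose (topspace C) s m) = CY.hatXY (compose (topspace C) n t)"
      using CY.hat_inj[OF spectral_maps_compose[OF m s] spectral_maps_compose[OF t n]] by auto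
    then show ?thesis
      unfolding hat_compose[OF C X Y m s] hat_compose[OF C D Y t n] f f' .
  qed
  show ?thesis
    unfolding bij_betw_def
  proof
    show "inj_on (hat_pair \<Omega> \<Lambda> e e' \<Lambda>' d d') (Hom (SIC \<K>) \<Omega> \<Omega>')"
    proof (rule inj_onI)
      fix p q assume pq: "p \<in> Hom (SIC \<K>) \<Omega> \<Omega>'" "q \<in> Hom (SIC \<K>) \<Omega> \<Omega>'"
        "hat_pair \<Omega> \<Lambda> e e' \<Lambda>' d d' p = hat_pair \<Omega> \<Lambda> e e' \<Lambda>' d d' q"
      obtain s t where p: "p = (s, t)" by (cases p)
      obtain s' t' where q: "q = (s', t')" by (cases q)
      show "p = q"
        using pq XY.hat_inj[of s s'] CD.hat_inj[of t t'] by (simp add: p q \<Omega> \<Omega>' \<Lambda> \<Lambda>' SIC_simps hat_pair_def)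
    qed
    show "hat_pair \<Omega> \<Lambda> e e' \<Lambda>' d d' ` Hom (SIC \<K>) \<Omega> \<Omega>' = Hom (LIC \<K>) \<Lambda>' \<Lambda>"
    proof (intro equalityI subsetI)
      fix r assume "r \<in> hat_pair \<Omega> \<Lambda> e e' \<Lambda>' d d' ` Hom (SIC \<K>) \<Omega> \<Omega>'"
      then obtain s t where st: "(s, t) \<in> Hom (SIC \<K>) \<Omega> \<Omega>'" "r = hat_pair \<Omega> \<Lambda> e e' \<Lambda>' d d' (s, t)" by auto
      then show "r \<in> Hom (LIC \<K>) \<Lambda>' \<Lambda>"
        using square[of s t] XY.hat_hom[of s] CD.hat_hom[of t]
        by (simp add: \<Omega> \<Omega>' \<Lambda> \<Lambda>' SIC_simps LIC_simps hat_pair_def)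
    next
      fix r assume r: "r \<in> Hom (LIC \<K>) \<Lambda>' \<Lambda>"
      obtain \<phi> \<psi> where \<phi>\<psi>: "r = (\<phi>, \<psi>)" by (cases r)
      obtain s where s: "s \<in> spectral_maps X Y" "XY.hatXY s = \<phi>"
        using XY.hat_surj[of \<phi>] r by (auto simp: \<phi>\<psi> \<Lambda> \<Lambda>' LIC_simps)
      obtain t where t: "t \<in> spectral_maps C D" "CD.hatXY t = \<psi>"
        using CD.hat_surj[of \<psi>] r by (auto simp: \<phi>\<psi> \<Lambda> \<Lambda>' LIC_simps)
      have "(s, t) \<in> Hom (SIC \<K>) \<Omega> \<Omega>'"
        using s t r square[OF s(1) t(1)] by (simp add: \<phi>\<psi> \<Omega> \<Omega>' \<Lambda> \<Lambda>' SIC_simps LIC_simps)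
      moreover have "r = hat_pair \<Omega> \<Lambda> e e' \<Lambda>' d d' (s, t)"
        using s t by (simp add: \<phi>\<psi> \<Omega> \<Lambda> \<Lambda>' hat_pair_def)
      ultimately show "r \<in> hat_pair \<Omega> \<Lambda> e e' \<Lambda>' d d' ` Hom (SIC \<K>) \<Omega> \<Omega>'" by blast
    qed
  qed
qed

lemma hat_pair_Comp:
  assumes "dual_objects \<Omega> \<Lambda> e e'" "dual_objects \<Omega>' \<Lambda>' d d'" "dual_objects \<Omega>'' \<Lambda>'' c c'"
    and "p \<in> Hom (SIC \<K>) \<Omega> \<Omega>'" "q \<in> Hom (SIC \<K>) \<Omega>' \<Omega>''"
  shows "hat_pair \<Omega> \<Lambda> e e' \<Lambda>'' c c' (Comp (SIC \<K>) \<Omega> \<Omega>' \<Omega>'' q p) =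
    Comp (LIC \<K>) \<Lambda>'' \<Lambda>' \<Lambda> (hat_pair \<Omega> \<Lambda> e e' \<Lambda>' d d' p) (hat_pair \<Omega>' \<Lambda>' d d' \<Lambda>'' c c' q)"
  using assms
  by (cases \<Omega>; cases \<Omega>'; cases \<Omega>''; cases \<Lambda>; cases \<Lambda>'; cases \<Lambda>''; cases p; cases q)
    (auto simp: hat_pair_def dual_objects_def SIC_simps LIC_simps intro!: hat_compose)

lemma hat_pair_Ident:
  assumes "dual_objects \<Omega> \<Lambda> e e'"
  shows "hat_pair \<Omega> \<Lambda> e e' \<Lambda> e e' (Ident (SIC \<K>) \<Omega>) = Ident (LIC \<K>) \<Lambda>"
  using assms
  by (cases \<Omega>; cases \<Lambda>) (auto simp: hat_pair_def dual_objects_def SIC_simps LIC_simps hat_id)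

lemma opposite_simps:
  "Obj (opposite C) = Obj C" "Hom (opposite C) A B = Hom C B A" "Ident (opposite C) = Ident C"
  "Comp (opposite C) A B D g f = Comp C D B A f g"
  by (simp_all add: opposite_def)

text \<open>The identity of \<open>\<Omega>\<close>, dualized with respect to the two systems of
  witnesses, gives maps in both directions whose composites are dual to the identity again. This
  makes the chosen dual interchangeable with any other.\<close>

lemma dual_objects_isomorphic:
  assumes \<Omega>: "\<Omega> \<in> Obj (SIC \<K>)" and 1: "dual_objects \<Omega> \<Lambda> e e'" and 2: "dual_objects \<Omega> \<Lambda>' d d'"
  shows "isomorphism_in (opposite (LIC \<K>)) \<Lambda> \<Lambda>' (hat_pair \<Omega> \<Lambda> e e' \<Lambda>' d d' (Ident (SIC \<K>) \<Omega>))"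
proof -
  interpret is_category "SIC \<K>" by (rule is_category_SIC)
  note id = Ident_in_Hom[OF \<Omega>]
  have idid: "Comp (SIC \<K>) \<Omega> \<Omega> \<Omega> (Ident (SIC \<K>) \<Omega>) (Ident (SIC \<K>) \<Omega>) = Ident (SIC \<K>) \<Omega>"
    by (rule Comp_Ident_left[OF \<Omega> \<Omega> id])
  have hom: "hat_pair \<Omega> \<Lambda> e e' \<Lambda>' d d' (Ident (SIC \<K>) \<Omega>) \<in> Hom (LIC \<K>) \<Lambda>' \<Lambda>"
    "hat_pair \<Omega> \<Lambda>' d d' \<Lambda> e e' (Ident (SIC \<K>) \<Omega>) \<in> Hom (LIC \<K>) \<Lambda> \<Lambda>'"
    using bij_betwE[OF hat_pair_bij[OF 1 2]] bij_betwE[OF hat_pair_bij[OF 2 1]] id by blast+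
  show ?thesis
    unfolding isomorphism_in_def opposite_simps
    using hom hat_pair_Comp[OF 1 2 1 id id] hat_pair_Comp[OF 2 1 2 id id]
      hat_pair_Ident[OF 1] hat_pair_Ident[OF 2] unfolding idid by metis
qed

theorem theorem5p12:
  fixes \<K> :: "'k set set"
  assumes universe: "\<And>K. K \<in> \<K> \<Longrightarrow> Pow (K <+> (UNIV :: nat set)) \<lesssim> (UNIV :: 'u set)"
  shows "equivalent_categories
    (SIC \<K> :: ('u sic_object, 'u sic_morphism) category)
    (opposite (LIC \<K> :: (('k, 'u) lic_object, ('k, 'u) lic_morphism) category))"
proof -
  have "\<forall>\<Omega>\<in>Obj (SIC \<K> :: ('u sic_object, 'u sic_morphism) category).
      \<exists>\<Lambda> e e'. \<Lambda> \<in> Obj (LIC \<K> :: (('k, 'u) lic_object, ('k, 'u) lic_morphism) category) \<and> dual_objects \<Omega> \<Lambda> e e'"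
    using SIC_object_dual[OF universe] by (metis prod_cases3)
  then obtain Fo E E' where Fo: "\<And>\<Omega> :: 'u sic_object. \<Omega> \<in> Obj (SIC \<K>) \<Longrightarrow>
      Fo \<Omega> \<in> Obj (LIC \<K> :: (('k, 'u) lic_object, ('k, 'u) lic_morphism) category)"
    and dual: "\<And>\<Omega>. \<Omega> \<in> Obj (SIC \<K>) \<Longrightarrow> dual_objects \<Omega> (Fo \<Omega>) (E \<Omega>) (E' \<Omega>)"
    by metis
  define Fm where "Fm \<Omega> \<Omega>' = hat_pair \<Omega> (Fo \<Omega>) (E \<Omega>) (E' \<Omega>) (Fo \<Omega>') (E \<Omega>') (E' \<Omega>')" for \<Omega> \<Omega>'
  have ff: "bij_betw (Fm \<Omega> \<Omega>') (Hom (SIC \<K>) \<Omega> \<Omega>') (Hom (opposite (LIC \<K>)) (Fo \<Omega>) (Fo \<Omega>'))"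
    if "\<Omega> \<in> Obj (SIC \<K>)" "\<Omega>' \<in> Obj (SIC \<K>)" for \<Omega> \<Omega>'
    unfolding Fm_def opposite_simps by (rule hat_pair_bij[OF dual dual]) (fact that)+
  show ?thesis
  proof (rule equivalent_categoriesI[OF is_category_SIC is_category_opposite[OF is_category_LIC] _ ff])
    show "is_functor (SIC \<K>) (opposite (LIC \<K>)) Fo Fm"
    proof
      show "Fo \<Omega> \<in> Obj (opposite (LIC \<K>))" if "\<Omega> \<in> Obj (SIC \<K>)" for \<Omega>
        using Fo[OF that] by (simp add: opposite_simps)
      show "Fm \<Omega> \<Omega>' p \<in> Hom (opposite (LIC \<K>)) (Fo \<Omega>) (Fo \<Omega>')"
        if "\<Omega> \<in> Obj (SIC \<K>)" "\<Omega>' \<in> Obj (SIC \<K>)" "p \<in> Hom (SIC \<K>) \<Omega> \<Omega>'" for \<Omega> \<Omega>' p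
        using bij_betwE[OF ff[OF that(1,2)]] that(3) by blast
      show "Fm \<Omega> \<Omega> (Ident (SIC \<K>) \<Omega>) = Ident (opposite (LIC \<K>)) (Fo \<Omega>)" if "\<Omega> \<in> Obj (SIC \<K>)" for \<Omega>
        unfolding Fm_def opposite_simps by (rule hat_pair_Ident[OF dual[OF that]])
      show "Fm \<Omega> \<Omega>'' (Comp (SIC \<K>) \<Omega> \<Omega>' \<Omega>'' q p) =
          Comp (opposite (LIC \<K>)) (Fo \<Omega>) (Fo \<Omega>') (Fo \<Omega>'') (Fm \<Omega>' \<Omega>'' q) (Fm \<Omega> \<Omega>' p)"
        if "\<Omega> \<in> Obj (SIC \<K>)" "\<Omega>' \<in> Obj (SIC \<K>)" "\<Omega>'' \<in> Obj (SIC \<K>)"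
          "p \<in> Hom (SIC \<K>) \<Omega> \<Omega>'" "q \<in> Hom (SIC \<K>) \<Omega>' \<Omega>''" for \<Omega> \<Omega>' \<Omega>'' p q
        unfolding Fm_def opposite_simps
        by (rule hat_pair_Comp[OF dual dual dual]) (fact that)+
    qed
  next
    fix \<Lambda> assume "\<Lambda> \<in> Obj (opposite (LIC \<K> :: (('k, 'u) lic_object, ('k, 'u) lic_morphism) category))"
    then have \<Lambda>: "\<Lambda> \<in> Obj (LIC \<K>)" by (simp add: opposite_simps)
    obtain B L f where BLf: "\<Lambda> = (B, L, f)" by (cases \<Lambda>)
    \<comment> \<open>\<open>\<Lambda>\<close> is a dual of this \<open>\<Omega>\<close>, though not
      necessarily the chosen dual \<open>Fo \<Omega>\<close>; any two duals of one object are
      isomorphic.\<close>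
    from LIC_object_dual[OF universe \<Lambda>[unfolded BLf]]
    obtain \<Omega> e e' where \<Omega>: "\<Omega> \<in> Obj (SIC \<K>)" "dual_objects \<Omega> \<Lambda> e e'"
      unfolding BLf by blast
    show "\<exists>\<Omega>\<in>Obj (SIC \<K>). \<exists>p. isomorphism_in (opposite (LIC \<K>)) (Fo \<Omega>) \<Lambda> p"
      using dual_objects_isomorphic[OF \<Omega>(1) dual[OF \<Omega>(1)] \<Omega>(2)] \<Omega>(1) by blast
  qed
qed

end
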